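(* There is a Tauberian operator $T : L_1(0,1) \to L_1(0,1)$ whose null space $\mathcal{N}(T) = \{x : Tx = 0\}$ is infinite dimensional. Consequently, $T$ is not upper semi-Fredholm.
   Context: "Operator" means bounded linear operator between Banach spaces. $L_1(0,1)$ is the usual Lebesgue space of the interval $(0,1)$ with Lebesgue measure. An operator $T$ from a Banach space $X$ into a Banach space $Y$ is called Tauberian if $(T^{**})^{-1}(Y) = X$, where $T^{**} : X^{**} \to Y^{**}$ is the second adjoint and $X$, $Y$ are identified with their canonical images in $X^{**}$, $Y^{**}$; i.e. whenever $x^{**} \in X^{**}$ and $T^{**}x^{**} \in Y$, then $x^{**} \in X$. An operator $T$ is upper semi-Fredholm if its range is closed and its null space is finite dimensional. *)

theory Defs
  imports "HOL-Analysis.Analysis"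
begin

section \<open>The real Banach space \<open>L\<^sub>1(0,1)\<close>\<close>

abbreviation lebesgue_01 :: "real measure" where
  "lebesgue_01 \<equiv> lebesgue_on {0<..<1}"

definition L1_eq :: "(real \<Rightarrow> real) \<Rightarrow> (real \<Rightarrow> real) \<Rightarrow> bool" where
  "L1_eq f g \<longleftrightarrow>
     integrable lebesgue_01 f \<and> integrable lebesgue_01 g \<and> (AE x in lebesgue_01. f x = g x)"

lemma part_equivp_L1_eq: "part_equivp L1_eq"
proof (rule part_equivpI)
  show "\<exists>f. L1_eq f f"
    by (rule exI[of _ "\<lambda>_. 0"]) (simp add: L1_eq_def)
  show "symp L1_eq"
    by (rule sympI) (auto simp: L1_eq_def elim: AE_mp)
  show "transp L1_eq"
    by (rule transpI) (auto simp: L1_eq_def elim: AE_mp)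
qed

quotient_type L1 = "real \<Rightarrow> real" / partial: L1_eq
  by (rule part_equivp_L1_eq)

instantiation L1 :: real_vector
begin

lift_definition zero_L1 :: L1 is "\<lambda>_. 0"
  by (simp add: L1_eq_def)

lift_definition plus_L1 :: "L1 \<Rightarrow> L1 \<Rightarrow> L1" is "\<lambda>f g x. f x + g x"
  unfolding L1_eq_def by (auto elim: AE_mp)

lift_definition minus_L1 :: "L1 \<Rightarrow> L1 \<Rightarrow> L1" is "\<lambda>f g x. f x - g x"
  unfolding L1_eq_def by (auto elim: AE_mp)

lift_definition uminus_L1 :: "L1 \<Rightarrow> L1" is "\<lambda>f x. - f x"
  unfolding L1_eq_def by (auto elim: AE_mp)

lift_definition scaleR_L1 :: "real \<Rightarrow> L1 \<Rightarrow> L1" is "\<lambda>c f x. c * f x"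
  unfolding L1_eq_def by (auto elim: AE_mp)

instance
  by standard (transfer, auto simp: L1_eq_def algebra_simps)+

end

instantiation L1 :: real_normed_vector
begin

lift_definition norm_L1 :: "L1 \<Rightarrow> real" is "\<lambda>f. \<integral>x. \<bar>f x\<bar> \<partial>lebesgue_01"
  unfolding L1_eq_def by (intro integral_cong_AE) (auto elim: AE_mp)

definition dist_L1 :: "L1 \<Rightarrow> L1 \<Rightarrow> real" where
  "dist_L1 f g = norm (f - g)"

definition sgn_L1 :: "L1 \<Rightarrow> L1" where
  "sgn_L1 f = inverse (norm f) *\<^sub>R f"

definition [code del]:
  "(uniformity :: (L1 \<times> L1) filter) = (INF e\<in>{0<..}. principal {(x, y). dist x y < e})"

definition open_L1 :: "L1 set \<Rightarrow> bool" where
  [code del]: "open_L1 S = (\<forall>x\<in>S. \<forall>\<^sub>F (x', y) in uniformity. x' = x \<longrightarrow> y \<in> S)"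

instance
proof
  fix f g :: L1 and c :: real
  show "norm f = 0 \<longleftrightarrow> f = 0"
    by transfer (auto simp: L1_eq_def integral_nonneg_eq_0_iff_AE)
  show "norm (f + g) \<le> norm f + norm g"
  proof transfer
    fix f g assume "L1_eq f f" "L1_eq g g"
    then have fg: "integrable lebesgue_01 f" "integrable lebesgue_01 g"
      by (auto simp: L1_eq_def)
    then have "(\<integral>x. \<bar>f x + g x\<bar> \<partial>lebesgue_01) \<le> (\<integral>x. \<bar>f x\<bar> + \<bar>g x\<bar> \<partial>lebesgue_01)"
      by (intro integral_mono) auto
    with fg show "(\<integral>x. \<bar>f x + g x\<bar> \<partial>lebesgue_01)
        \<le> (\<integral>x. \<bar>f x\<bar> \<partial>lebesgue_01) + (\<integral>x. \<bar>g x\<bar> \<partial>lebesgue_01)"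
      by simp
  qed
  show "norm (c *\<^sub>R f) = \<bar>c\<bar> * norm f"
    by transfer (simp add: abs_mult)
qed (simp_all add: dist_L1_def sgn_L1_def uniformity_L1_def open_L1_def)

end

instance L1 :: banach
proof
  fix X :: "nat \<Rightarrow> L1"
  assume X: "Cauchy X"
  define s where "s n = rep_L1 (X n)" for n
  have s_eq: "L1_eq (s n) (s n)" for n
    unfolding s_def by (rule Quotient3_rep_reflp[OF Quotient3_L1])
  then have s_int: "integrable lebesgue_01 (s n)" for n
    by (simp add: L1_eq_def)
  have X_s: "X n = abs_L1 (s n)" for n
    unfolding s_def by (rule Quotient3_abs_rep[OF Quotient3_L1, symmetric])
  have norm_abs: "norm (abs_L1 f - abs_L1 g) = (\<integral>x. \<bar>f x - g x\<bar> \<partial>lebesgue_01)"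
    if "L1_eq f f" "L1_eq g g" for f g
    using that by (subst minus_L1.abs_eq, simp, simp, subst norm_L1.abs_eq) (auto simp: L1_eq_def)
  have cau: "\<exists>N. \<forall>i\<ge>N. \<forall>j\<ge>N. (\<integral>x. norm (s i x - s j x) \<partial>lebesgue_01) < e"
    if "e > 0" for e
    using X that unfolding Cauchy_def dist_norm X_s by (simp add: norm_abs s_eq)
  obtain r where r: "strict_mono r" "AE x in lebesgue_01. Cauchy (\<lambda>i. s (r i) x)"
    using cauchy_L1_AE_cauchy_subseq[OF s_int cau] by blast
  define h where "h x = lim (\<lambda>i. s (r i) x)" for x
  have h_meas [measurable]: "h \<in> borel_measurable lebesgue_01"
    unfolding h_def using s_int by (intro borel_measurable_lim_metric) auto
  have s_meas [measurable]: "s n \<in> borel_measurable lebesgue_01" for n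
    using s_int by auto
  have lim: "AE x in lebesgue_01. (\<lambda>i. s (r i) x) \<longlonglongrightarrow> h x"
    using r(2) by eventually_elim (simp add: h_def Cauchy_convergent convergent_LIMSEQ_iff[symmetric])
  have fatou: "(\<integral>\<^sup>+x. ennreal \<bar>s n x - h x\<bar> \<partial>lebesgue_01) \<le> ennreal e"
    if N: "\<forall>i\<ge>N. \<forall>j\<ge>N. (\<integral>x. norm (s i x - s j x) \<partial>lebesgue_01) < e" and n: "n \<ge> N" for e N n
  proof -
    have "(\<integral>\<^sup>+x. ennreal \<bar>s n x - h x\<bar> \<partial>lebesgue_01)
        = (\<integral>\<^sup>+x. liminf (\<lambda>i. ennreal \<bar>s n x - s (r i) x\<bar>) \<partial>lebesgue_01)"
    proof (rule nn_integral_cong_AE, use lim in eventually_elim)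
      fix x assume "(\<lambda>i. s (r i) x) \<longlonglongrightarrow> h x"
      then have "(\<lambda>i. ennreal \<bar>s n x - s (r i) x\<bar>) \<longlonglongrightarrow> ennreal \<bar>s n x - h x\<bar>"
        by (intro tendsto_intros)
      then show "ennreal \<bar>s n x - h x\<bar> = liminf (\<lambda>i. ennreal \<bar>s n x - s (r i) x\<bar>)"
        by (intro lim_imp_Liminf[symmetric]) simp_all
    qed
    also have "\<dots> \<le> liminf (\<lambda>i. \<integral>\<^sup>+x. ennreal \<bar>s n x - s (r i) x\<bar> \<partial>lebesgue_01)"
      by (rule nn_integral_liminf) measurable
    also have "\<dots> \<le> limsup (\<lambda>i. \<integral>\<^sup>+x. ennreal \<bar>s n x - s (r i) x\<bar> \<partial>lebesgue_01)"
      by (rule Liminf_le_Limsup) simp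
    also have "\<dots> \<le> ennreal e"
    proof (rule Limsup_bounded, rule eventually_sequentiallyI[of N])
      fix i assume "i \<ge> N"
      then have "r i \<ge> N"
        using seq_suble[OF r(1), of i] by linarith
      then show "(\<integral>\<^sup>+x. ennreal \<bar>s n x - s (r i) x\<bar> \<partial>lebesgue_01) \<le> ennreal e"
        using N n s_int
        by (subst nn_integral_eq_integral) (auto intro!: ennreal_leI simp: less_imp_le)
    qed
    finally show ?thesis .
  qed
  have h_int: "integrable lebesgue_01 h"
  proof -
    obtain N where N: "\<forall>i\<ge>N. \<forall>j\<ge>N. (\<integral>x. norm (s i x - s j x) \<partial>lebesgue_01) < 1"
      using cau[of 1] by auto
    have "integrable lebesgue_01 (\<lambda>x. s N x - h x)"
      using fatou[OF N order_refl]
      by (intro integrableI_bounded) (auto intro: le_less_trans[OF _ ennreal_one_less_top])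
    from Bochner_Integration.integrable_diff[OF s_int[of N] this] show ?thesis
      by simp
  qed
  then have h_eq: "L1_eq h h"
    by (simp add: L1_eq_def)
  have "X \<longlonglongrightarrow> abs_L1 h"
  proof (rule metric_LIMSEQ_I)
    fix e :: real assume e: "e > 0"
    then obtain N where
      N: "\<forall>i\<ge>N. \<forall>j\<ge>N. (\<integral>x. norm (s i x - s j x) \<partial>lebesgue_01) < e / 2"
      using cau[of "e / 2"] by auto
    have "dist (X n) (abs_L1 h) < e" if "n \<ge> N" for n
    proof -
      have "ennreal (\<integral>x. \<bar>s n x - h x\<bar> \<partial>lebesgue_01) \<le> ennreal (e / 2)"
        using fatou[OF N that] s_int[of n] h_int
        by (subst nn_integral_eq_integral[symmetric]) auto
      then have "(\<integral>x. \<bar>s n x - h x\<bar> \<partial>lebesgue_01) \<le> e / 2"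
        using e by (subst (asm) ennreal_le_iff) auto
      then show ?thesis
        using e by (simp add: dist_norm X_s norm_abs[OF s_eq h_eq])
    qed
    then show "\<exists>N. \<forall>n\<ge>N. dist (X n) (abs_L1 h) < e"
      by blast
  qed
  then show "convergent X"
    by (rule convergentI)
qed


section \<open>Duals, Tauberian and upper semi-Fredholm operators\<close>

type_synonym 'a dual = "'a \<Rightarrow>\<^sub>L real"

lift_definition dual_adjoint ::
  "('a::real_normed_vector \<Rightarrow>\<^sub>L 'b::real_normed_vector) \<Rightarrow> 'b dual \<Rightarrow>\<^sub>L 'a dual"
  is "\<lambda>T \<phi>. \<phi> o\<^sub>L T"
  by (rule bounded_bilinear.bounded_linear_left[OF bounded_bilinear_blinfun_compose])

lift_definition canonical_embedding :: "'a::real_normed_vector \<Rightarrow> 'a dual dual"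
  is "\<lambda>x \<phi>. blinfun_apply \<phi> x"
  by (rule blinfun.bounded_linear_left)

definition tauberian :: "('a::banach \<Rightarrow>\<^sub>L 'b::banach) \<Rightarrow> bool" where
  "tauberian T \<longleftrightarrow>
     blinfun_apply (dual_adjoint (dual_adjoint T)) -` range canonical_embedding
       = range canonical_embedding"

definition null_space :: "('a::real_normed_vector \<Rightarrow>\<^sub>L 'b::real_normed_vector) \<Rightarrow> 'a set" where
  "null_space T = {x. blinfun_apply T x = 0}"

text \<open>
  \<^const>\<open>dim\<close> does not distinguish infinite-dimensional subspaces from the zero space:
  it is \<open>0\<close> on both.
\<close>

definition finite_dimensional :: "'a::real_vector set \<Rightarrow> bool" where
  "finite_dimensional S \<longleftrightarrow> (\<exists>B. finite B \<and> span B = S)"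

definition upper_semi_fredholm :: "('a::banach \<Rightarrow>\<^sub>L 'b::banach) \<Rightarrow> bool" where
  "upper_semi_fredholm T \<longleftrightarrow>
     closed (range (blinfun_apply T)) \<and> finite_dimensional (null_space T)"

end

theory Submission
  imports Defs "HOL-Complex_Analysis.Great_Picard"
begin

text \<open>
  The proof rests on a criterion: an operator \<open>T\<close> on \<open>L\<^sub>1(0,1)\<close> is Tauberian once it is bounded below
  on all functions whose support has measure less than some fixed \<open>\<delta> > 0\<close>
  (\<open>tauberian_of_bounded_below_on_small_support\<close>). An element of the bidual is the sum of a function
  and a singular functional \<open>\<sigma>\<close>, which lives on sets of arbitrarily small measure
  (\<open>bidual_L1_decomposition\<close>). If \<open>T**\<sigma>\<close> is a function, Helly's theorem (\<open>helly_bidual\<close>) approximates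
  \<open>\<sigma>\<close> by functions \<open>u\<^sub>k\<close> on such small sets for which \<open>T u\<^sub>k\<close> converges in norm. The lower bound
  makes \<open>u\<^sub>k\<close> converge as well; the limit lives on a null set, so it is zero, and hence \<open>\<sigma> = 0\<close>.

  It remains to find an operator that is bounded below on small supports but has a large kernel.
  In finite dimensions this is the adjacency operator from \<open>5n\<close> left to \<open>2n\<close> right vertices of an
  unbalanced bipartite graph of left degree 8 in which every small set \<open>A\<close> of left vertices has at
  least \<open>6|A|\<close> neighbours. So few edges collide that no cancellation can destroy the \<open>\<ell>\<^sub>1\<close> norm of a
  function on \<open>A\<close> (\<open>expander_lower_bound\<close>), while the kernel has dimension at least \<open>3n\<close>. Counting
  shows that random graphs do this (\<open>expander_exists\<close>); a pigeonhole argument gives bounded integer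
  kernel vectors, none of which can have small support, and among them a sequence in triangular form
  with pivot sets of positive density (\<open>finite_model_exists\<close>).

  Finally \<open>n\<close> tends to infinity. Left vertices are labelled by the values of the kernel vectors and
  by binary digits of their numbers, right vertices by the numbers of edges that they receive from
  the sets defined by finitely many left labels. Along a subsequence the joint distributions of the labels converge,
  and limiting label functions live on \<open>(0,1)\<close> (\<open>limit_of_digit_sequences\<close>). Norms of functions of
  finitely many labels and of their images are limits of the normalised finite ones, so the
  adjacency operators have a limit on \<open>L\<^sub>1(0,1)\<close>. The lower bound, the kernel vectors and their
  linear independence pass to the limit, because each involves only finitely many labels at a time.
\<close>

section \<open>Hahn--Banach and a quantitative Helly theorem\<close>

text \<open>
  Partial functionals are represented by their graphs, which makes domination by \<open>p\<close> the only
  condition besides linearity: it already forces a graph to be single-valued. The value \<open>c\<close> at the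
  new point \<open>x0\<close> has to lie between the bounds that points \<open>y - x0\<close> and \<open>z + x0\<close> impose.
\<close>

lemma hahn_banach_extend_graph:
  fixes G :: "('a::real_vector \<times> real) set" and p :: "'a \<Rightarrow> real" and x0 :: 'a
  assumes G: "subspace G" and Gp: "\<And>y r. (y, r) \<in> G \<Longrightarrow> r \<le> p y"
    and sub: "\<And>x y. p (x + y) \<le> p x + p y" and hom: "\<And>c x. p (c *\<^sub>R x) = \<bar>c\<bar> * p x"
  obtains G' where "subspace G'" "G \<subseteq> G'" "x0 \<in> fst ` G'" "\<And>y r. (y, r) \<in> G' \<Longrightarrow> r \<le> p y"
proof -
  define c where "c = (SUP (y, r)\<in>G. r - p (y - x0))"
  have zero: "(0, 0) \<in> G"
    using subspace_0[OF G] by (simp add: zero_prod_def)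
  have key: "r - p (y - x0) \<le> p (z + x0) - s" if "(y, r) \<in> G" "(z, s) \<in> G" for y r z s
  proof -
    have "(y + z, r + s) \<in> G"
      using subspace_add[OF G that] by simp
    then have "r + s \<le> p ((y - x0) + (z + x0))"
      using Gp by (metis add.commute add_diff_cancel diff_add_eq add.assoc)
    with sub[of "y - x0" "z + x0"] show ?thesis by linarith
  qed
  have bdd: "bdd_above ((\<lambda>(y, r). r - p (y - x0)) ` G)"
    using key[OF _ zero] by (intro bdd_aboveI2[where M = "p x0"]) auto
  have lo: "r - p (y - x0) \<le> c" if "(y, r) \<in> G" for y r
    unfolding c_def using cSUP_upper[OF that bdd] by simp
  have hi: "c \<le> p (z + x0) - s" if "(z, s) \<in> G" for z s
    unfolding c_def using zero by (intro cSUP_least) (auto intro: key[OF _ that])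
  define G' where "G' = {u + t *\<^sub>R (x0, c) | u t. u \<in> G}"
  have "G' = {x + y |x y. x \<in> G \<and> y \<in> span {(x0, c)}}"
    unfolding G'_def span_singleton by blast
  then have "subspace G'"
    using subspace_sums[OF G subspace_span] by simp
  moreover have "G \<subseteq> G'"
    unfolding G'_def by (force intro: exI[of _ "0::real"])
  moreover have "(0, 0) + 1 *\<^sub>R (x0, c) \<in> G'"
    unfolding G'_def using zero by blast
  then have "x0 \<in> fst ` G'"
    by (force simp: image_iff)
  moreover have "r \<le> p y" if "(y, r) \<in> G'" for y r
  proof -
    from that obtain z s t where zs: "(z, s) \<in> G" and y: "y = z + t *\<^sub>R x0" and r: "r = s + t * c"
      unfolding G'_def by auto
    have scale: "((1 / a) *\<^sub>R z, s / a) \<in> G" for a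
      using subspace_scale[OF G zs, of "1 / a"] by simp
    consider "t = 0" | "t > 0" | "t < 0" by linarith
    then show ?thesis
    proof cases
      case 1
      then show ?thesis using Gp[OF zs] y r by simp
    next
      case 2
      have "t * c \<le> t * (p ((1 / t) *\<^sub>R z + x0) - s / t)"
        using hi[OF scale[of t]] 2 by (intro mult_left_mono) auto
      also have "\<dots> = p (t *\<^sub>R ((1 / t) *\<^sub>R z + x0)) - s"
        using 2 by (simp add: hom right_diff_distrib)
      also have "t *\<^sub>R ((1 / t) *\<^sub>R z + x0) = y"
        using 2 y by (simp add: scaleR_add_right)
      finally show ?thesis using r by simp
    next
      case 3
      have "(-t) * (s / (-t) - p ((1 / (-t)) *\<^sub>R z - x0)) \<le> (-t) * c"
        using lo[OF scale[of "-t"]] 3 by (intro mult_left_mono) auto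
      moreover have "(-t) * (s / (-t) - p ((1 / (-t)) *\<^sub>R z - x0)) = s - p ((-t) *\<^sub>R ((1 / (-t)) *\<^sub>R z - x0))"
        using 3 unfolding hom by (simp add: right_diff_distrib)
      moreover have "(-t) *\<^sub>R ((1 / (-t)) *\<^sub>R z - x0) = y"
        using 3 y by (simp add: scaleR_diff_right)
      ultimately show ?thesis using r by simp
    qed
  qed
  ultimately show thesis by (rule that)
qed

theorem hahn_banach_seminorm:
  fixes p :: "'a::real_vector \<Rightarrow> real" and g :: 'a
  assumes sub: "\<And>x y. p (x + y) \<le> p x + p y" and hom: "\<And>c x. p (c *\<^sub>R x) = \<bar>c\<bar> * p x"
  obtains \<psi> :: "'a \<Rightarrow> real" where "linear \<psi>" "\<psi> g = p g" "\<And>z. \<bar>\<psi> z\<bar> \<le> p z"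
proof -
  have p0: "p 0 = 0" using hom[of 0 0] by simp
  have p_nonneg: "0 \<le> p x" for x
    using sub[of x "-x"] hom[of "-1" x] p0 by simp
  define \<G> where "\<G> = {G. subspace G \<and> (g, p g) \<in> G \<and> (\<forall>(y, r)\<in>G. r \<le> p y)}"
  have base: "span {(g, p g)} \<in> \<G>"
  proof -
    have "t * p g \<le> p (t *\<^sub>R g)" for t
      using p_nonneg[of g] by (simp add: hom mult_right_mono)
    then have "\<forall>(y, r)\<in>span {(g, p g)}. r \<le> p y"
      by (auto simp: span_singleton)
    then show ?thesis
      unfolding \<G>_def by (simp add: span_base)
  qed
  have "\<exists>M\<in>\<G>. \<forall>X\<in>\<G>. M \<subseteq> X \<longrightarrow> X = M"
  proof (rule subset_Zorn_nonempty)
    show "\<G> \<noteq> {}" using base by blast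
  next
    fix \<C> assume ne: "\<C> \<noteq> {}" and chain: "subset.chain \<G> \<C>"
    then have C: "\<And>G. G \<in> \<C> \<Longrightarrow> G \<in> \<G>" and tot: "\<And>G H. G \<in> \<C> \<Longrightarrow> H \<in> \<C> \<Longrightarrow> G \<subseteq> H \<or> H \<subseteq> G"
      by (auto simp: subset.chain_def)
    have "subspace (\<Union>\<C>)"
    proof (rule subspaceI)
      show "0 \<in> \<Union>\<C>" using ne C by (force simp: \<G>_def subspace_0)
    next
      fix x y assume "x \<in> \<Union>\<C>" "y \<in> \<Union>\<C>"
      then obtain G H where "G \<in> \<C>" "H \<in> \<C>" "x \<in> G" "y \<in> H" by blast
      then have "\<exists>K\<in>\<C>. x \<in> K \<and> y \<in> K" using tot[of G H] by (metis subsetD)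
      then show "x + y \<in> \<Union>\<C>" using C by (auto simp: \<G>_def dest: subspace_add)
    next
      fix c x assume "x \<in> \<Union>\<C>"
      then obtain G where "G \<in> \<C>" "x \<in> G" by blast
      then show "c *\<^sub>R x \<in> \<Union>\<C>" using C[of G] by (auto simp: \<G>_def intro: subspace_scale)
    qed
    moreover have "(g, p g) \<in> \<Union>\<C>" using ne C unfolding \<G>_def by blast
    moreover have "\<forall>(y, r)\<in>\<Union>\<C>. r \<le> p y" using C unfolding \<G>_def by blast
    ultimately show "\<Union>\<C> \<in> \<G>" unfolding \<G>_def by simp
  qed
  then obtain M where M: "M \<in> \<G>" and max: "\<And>X. X \<in> \<G> \<Longrightarrow> M \<subseteq> X \<Longrightarrow> X = M" by blast
  then have Ms: "subspace M" and Mg: "(g, p g) \<in> M" and Mp: "\<And>y r. (y, r) \<in> M \<Longrightarrow> r \<le> p y"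
    by (auto simp: \<G>_def)
  have dom: "x \<in> fst ` M" for x
  proof -
    obtain G' where G': "subspace G'" "M \<subseteq> G'" "x \<in> fst ` G'" "\<And>y r. (y, r) \<in> G' \<Longrightarrow> r \<le> p y"
      using hahn_banach_extend_graph[OF Ms Mp sub hom, of x] by blast
    then have "G' \<in> \<G>" using Mg by (auto simp: \<G>_def)
    with max G' show ?thesis by blast
  qed
  have single: "r = s" if "(y, r) \<in> M" "(y, s) \<in> M" for y r s
  proof -
    have "(0, r - s) \<in> M" "(0, s - r) \<in> M"
      using subspace_diff[OF Ms that] subspace_diff[OF Ms that(2,1)] by simp_all
    from this[THEN Mp] p0 show ?thesis by linarith
  qed
  define \<psi> where "\<psi> y = (THE r. (y, r) \<in> M)" for y
  have \<psi>: "(y, \<psi> y) \<in> M" for y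
  proof -
    have "\<exists>!r. (y, r) \<in> M" using dom[of y] single by auto
    then show ?thesis unfolding \<psi>_def by (rule theI')
  qed
  have \<psi>_eq: "\<psi> y = r" if "(y, r) \<in> M" for y r
    using single[OF \<psi> that] .
  have "linear \<psi>"
  proof (rule linearI)
    show "\<psi> (x + y) = \<psi> x + \<psi> y" for x y
      using subspace_add[OF Ms \<psi>[of x] \<psi>[of y]] by (intro \<psi>_eq) simp
    show "\<psi> (c *\<^sub>R x) = c *\<^sub>R \<psi> x" for c x
      using subspace_scale[OF Ms \<psi>[of x], of c] by (intro \<psi>_eq) simp
  qed
  moreover have "\<bar>\<psi> z\<bar> \<le> p z" for z
  proof -
    have "(-z, -\<psi> z) \<in> M" using subspace_neg[OF Ms \<psi>[of z]] by simp
    from Mp[OF this] Mp[OF \<psi>[of z]] hom[of "-1" z] show ?thesis by simp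
  qed
  ultimately show thesis using \<psi>_eq[OF Mg] that by blast
qed

lemma dual_adjoint_apply [simp]: "blinfun_apply (dual_adjoint T) \<psi> = \<psi> o\<^sub>L T"
  by (simp add: dual_adjoint.rep_eq)

lemma canonical_embedding_apply [simp]: "blinfun_apply (canonical_embedding x) \<phi> = blinfun_apply \<phi> x"
  by (simp add: canonical_embedding.rep_eq)

text \<open>
  If \<open>U**\<Phi>\<close> is the vector \<open>z\<close>, then \<open>z\<close> is almost \<open>U x\<close> with \<open>x\<close> hardly longer than \<open>\<Phi>\<close>. The seminorm
  \<open>p y = inf\<^sub>x (\<parallel>x\<parallel> + N \<parallel>y - U x\<parallel>)\<close> measures how well this succeeds, with \<open>N\<close> as the price of an error.
  A functional \<open>\<psi> \<le> p\<close> satisfies \<open>\<parallel>\<psi> \<circ> U\<parallel> \<le> 1\<close>; choosing \<open>\<psi> z = p z\<close> gives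
  \<open>p z = \<Phi> (\<psi> \<circ> U) \<le> \<parallel>\<Phi>\<parallel>\<close>, so a nearly optimal \<open>x\<close> is short and has a small error.
\<close>

lemma helly_bidual:
  fixes U :: "'a::real_normed_vector \<Rightarrow>\<^sub>L 'b::real_normed_vector" and \<Phi> :: "'a dual dual"
  assumes eq: "\<And>\<psi>. blinfun_apply \<Phi> (\<psi> o\<^sub>L U) = blinfun_apply \<psi> z" and \<epsilon>: "\<epsilon> > 0"
  obtains x where "norm x \<le> norm \<Phi> + \<epsilon>" "norm (blinfun_apply U x - z) \<le> \<epsilon>"
proof -
  define N where "N = (norm \<Phi> + \<epsilon>) / \<epsilon>"
  have N: "N > 0" unfolding N_def using \<epsilon> norm_ge_zero[of \<Phi>] by (intro divide_pos_pos) linarith+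
  define q where "q y x = norm x + N * norm (y - blinfun_apply U x)" for y x
  define p where "p y = (INF x. q y x)" for y
  have q0: "0 \<le> q y x" for y x using N by (simp add: q_def)
  have bdd: "bdd_below (range (q y))" for y
    using q0 by (intro bdd_belowI2[where m = 0]) auto
  have pq: "p y \<le> q y x" for x y
    unfolding p_def by (intro cINF_lower bdd) auto
  have p0: "0 \<le> p y" for y unfolding p_def by (intro cINF_greatest) (auto simp: q0)
  have sub: "p (y + y') \<le> p y + p y'" for y y'
  proof -
    have qq: "p (y + y') \<le> q y x + q y' x'" for x x'
    proof -
      have "norm ((y + y') - U (x + x')) \<le> norm (y - U x) + norm (y' - U x')"
        using norm_triangle_ineq[of "y - U x" "y' - U x'"] by (simp add: blinfun.add_right algebra_simps)
      then have "q (y + y') (x + x') \<le> q y x + q y' x'"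
        using N norm_triangle_ineq[of x x'] mult_left_mono[of _ _ N]
        unfolding q_def by (fastforce simp: distrib_left)
      with pq show ?thesis by (rule order_trans)
    qed
    have "p (y + y') - q y x \<le> p y'" for x
      unfolding p_def[of y'] using qq[of x] by (intro cINF_greatest) (auto simp: algebra_simps)
    then have "p (y + y') - p y' \<le> q y x" for x
      by (simp add: algebra_simps)
    then have "p (y + y') - p y' \<le> p y"
      unfolding p_def[of y] by (intro cINF_greatest) auto
    then show ?thesis by simp
  qed
  have hom_le: "p (c *\<^sub>R y) \<le> \<bar>c\<bar> * p y" if "c \<noteq> 0" for c y
  proof -
    have "p (c *\<^sub>R y) \<le> \<bar>c\<bar> * q y x" for x
    proof -
      have "q (c *\<^sub>R y) (c *\<^sub>R x) = \<bar>c\<bar> * q y x"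
        by (simp add: q_def blinfun.scaleR_right scaleR_diff_right[symmetric] distrib_left)
      with pq[of "c *\<^sub>R y"] show ?thesis by metis
    qed
    then have "p (c *\<^sub>R y) / \<bar>c\<bar> \<le> q y x" for x
      using that by (simp add: divide_le_eq mult.commute)
    then have "p (c *\<^sub>R y) / \<bar>c\<bar> \<le> p y"
      unfolding p_def[of y] by (intro cINF_greatest) auto
    then show ?thesis using that by (simp add: divide_le_eq mult.commute)
  qed
  have hom: "p (c *\<^sub>R y) = \<bar>c\<bar> * p y" for c y
  proof (cases "c = 0")
    case True
    then show ?thesis using pq[of 0 0] p0[of 0] by (simp add: q_def)
  next
    case False
    then have "p ((1 / c) *\<^sub>R (c *\<^sub>R y)) \<le> \<bar>1 / c\<bar> * p (c *\<^sub>R y)"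
      by (intro hom_le) auto
    then have "\<bar>c\<bar> * p y \<le> p (c *\<^sub>R y)" using False by (simp add: field_simps)
    with hom_le[OF False] show ?thesis by (intro antisym)
  qed
  obtain \<psi> where \<psi>: "linear \<psi>" "\<psi> z = p z" "\<And>y. \<bar>\<psi> y\<bar> \<le> p y"
    using hahn_banach_seminorm[of p z, OF sub hom] by blast
  have "\<bar>\<psi> y\<bar> \<le> norm y * N" for y
    using \<psi>(3)[of y] pq[of y 0] by (simp add: q_def mult.commute)
  then have "bounded_linear \<psi>"
    using \<psi>(1) by (intro bounded_linear_intro[where K = N]) (auto simp: linear_add linear_scale)
  then have B: "blinfun_apply (Blinfun \<psi>) = \<psi>" by (rule bounded_linear_Blinfun_apply)
  have "norm (Blinfun \<psi> o\<^sub>L U) \<le> 1"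
  proof (rule norm_blinfun_bound)
    fix x
    show "norm (blinfun_apply (Blinfun \<psi> o\<^sub>L U) x) \<le> 1 * norm x"
      using \<psi>(3)[of "U x"] pq[of "U x" x] by (simp add: B q_def)
  qed simp
  then have "norm (\<Phi> (Blinfun \<psi> o\<^sub>L U)) \<le> norm \<Phi> * 1"
    using norm_blinfun[of \<Phi> "Blinfun \<psi> o\<^sub>L U"] by (meson mult_left_mono norm_ge_zero order_trans)
  then have "p z \<le> norm \<Phi>"
    using eq[of "Blinfun \<psi>"] \<psi>(2) by (simp add: B)
  then have "\<exists>x. q z x < norm \<Phi> + \<epsilon>"
    using \<epsilon> cINF_less_iff[OF _ bdd, of z "norm \<Phi> + \<epsilon>"] by (auto simp: p_def)
  then obtain x where x: "q z x < norm \<Phi> + \<epsilon>" by blast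
  have "N * norm (z - U x) \<ge> 0" using N by simp
  then have "norm x \<le> norm \<Phi> + \<epsilon>" using x by (simp add: q_def)
  moreover have "N * norm (z - U x) \<le> N * \<epsilon>"
    using x \<epsilon> norm_ge_zero[of x] unfolding q_def by (simp add: N_def del: norm_ge_zero)
  then have "norm (U x - z) \<le> \<epsilon>" using N by (simp add: norm_minus_commute)
  ultimately show thesis by (rule that)
qed

section \<open>Closures and extensions from dense subspaces\<close>

lemma subspace_closure_normed:
  fixes S :: "'a::real_normed_vector set"
  assumes S: "subspace S"
  shows "subspace (closure S)"
proof (rule subspaceI)
  show "0 \<in> closure S" using subspace_0[OF S] closure_subset by blast
next
  fix x y assume "x \<in> closure S" "y \<in> closure S"
  then obtain u v where "\<And>k. u k \<in> S" "u \<longlonglongrightarrow> x" "\<And>k. v k \<in> S" "v \<longlonglongrightarrow> y"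
    unfolding closure_sequential by blast
  then show "x + y \<in> closure S"
    unfolding closure_sequential
    by (intro exI[of _ "\<lambda>k. u k + v k"]) (auto intro: subspace_add[OF S] tendsto_add)
next
  fix c x assume "x \<in> closure S"
  then obtain u where "\<And>k. u k \<in> S" "u \<longlonglongrightarrow> x"
    unfolding closure_sequential by blast
  then show "c *\<^sub>R x \<in> closure S"
    unfolding closure_sequential
    by (intro exI[of _ "\<lambda>k. c *\<^sub>R u k"]) (auto intro: subspace_scale[OF S] tendsto_scaleR)
qed

text \<open>
  Vectors of the dense subspace may be represented in several ways. The norm bound on the graph implies
  that the assigned value is independent of the representation, and it makes limits of values exist.
\<close>

lemma blinfun_of_bounded_graph:
  fixes G :: "('a::real_normed_vector \<times> 'b::banach) set"
  assumes G: "subspace G" and bd: "\<And>x y. (x, y) \<in> G \<Longrightarrow> norm y \<le> K * norm x"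
    and dense: "closure (fst ` G) = UNIV"
  obtains T :: "'a \<Rightarrow>\<^sub>L 'b" where "\<And>x y. (x, y) \<in> G \<Longrightarrow> T x = y"
proof -
  have K0: "norm y \<le> \<bar>K\<bar> * norm x" if "(x, y) \<in> G" for x y
    using bd[OF that] mult_right_mono[OF abs_ge_self[of K] norm_ge_zero[of x]] by linarith
  define C where "C = closure G"
  have C: "subspace C" unfolding C_def by (rule subspace_closure_normed[OF G])
  have "closed {p :: 'a \<times> 'b. norm (snd p) \<le> \<bar>K\<bar> * norm (fst p)}"
    by (intro closed_Collect_le continuous_intros)
  then have "C \<subseteq> {p. norm (snd p) \<le> \<bar>K\<bar> * norm (fst p)}"
    unfolding C_def using K0 by (intro closure_minimal) auto
  then have Cbd: "norm y \<le> \<bar>K\<bar> * norm x" if "(x, y) \<in> C" for x y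
    using that by auto
  have uniq: "y = y'" if "(x, y) \<in> C" "(x, y') \<in> C" for x y y'
    using Cbd[of 0 "y - y'"] subspace_diff[OF C that] by simp
  have ex: "\<exists>y. (x, y) \<in> C" for x
  proof -
    have "x \<in> closure (fst ` G)" using dense by simp
    then obtain u where u: "\<And>k. u k \<in> fst ` G" "u \<longlonglongrightarrow> x" by (auto simp: closure_sequential)
    then have "\<forall>k. \<exists>y. (u k, y) \<in> G" by force
    then obtain v where v: "\<And>k. (u k, v k) \<in> G" by metis
    have "Cauchy v"
    proof (rule CauchyI)
      fix e :: real assume "e > 0"
      define d where "d = e / (\<bar>K\<bar> + 1)"
      have "d > 0" using \<open>e > 0\<close> by (simp add: d_def add_nonneg_pos)
      then obtain M where M: "\<forall>m\<ge>M. \<forall>n\<ge>M. norm (u m - u n) < d"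
        using CauchyD[OF LIMSEQ_imp_Cauchy[OF u(2)]] by blast
      have "norm (v m - v n) < e" if "m \<ge> M" "n \<ge> M" for m n
      proof -
        have "norm (v m - v n) \<le> \<bar>K\<bar> * norm (u m - u n)"
          using K0[of "u m - u n" "v m - v n"] subspace_diff[OF G v[of m] v[of n]] by simp
        also have "\<dots> \<le> \<bar>K\<bar> * d" using M that by (intro mult_left_mono) (auto intro: less_imp_le)
        also have "\<dots> < (\<bar>K\<bar> + 1) * d" using \<open>d > 0\<close> by (intro mult_strict_right_mono) auto
        also have "\<dots> = e" using abs_ge_zero[of K] by (simp add: d_def add_nonneg_eq_0_iff)
        finally show ?thesis .
      qed
      then show "\<exists>M. \<forall>m\<ge>M. \<forall>n\<ge>M. norm (v m - v n) < e" by blast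
    qed
    then obtain y where "v \<longlonglongrightarrow> y" using Cauchy_convergent convergent_def by blast
    then have "(\<lambda>k. (u k, v k)) \<longlonglongrightarrow> (x, y)" using u(2) by (intro tendsto_Pair)
    then have "(x, y) \<in> C"
      unfolding C_def closure_sequential using v by (intro exI[of _ "\<lambda>k. (u k, v k)"]) simp
    then show ?thesis by blast
  qed
  then obtain t where t: "\<And>x. (x, t x) \<in> C" by metis
  have "bounded_linear t"
  proof (rule bounded_linear_intro[where K = "\<bar>K\<bar>"])
    show "t (x + y) = t x + t y" for x y using uniq[OF t] subspace_add[OF C t t, of x y] by simp
    show "t (c *\<^sub>R x) = c *\<^sub>R t x" for c x using uniq[OF t] subspace_scale[OF C t, of c x] by simp
    show "norm (t x) \<le> norm x * \<bar>K\<bar>" for x using Cbd[OF t[of x]] by (simp add: mult.commute)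
  qed
  then have app: "blinfun_apply (Blinfun t) = t" by (rule bounded_linear_Blinfun_apply)
  show thesis
  proof (rule that)
    fix x y assume "(x, y) \<in> G"
    then have "(x, y) \<in> C" unfolding C_def using closure_subset by blast
    then show "Blinfun t x = y" unfolding app using uniq[OF t] by blast
  qed
qed

section \<open>Restriction operators and supports in L1\<close>

abbreviation \<mu> :: "real set \<Rightarrow> real" where
  "\<mu> \<equiv> measure lebesgue_01"

lemma finite_measure_01: "finite_measure lebesgue_01"
  by (intro finite_measureI) (simp add: emeasure_restrict_space space_restrict_space)

interpretation L01: finite_measure lebesgue_01
  by (rule finite_measure_01)

lemma space_01 [simp]: "space lebesgue_01 = {0<..<1}"
  by (simp add: space_restrict_space)

lemma measure_space_01 [simp]: "\<mu> {0<..<1} = 1"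
  by (simp add: measure_restrict_space)

lemma integrable_rep_L1 [simp]: "integrable lebesgue_01 (rep_L1 f)"
  using Quotient3_rep_reflp[OF Quotient3_L1, of f] by (simp add: L1_eq_def)

lemma measurable_rep_L1 [measurable]: "rep_L1 f \<in> borel_measurable lebesgue_01"
  by (rule borel_measurable_integrable) simp

lemma abs_rep_L1 [simp]: "abs_L1 (rep_L1 f) = f"
  by (rule Quotient3_abs_rep[OF Quotient3_L1])

lemma abs_L1_eq_iff:
  assumes "integrable lebesgue_01 f" "integrable lebesgue_01 g"
  shows "abs_L1 f = abs_L1 g \<longleftrightarrow> (AE x in lebesgue_01. f x = g x)"
  using Quotient3_rel[OF Quotient3_L1, of f g] assms by (auto simp: L1_eq_def)

lemma abs_L1_add: "integrable lebesgue_01 f \<Longrightarrow> integrable lebesgue_01 g \<Longrightarrow>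
    abs_L1 f + abs_L1 g = abs_L1 (\<lambda>x. f x + g x)"
  by (rule plus_L1.abs_eq) (auto simp: L1_eq_def)

lemma abs_L1_diff: "integrable lebesgue_01 f \<Longrightarrow> integrable lebesgue_01 g \<Longrightarrow>
    abs_L1 f - abs_L1 g = abs_L1 (\<lambda>x. f x - g x)"
  by (rule minus_L1.abs_eq) (auto simp: L1_eq_def)

lemma abs_L1_scaleR: "integrable lebesgue_01 f \<Longrightarrow> c *\<^sub>R abs_L1 f = abs_L1 (\<lambda>x. c * f x)"
  by (rule scaleR_L1.abs_eq) (auto simp: L1_eq_def)

lemma norm_abs_L1: "integrable lebesgue_01 f \<Longrightarrow> norm (abs_L1 f) = (\<integral>x. \<bar>f x\<bar> \<partial>lebesgue_01)"
  by (rule norm_L1.abs_eq) (auto simp: L1_eq_def)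

lemma zero_L1_abs: "0 = abs_L1 (\<lambda>_. 0)"
  using zero_L1.abs_eq by simp

lemma abs_L1_sum:
  assumes "\<And>i. i \<in> I \<Longrightarrow> integrable lebesgue_01 (f i)"
  shows "(\<Sum>i\<in>I. abs_L1 (f i)) = abs_L1 (\<lambda>x. \<Sum>i\<in>I. f i x)"
  using assms
  by (induction I rule: infinite_finite_induct) (auto simp: zero_L1_abs abs_L1_add)

lemma L1_cases:
  obtains h where "integrable lebesgue_01 h" "f = abs_L1 h"
  by (rule that[of "rep_L1 f"]) simp_all

lemma integrable_indicator_times:
  "A \<in> sets lebesgue_01 \<Longrightarrow> integrable lebesgue_01 f \<Longrightarrow> integrable lebesgue_01 (\<lambda>x. indicator A x * f x :: real)"
  using integrable_mult_indicator[of A lebesgue_01 f] by simp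

text \<open>
  Non-measurable sets are sent to the zero operator, so that the norm bound holds for every set.
\<close>

lift_definition restrict_fun_L1 :: "real set \<Rightarrow> L1 \<Rightarrow> L1"
  is "\<lambda>A f x. (if A \<in> sets lebesgue_01 then indicator A x * f x else 0)"
  subgoal for A f g
    by (cases "A \<in> sets lebesgue_01") (auto simp: L1_eq_def integrable_indicator_times elim: AE_mp)
  done

lemma restrict_fun_abs:
  assumes "A \<in> sets lebesgue_01" "integrable lebesgue_01 f"
  shows "restrict_fun_L1 A (abs_L1 f) = abs_L1 (\<lambda>x. indicator A x * f x)"
  using assms by (subst restrict_fun_L1.abs_eq) (auto simp: L1_eq_def)

lemma bounded_linear_restrict_fun: "bounded_linear (restrict_fun_L1 A)"
proof (cases "A \<in> sets lebesgue_01")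
  case False
  then have "restrict_fun_L1 A f = 0" for f
    by (cases f rule: L1_cases) (simp add: restrict_fun_L1.abs_eq L1_eq_def zero_L1_abs)
  then have "restrict_fun_L1 A = (\<lambda>_. 0)" by auto
  then show ?thesis by simp
next
  case A: True
  show ?thesis
  proof (rule bounded_linear_intro[where K = 1])
    fix f g :: L1 and c :: real
    obtain f' where f: "integrable lebesgue_01 f'" "f = abs_L1 f'" by (rule L1_cases)
    obtain g' where g: "integrable lebesgue_01 g'" "g = abs_L1 g'" by (rule L1_cases)
    show "restrict_fun_L1 A (f + g) = restrict_fun_L1 A f + restrict_fun_L1 A g"
      using f g A by (simp add: abs_L1_add restrict_fun_abs integrable_indicator_times distrib_left)
    show "restrict_fun_L1 A (c *\<^sub>R f) = c *\<^sub>R restrict_fun_L1 A f"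
      using f A by (simp add: abs_L1_scaleR restrict_fun_abs integrable_indicator_times mult.left_commute)
    have "(\<integral>x. \<bar>indicator A x * f' x\<bar> \<partial>lebesgue_01) \<le> (\<integral>x. \<bar>f' x\<bar> \<partial>lebesgue_01)"
      using f A by (intro integral_mono) (auto simp: integrable_indicator_times split: split_indicator)
    then show "norm (restrict_fun_L1 A f) \<le> norm f * 1"
      using f A by (simp add: restrict_fun_abs norm_abs_L1 integrable_indicator_times)
  qed
qed

definition restrict_L1 :: "real set \<Rightarrow> L1 \<Rightarrow>\<^sub>L L1" where
  "restrict_L1 A = Blinfun (restrict_fun_L1 A)"

lemma restrict_L1_abs:
  assumes "A \<in> sets lebesgue_01" "integrable lebesgue_01 f"
  shows "restrict_L1 A (abs_L1 f) = abs_L1 (\<lambda>x. indicator A x * f x)"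
  using assms by (simp add: restrict_L1_def bounded_linear_Blinfun_apply bounded_linear_restrict_fun restrict_fun_abs)

lemma restrict_L1_comp:
  assumes "A \<in> sets lebesgue_01" "B \<in> sets lebesgue_01"
  shows "restrict_L1 A o\<^sub>L restrict_L1 B = restrict_L1 (A \<inter> B)"
proof (rule blinfun_eqI)
  fix f :: L1
  obtain f' where f: "integrable lebesgue_01 f'" "f = abs_L1 f'" by (rule L1_cases)
  then show "blinfun_apply (restrict_L1 A o\<^sub>L restrict_L1 B) f = blinfun_apply (restrict_L1 (A \<inter> B)) f"
    using assms by (simp add: restrict_L1_abs integrable_indicator_times indicator_inter_arith mult.assoc)
qed

lemma restrict_L1_Un:
  assumes "A \<in> sets lebesgue_01" "B \<in> sets lebesgue_01" "A \<inter> B = {}"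
  shows "restrict_L1 (A \<union> B) = restrict_L1 A + restrict_L1 B"
proof (rule blinfun_eqI)
  fix f :: L1
  obtain f' where f: "integrable lebesgue_01 f'" "f = abs_L1 f'" by (rule L1_cases)
  then show "blinfun_apply (restrict_L1 (A \<union> B)) f = blinfun_apply (restrict_L1 A + restrict_L1 B) f"
    using assms
    by (simp add: restrict_L1_abs integrable_indicator_times blinfun.add_left abs_L1_add
        indicator_disj_union distrib_right)
qed

lemma norm_restrict_L1_add:
  assumes "A \<in> sets lebesgue_01" "B \<in> sets lebesgue_01" "A \<inter> B = {}"
  shows "norm (restrict_L1 A f) + norm (restrict_L1 B f) \<le> norm f"
proof -
  obtain f' where f: "integrable lebesgue_01 f'" "f = abs_L1 f'" by (rule L1_cases)
  have "(\<integral>x. \<bar>indicator A x * f' x\<bar> \<partial>lebesgue_01) + (\<integral>x. \<bar>indicator B x * f' x\<bar> \<partial>lebesgue_01)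
      = (\<integral>x. \<bar>indicator A x * f' x\<bar> + \<bar>indicator B x * f' x\<bar> \<partial>lebesgue_01)"
    using assms f by (simp add: integrable_indicator_times)
  also have "\<dots> \<le> (\<integral>x. \<bar>f' x\<bar> \<partial>lebesgue_01)"
    using f assms by (intro integral_mono) (auto simp: integrable_indicator_times split: split_indicator)
  finally show ?thesis
    using assms f by (simp add: restrict_L1_abs norm_abs_L1 integrable_indicator_times)
qed

lemma norm_restrict_L1_le: "norm (restrict_L1 A f) \<le> norm f"
proof (cases "A \<in> sets lebesgue_01")
  case True
  then show ?thesis
    using norm_restrict_L1_add[of A "{}" f] norm_ge_zero[of "restrict_L1 {} f"]
    by (simp del: norm_ge_zero)
next
  case False
  obtain f' where f: "integrable lebesgue_01 f'" "f = abs_L1 f'" by (rule L1_cases)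
  then have "restrict_L1 A f = 0"
    using False
    by (simp add: restrict_L1_def bounded_linear_Blinfun_apply bounded_linear_restrict_fun
        restrict_fun_L1.abs_eq L1_eq_def zero_L1_abs)
  then show ?thesis by simp
qed

lemma restrict_L1_space [simp]: "restrict_L1 {0<..<1} = id_blinfun"
proof (rule blinfun_eqI)
  fix f :: L1
  obtain f' where f: "integrable lebesgue_01 f'" "f = abs_L1 f'" by (rule L1_cases)
  have "{0<..<1} \<in> sets lebesgue_01" using sets.top[of lebesgue_01] by simp
  with f show "blinfun_apply (restrict_L1 {0<..<1}) f = blinfun_apply id_blinfun f"
    by (simp add: restrict_L1_abs integrable_indicator_times abs_L1_eq_iff) (rule AE_I2, simp)
qed

definition supp_measure :: "L1 \<Rightarrow> real" where
  "supp_measure f = \<mu> {x \<in> space lebesgue_01. rep_L1 f x \<noteq> 0}"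

lemma AE_rep_abs_L1:
  assumes "integrable lebesgue_01 f"
  shows "AE x in lebesgue_01. rep_L1 (abs_L1 f) x = f x"
  using assms abs_L1_eq_iff[of "rep_L1 (abs_L1 f)" f] by simp

lemma supp_measure_abs:
  assumes f: "integrable lebesgue_01 f"
  shows "supp_measure (abs_L1 f) = \<mu> {x \<in> space lebesgue_01. f x \<noteq> 0}"
proof -
  have [measurable]: "f \<in> borel_measurable lebesgue_01" using f by auto
  have "AE x in lebesgue_01. x \<in> {x \<in> space lebesgue_01. rep_L1 (abs_L1 f) x \<noteq> 0}
      \<longleftrightarrow> x \<in> {x \<in> space lebesgue_01. f x \<noteq> 0}"
    using AE_rep_abs_L1[OF f] by (rule AE_mp) (rule AE_I2, simp)
  then show ?thesis
    unfolding supp_measure_def by (intro measure_eq_AE) measurable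
qed

lemma supp_measure_restrict:
  assumes "A \<in> sets lebesgue_01"
  shows "supp_measure (restrict_L1 A f) \<le> \<mu> A"
proof -
  obtain f' where f: "integrable lebesgue_01 f'" "f = abs_L1 f'" by (rule L1_cases)
  then show ?thesis
    using assms by (simp add: restrict_L1_abs supp_measure_abs integrable_indicator_times)
      (intro L01.finite_measure_mono, auto simp: indicator_eq_0_iff)
qed

lemma supp_measure_0:
  assumes "supp_measure f \<le> 0"
  shows "f = 0"
proof -
  obtain f' where f: "integrable lebesgue_01 f'" "f = abs_L1 f'" by (rule L1_cases)
  have [measurable]: "f' \<in> borel_measurable lebesgue_01" using f by auto
  have "\<mu> {x \<in> space lebesgue_01. f' x \<noteq> 0} = 0"
    using assms f supp_measure_abs[OF f(1)] by (simp add: antisym)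
  moreover have "{x \<in> space lebesgue_01. f' x \<noteq> 0} \<in> sets lebesgue_01" by measurable
  ultimately have "AE x in lebesgue_01. f' x = 0"
    by (intro AE_I[where N = "{x \<in> space lebesgue_01. f' x \<noteq> 0}"])
      (auto simp: L01.emeasure_eq_measure)
  then show ?thesis
    using f by (simp add: zero_L1_abs abs_L1_eq_iff)
qed

section \<open>Simple functions and densities in L1\<close>

definition one_L1 :: L1 where "one_L1 = abs_L1 (\<lambda>_. 1)"

lemma restrict_one_L1:
  "A \<in> sets lebesgue_01 \<Longrightarrow> restrict_L1 A one_L1 = abs_L1 (indicator A)"
  by (simp add: one_L1_def restrict_L1_abs)

lemma integrable_indicator_01:
  "A \<in> sets lebesgue_01 \<Longrightarrow> integrable lebesgue_01 (indicator A :: real \<Rightarrow> real)"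
  by (rule integrable_real_indicator) (auto simp: L01.emeasure_eq_measure)

lemma Int_space_01: "A \<in> sets lebesgue_01 \<Longrightarrow> A \<inter> {0<..<1} = A"
  using sets.sets_into_space[of A lebesgue_01] by auto

lemma norm_restrict_one_L1:
  "A \<in> sets lebesgue_01 \<Longrightarrow> norm (restrict_L1 A one_L1) = \<mu> A"
  by (simp add: restrict_one_L1 norm_abs_L1 integrable_indicator_01 Int_space_01)

text \<open>
  Absolute continuity supplies the continuity at the empty set that turns finite into countable
  additivity; the Radon--Nikodym theorem does the rest.
\<close>

lemma finitely_additive_density:
  fixes \<nu> :: "real set \<Rightarrow> real"
  assumes nonneg: "\<And>A. A \<in> sets lebesgue_01 \<Longrightarrow> 0 \<le> \<nu> A"
    and add: "\<And>A B. A \<in> sets lebesgue_01 \<Longrightarrow> B \<in> sets lebesgue_01 \<Longrightarrow> A \<inter> B = {} \<Longrightarrow> \<nu> (A \<union> B) = \<nu> A + \<nu> B"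
    and ac: "\<And>\<epsilon>. \<epsilon> > 0 \<Longrightarrow> \<exists>\<eta>>0. \<forall>A\<in>sets lebesgue_01. \<mu> A < \<eta> \<longrightarrow> \<nu> A \<le> \<epsilon>"
  obtains g where "integrable lebesgue_01 g" "\<And>A. A \<in> sets lebesgue_01 \<Longrightarrow> \<nu> A = (\<integral>x. indicator A x * g x \<partial>lebesgue_01)"
proof -
  have empty: "\<nu> {} = 0" using add[of "{}" "{}"] by simp
  define N where "N = measure_of (space lebesgue_01) (sets lebesgue_01) (\<lambda>A. ennreal (\<nu> A))"
  have sN: "sets N = sets lebesgue_01" unfolding N_def by (rule sets.sets_measure_of_eq)
  have pos: "positive (sets lebesgue_01) (\<lambda>A. ennreal (\<nu> A))"
    by (simp add: positive_def empty)
  have "countably_additive (sets lebesgue_01) (\<lambda>A. ennreal (\<nu> A))"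
  proof (rule sets.empty_continuous_imp_countably_additive)
    show "additive (sets lebesgue_01) (\<lambda>A. ennreal (\<nu> A))"
      by (auto simp: additive_def add nonneg ennreal_plus)
    fix A :: "nat \<Rightarrow> real set"
    assume A: "range A \<subseteq> sets lebesgue_01" "decseq A" "(\<Inter>i. A i) = {}"
    have lim: "(\<lambda>i. \<mu> (A i)) \<longlonglongrightarrow> 0"
      using L01.finite_Lim_measure_decseq[OF A(1,2)] A(3) by simp
    have "(\<lambda>i. \<nu> (A i)) \<longlonglongrightarrow> 0"
    proof (rule LIMSEQ_I)
      fix e :: real assume "e > 0"
      then obtain \<eta> where \<eta>: "\<eta> > 0" "\<forall>B\<in>sets lebesgue_01. \<mu> B < \<eta> \<longrightarrow> \<nu> B \<le> e / 2"
        using ac[of "e / 2"] by auto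
      obtain n0 where "\<forall>n\<ge>n0. norm (\<mu> (A n) - 0) < \<eta>"
        using LIMSEQ_D[OF lim \<eta>(1)] by blast
      then have "\<forall>n\<ge>n0. norm (\<nu> (A n) - 0) < e"
        using \<eta>(2) A(1) nonneg \<open>e > 0\<close> by (fastforce simp: abs_of_nonneg measure_nonneg)
      then show "\<exists>no. \<forall>n\<ge>no. norm (\<nu> (A n) - 0) < e" by blast
    qed
    then show "(\<lambda>i. ennreal (\<nu> (A i))) \<longlonglongrightarrow> 0"
      using tendsto_ennrealI by fastforce
  qed (use pos in auto)
  then have eN: "emeasure N A = ennreal (\<nu> A)" if "A \<in> sets lebesgue_01" for A
    unfolding N_def using that pos by (intro emeasure_measure_of_sigma sets.sigma_algebra_axioms) auto
  have "absolutely_continuous lebesgue_01 N"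
    unfolding absolutely_continuous_def
  proof
    fix A assume "A \<in> null_sets lebesgue_01"
    then have A: "A \<in> sets lebesgue_01" "\<mu> A = 0"
      by (auto simp: null_sets_def measure_def)
    have "\<nu> A \<le> \<epsilon>" if "\<epsilon> > 0" for \<epsilon>
      using ac[OF that] A by auto
    then have "\<nu> A \<le> 0" by (meson field_le_epsilon dense_ge)
    then have "\<nu> A = 0" using nonneg[OF A(1)] by simp
    then show "A \<in> null_sets N" using A by (simp add: null_sets_def sN eN)
  qed
  then obtain f where f [measurable]: "f \<in> borel_measurable lebesgue_01" and fN: "density lebesgue_01 f = N"
    using L01.Radon_Nikodym[of N] sN by blast
  have nn: "(\<integral>\<^sup>+x. f x * indicator A x \<partial>lebesgue_01) = ennreal (\<nu> A)" if "A \<in> sets lebesgue_01" for A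
    using emeasure_density[OF f that] fN eN[OF that] by simp
  have top: "{0<..<1} \<in> sets lebesgue_01" using sets.top[of lebesgue_01] by simp
  have "(\<integral>\<^sup>+x. f x \<partial>lebesgue_01) = (\<integral>\<^sup>+x. f x * indicator {0<..<1} x \<partial>lebesgue_01)"
    by (intro nn_integral_cong) auto
  then have fin: "(\<integral>\<^sup>+x. f x \<partial>lebesgue_01) \<noteq> \<infinity>"
    using nn[OF top] by simp
  then have AEf: "AE x in lebesgue_01. f x \<noteq> \<infinity>"
    by (intro nn_integral_PInf_AE) auto
  have "(\<integral>\<^sup>+x. ennreal (enn2real (f x)) \<partial>lebesgue_01) = (\<integral>\<^sup>+x. f x \<partial>lebesgue_01)"
    using AEf by (intro nn_integral_cong_AE) (auto simp: less_top)
  then have "integrable lebesgue_01 (\<lambda>x. enn2real (f x))"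
    using fin by (intro integrableI_nonneg) (auto simp: less_top)
  moreover have "\<nu> A = (\<integral>x. indicator A x * enn2real (f x) \<partial>lebesgue_01)" if "A \<in> sets lebesgue_01" for A
  proof -
    have "(\<integral>x. indicator A x * enn2real (f x) \<partial>lebesgue_01)
        = enn2real (\<integral>\<^sup>+x. ennreal (indicator A x * enn2real (f x)) \<partial>lebesgue_01)"
      using that by (intro integral_eq_nn_integral) auto
    also have "(\<integral>\<^sup>+x. ennreal (indicator A x * enn2real (f x)) \<partial>lebesgue_01)
        = (\<integral>\<^sup>+x. f x * indicator A x \<partial>lebesgue_01)"
      using AEf by (intro nn_integral_cong_AE) (auto simp: less_top split: split_indicator)
    finally show ?thesis using nn[OF that] nonneg[OF that] by simp
  qed
  ultimately show thesis by (rule that)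
qed

definition integral_L1 :: "L1 dual" where
  "integral_L1 = Blinfun (\<lambda>f. \<integral>x. rep_L1 f x \<partial>lebesgue_01)"

lemma integral_L1: "norm integral_L1 \<le> 1"
    "integrable lebesgue_01 f \<Longrightarrow> blinfun_apply integral_L1 (abs_L1 f) = (\<integral>x. f x \<partial>lebesgue_01)"
proof -
  define i where "i f = (\<integral>x. rep_L1 f x \<partial>lebesgue_01)" for f
  have i: "i (abs_L1 f) = (\<integral>x. f x \<partial>lebesgue_01)" if f: "integrable lebesgue_01 f" for f
    unfolding i_def using AE_rep_abs_L1[OF f] f by (intro integral_cong_AE) auto
  have le: "\<bar>i f\<bar> \<le> norm f" for f
  proof -
    obtain f' where "integrable lebesgue_01 f'" "f = abs_L1 f'" by (rule L1_cases)
    then show ?thesis by (simp add: i norm_abs_L1 integral_abs_bound)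
  qed
  have bl: "bounded_linear i"
  proof (rule bounded_linear_intro[where K = 1])
    fix f g :: L1 and c :: real
    obtain f' where f: "integrable lebesgue_01 f'" "f = abs_L1 f'" by (rule L1_cases)
    obtain g' where g: "integrable lebesgue_01 g'" "g = abs_L1 g'" by (rule L1_cases)
    show "i (f + g) = i f + i g" using f g by (simp add: abs_L1_add i)
    show "i (c *\<^sub>R f) = c *\<^sub>R i f" using f by (simp add: abs_L1_scaleR i)
    show "norm (i f) \<le> norm f * 1" using le[of f] by simp
  qed
  have app: "blinfun_apply integral_L1 = i"
    unfolding integral_L1_def i_def[abs_def, symmetric] by (rule bounded_linear_Blinfun_apply[OF bl])
  show "norm integral_L1 \<le> 1" by (rule norm_blinfun_bound) (simp_all add: app le)
  show "integrable lebesgue_01 f \<Longrightarrow> blinfun_apply integral_L1 (abs_L1 f) = (\<integral>x. f x \<partial>lebesgue_01)"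
    by (simp add: app i)
qed

abbreviation set_functional :: "real set \<Rightarrow> L1 dual" where
  "set_functional A \<equiv> integral_L1 o\<^sub>L restrict_L1 A"

text \<open>
  The last clause records that the pieces of the simple function are disjoint.
\<close>

lemma L1_simple_approx:
  assumes "\<epsilon> > 0"
  obtains S :: "real set" and A :: "real \<Rightarrow> real set" where
    "finite S" "\<And>y. A y \<in> sets lebesgue_01"
    "norm (f - (\<Sum>y\<in>S. y *\<^sub>R restrict_L1 (A y) one_L1)) < \<epsilon>"
    "norm (\<Sum>y\<in>S. y *\<^sub>R restrict_L1 (A y) one_L1) = (\<Sum>y\<in>S. \<bar>y\<bar> * \<mu> (A y))"
proof -
  obtain f' where f: "integrable lebesgue_01 f'" "f = abs_L1 f'" by (rule L1_cases)
  obtain s where s': "\<forall>i. simple_function lebesgue_01 (s i)"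
      "\<forall>x\<in>space lebesgue_01. (\<lambda>i. s i x) \<longlonglongrightarrow> f' x"
      "\<forall>i. \<forall>x\<in>space lebesgue_01. dist (s i x) 0 \<le> 2 * dist (f' x) 0"
    using borel_measurable_implies_sequence_metric[OF borel_measurable_integrable[OF f(1)], of 0]
    by blast
  then have s: "\<And>i. simple_function lebesgue_01 (s i)"
      "\<And>x. x \<in> space lebesgue_01 \<Longrightarrow> (\<lambda>i. s i x) \<longlonglongrightarrow> f' x"
      "\<And>i x. x \<in> space lebesgue_01 \<Longrightarrow> norm (s i x) \<le> 2 * norm (f' x)"
    by (simp_all add: dist_norm)
  have sm [measurable]: "s i \<in> borel_measurable lebesgue_01" for i
    using s(1) by (rule borel_measurable_simple_function)
  have si: "integrable lebesgue_01 (s i)" for i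
  proof (rule Bochner_Integration.integrable_bound)
    show "integrable lebesgue_01 (\<lambda>x. 2 * f' x)" using f(1) by simp
    show "AE x in lebesgue_01. norm (s i x) \<le> norm (2 * f' x)"
    proof (rule AE_I2)
      fix x assume "x \<in> space lebesgue_01"
      from s(3)[OF this, of i] show "norm (s i x) \<le> norm (2 * f' x)" by simp
    qed
  qed simp
  have "(\<lambda>i. \<integral>x. \<bar>f' x - s i x\<bar> \<partial>lebesgue_01) \<longlonglongrightarrow> (\<integral>x. 0 \<partial>lebesgue_01)"
  proof (rule integral_dominated_convergence[where w = "\<lambda>x. 3 * \<bar>f' x\<bar>"])
    show "AE x in lebesgue_01. (\<lambda>i. \<bar>f' x - s i x\<bar>) \<longlonglongrightarrow> 0"
    proof (rule AE_I2)
      fix x assume "x \<in> space lebesgue_01"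
      from tendsto_diff[OF tendsto_const[of "f' x"] s(2)[OF this]]
      show "(\<lambda>i. \<bar>f' x - s i x\<bar>) \<longlonglongrightarrow> 0" by (simp add: tendsto_rabs_zero)
    qed
    show "AE x in lebesgue_01. norm \<bar>f' x - s i x\<bar> \<le> 3 * \<bar>f' x\<bar>" for i
    proof (rule AE_I2)
      fix x assume "x \<in> space lebesgue_01"
      from s(3)[OF this, of i] show "norm \<bar>f' x - s i x\<bar> \<le> 3 * \<bar>f' x\<bar>"
        unfolding real_norm_def by linarith
    qed
  qed (use f in auto)
  then have "(\<lambda>i. norm (f - abs_L1 (s i))) \<longlonglongrightarrow> 0"
    using f si by (simp add: abs_L1_diff norm_abs_L1)
  from order_tendstoD(2)[OF this \<open>\<epsilon> > 0\<close>]
  obtain i where i: "norm (f - abs_L1 (s i)) < \<epsilon>" by (auto simp: eventually_sequentially)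
  define S where "S = s i ` space lebesgue_01"
  define A where "A y = s i -` {y} \<inter> space lebesgue_01" for y
  have finS: "finite S" using simple_functionD[OF s(1)[of i]] by (auto simp: S_def)
  have As: "A y \<in> sets lebesgue_01" for y
    using simple_functionD[OF s(1)[of i]] by (auto simp: A_def)
  have pick: "(\<Sum>y\<in>S. h y * indicator (A y) x) = h (s i x)" if "x \<in> space lebesgue_01" for h :: "real \<Rightarrow> real" and x
  proof -
    have "(\<Sum>y\<in>S. h y * indicator (A y) x) = (\<Sum>y\<in>S. if y = s i x then h y else 0)"
      using that by (intro sum.cong) (auto simp: A_def indicator_def)
    then show ?thesis using that finS by (simp add: S_def)
  qed
  have iA: "integrable lebesgue_01 (indicator (A y) :: real \<Rightarrow> real)" for y
    using As by (rule integrable_indicator_01)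
  have "abs_L1 (s i) = abs_L1 (\<lambda>x. \<Sum>y\<in>S. y * indicator (A y) x)"
    using si iA pick[of _ "\<lambda>y. y"] by (subst abs_L1_eq_iff) auto
  also have "\<dots> = (\<Sum>y\<in>S. y *\<^sub>R restrict_L1 (A y) one_L1)"
    using iA As by (simp add: abs_L1_sum[symmetric] abs_L1_scaleR restrict_one_L1)
  finally have rep: "abs_L1 (s i) = (\<Sum>y\<in>S. y *\<^sub>R restrict_L1 (A y) one_L1)" .
  have "norm (abs_L1 (s i)) = (\<integral>x. \<bar>s i x\<bar> \<partial>lebesgue_01)" using si by (simp add: norm_abs_L1)
  also have "\<dots> = (\<integral>x. (\<Sum>y\<in>S. \<bar>y\<bar> * indicator (A y) x) \<partial>lebesgue_01)"
    using pick[of _ abs] by (intro Bochner_Integration.integral_cong) auto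
  also have "\<dots> = (\<Sum>y\<in>S. \<bar>y\<bar> * \<mu> (A y))"
    using iA As Int_space_01[OF As] by simp
  finally show thesis
    unfolding rep using i by (intro that[OF finS As]) (simp_all add: rep)
qed

lemma norm_dual_L1_bound:
  assumes \<theta>: "\<And>B. B \<in> sets lebesgue_01 \<Longrightarrow> \<bar>blinfun_apply \<theta> (restrict_L1 B one_L1)\<bar> \<le> \<epsilon> * \<mu> B"
    and "\<epsilon> \<ge> 0"
  shows "norm \<theta> \<le> \<epsilon>"
proof (rule norm_blinfun_bound)
  fix f :: L1
  show "norm (\<theta> f) \<le> \<epsilon> * norm f"
  proof (rule field_le_epsilon)
    fix e :: real assume "e > 0"
    define d where "d = e / (norm \<theta> + \<epsilon> + 1)"
    have pos: "norm \<theta> + \<epsilon> + 1 > 0" using \<open>\<epsilon> \<ge> 0\<close> norm_ge_zero[of \<theta>] by linarith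
    then have "d > 0" using \<open>e > 0\<close> by (simp add: d_def)
    obtain S A where "finite S" and A: "\<And>y. A y \<in> sets lebesgue_01"
      and close: "norm (f - (\<Sum>y\<in>S. y *\<^sub>R restrict_L1 (A y) one_L1)) < d"
      and nrm: "norm (\<Sum>y\<in>S. y *\<^sub>R restrict_L1 (A y) one_L1) = (\<Sum>y\<in>S. \<bar>y\<bar> * \<mu> (A y))"
      by (rule L1_simple_approx[OF \<open>d > 0\<close>, of f]) (rule that)
    define g where "g = (\<Sum>y\<in>S. y *\<^sub>R restrict_L1 (A y) one_L1)"
    have "norm (\<theta> g) = norm (\<Sum>y\<in>S. y * \<theta> (restrict_L1 (A y) one_L1))"
      by (simp add: g_def blinfun.sum_right blinfun.scaleR_right)
    also have "\<dots> \<le> (\<Sum>y\<in>S. \<bar>y\<bar> * (\<epsilon> * \<mu> (A y)))"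
      using \<theta>[OF A] by (intro sum_norm_le) (auto simp: abs_mult intro!: mult_left_mono)
    also have "\<dots> = \<epsilon> * norm g" by (simp add: g_def nrm sum_distrib_left mult.left_commute)
    finally have 1: "norm (\<theta> g) \<le> \<epsilon> * norm g" .
    have 2: "norm (\<theta> (f - g)) \<le> norm \<theta> * d"
      using close norm_blinfun[of \<theta> "f - g"] unfolding g_def[symmetric]
      by (meson less_imp_le mult_left_mono norm_ge_zero order_trans)
    have "norm g \<le> norm f + d"
      using close norm_triangle_ineq2[of g f] unfolding g_def[symmetric] by (simp add: norm_minus_commute)
    then have 3: "\<epsilon> * norm g \<le> \<epsilon> * norm f + \<epsilon> * d"
      using \<open>\<epsilon> \<ge> 0\<close> mult_left_mono[of "norm g" "norm f + d" \<epsilon>] by (simp add: distrib_left)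
    have "norm (\<theta> f) \<le> norm (\<theta> g) + norm (\<theta> (f - g))"
      using norm_triangle_ineq[of "\<theta> g" "\<theta> (f - g)"] by (simp add: blinfun.diff_right)
    also have "\<dots> \<le> \<epsilon> * norm f + (norm \<theta> + \<epsilon> + 1) * d"
      using 1 2 3 \<open>d > 0\<close> by (simp add: algebra_simps)
    also have "(norm \<theta> + \<epsilon> + 1) * d = e" using pos by (simp add: d_def)
    finally show "norm (\<theta> f) \<le> \<epsilon> * norm f + e" .
  qed
qed fact

text \<open>
  The measurable sets whose indicator lies in \<open>C\<close> form a Dynkin system that contains the intervals,
  hence all Borel sets. Lebesgue sets differ from Borel sets by null sets, which \<open>L\<^sub>1\<close> does not see.
\<close>

lemma closed_subspace_L1_UNIV:
  assumes C: "subspace C" "closed C"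
    and ray: "\<And>t. 0 < t \<Longrightarrow> t < 1 \<Longrightarrow> restrict_L1 {0<..t} one_L1 \<in> C" and one: "one_L1 \<in> C"
  shows "(C :: L1 set) = UNIV"
proof -
  have top: "{0<..<1} \<in> sets lebesgue_01" using sets.top[of lebesgue_01] by simp
  have b01: "A \<inter> {0<..<1} \<in> sets lebesgue_01" if "A \<in> sets borel" for A
    using that by (auto simp: sets_restrict_space)
  have borelC: "restrict_L1 (A \<inter> {0<..<1}) one_L1 \<in> C" if "A \<in> sets borel" for A
  proof -
    have "sets (borel :: real measure) = sigma_sets UNIV (range (\<lambda>a::real. {..a}))"
      by (simp add: borel_eq_atMost)
    then have mem: "A \<in> sigma_sets UNIV (range (\<lambda>a::real. {..a}))" using that by simp
    have stable: "Int_stable (range (\<lambda>a::real. {..a}))"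
      by (auto simp: Int_stable_def Int_atMost)
    have sub: "range (\<lambda>a::real. {..a}) \<subseteq> Pow UNIV" by simp
    from stable sub mem show ?thesis
    proof (induction rule: sigma_sets_induct_disjoint)
      case (basic A)
      then obtain t where A: "A = {..t}" by auto
      consider "t \<le> 0" | "0 < t" "t < 1" | "1 \<le> t" by linarith
      then show ?case
      proof cases
        case 1
        then have "A \<inter> {0<..<1} = {}" by (auto simp: A)
        then show ?thesis using subspace_0[OF C(1)] restrict_L1_Un[of "{}" "{}"] by simp
      next
        case 2
        then have "A \<inter> {0<..<1} = {0<..t}" by (auto simp: A)
        then show ?thesis using ray 2 by simp
      next
        case 3
        then have "A \<inter> {0<..<1} = {0<..<1}" by (auto simp: A)
        then show ?thesis using one by simp
      qed
    next
      case empty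
      then show ?case using subspace_0[OF C(1)] restrict_L1_Un[of "{}" "{}"] by simp
    next
      case (compl A)
      have A: "A \<in> sets borel" using compl.hyps by (simp add: borel_eq_atMost)
      have "(UNIV - A) \<inter> {0<..<1} \<union> A \<inter> {0<..<1} = {0<..<1}" "((UNIV - A) \<inter> {0<..<1}) \<inter> (A \<inter> {0<..<1}) = {}"
        by auto
      then have "restrict_L1 {0<..<1} = restrict_L1 ((UNIV - A) \<inter> {0<..<1}) + restrict_L1 (A \<inter> {0<..<1})"
        using restrict_L1_Un[OF b01[of "UNIV - A"] b01[OF A]] A by (metis borel_comp Compl_eq_Diff_UNIV)
      then have "one_L1 = restrict_L1 ((UNIV - A) \<inter> {0<..<1}) one_L1 + restrict_L1 (A \<inter> {0<..<1}) one_L1"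
        by (metis blinfun.add_left id_blinfun.rep_eq restrict_L1_space)
      then show ?case using subspace_diff[OF C(1) one compl.IH] by (metis add_diff_cancel_right')
    next
      case (union A)
      have A: "A i \<in> sets borel" for i using union.hyps by (auto simp: borel_eq_atMost)
      define B where "B k = (\<Union>i<k. A i \<inter> {0<..<1})" for k :: nat
      define U where "U = (\<Union>i. A i \<inter> {0<..<1})"
      have Bs: "B k \<in> sets lebesgue_01" for k unfolding B_def using b01[OF A] by blast
      have Us: "U \<in> sets lebesgue_01" unfolding U_def using b01[OF A] by blast
      have BU: "B k \<subseteq> U" for k by (auto simp: B_def U_def)
      have BC: "restrict_L1 (B k) one_L1 \<in> C" for k
      proof (induction k)
        case 0
        then show ?case using subspace_0[OF C(1)] restrict_L1_Un[of "{}" "{}"] by (simp add: B_def)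
      next
        case (Suc k)
        have "B (Suc k) = B k \<union> (A k \<inter> {0<..<1})" by (auto simp: B_def less_Suc_eq)
        moreover have "B k \<inter> (A k \<inter> {0<..<1}) = {}"
        proof -
          have "A i \<inter> A k = {}" if "i < k" for i
            using disjoint_family_onD[OF union.hyps(1), of i k] that by simp
          then show ?thesis unfolding B_def by blast
        qed
        ultimately have "restrict_L1 (B (Suc k)) = restrict_L1 (B k) + restrict_L1 (A k \<inter> {0<..<1})"
          using restrict_L1_Un[OF Bs[of k] b01[OF A[of k]]] by simp
        then show ?case using subspace_add[OF C(1) Suc union.IH[of k]] by (simp add: blinfun.add_left)
      qed
      have "(\<lambda>k. \<mu> (B k)) \<longlonglongrightarrow> \<mu> (\<Union>k. B k)"
      proof (rule L01.finite_Lim_measure_incseq)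
        show "range B \<subseteq> sets lebesgue_01" using Bs by blast
        show "incseq B" unfolding incseq_def B_def by (intro allI impI UN_mono) auto
      qed
      moreover have "(\<Union>k. B k) = U" by (auto simp: B_def U_def)
      ultimately have "(\<lambda>k. \<mu> U - \<mu> (B k)) \<longlonglongrightarrow> 0"
        using tendsto_diff[OF tendsto_const[of "\<mu> U"]] by fastforce
      moreover have "norm (restrict_L1 (B k) one_L1 - restrict_L1 U one_L1) = \<mu> U - \<mu> (B k)" for k
      proof -
        have "B k \<union> (U - B k) = U" "B k \<inter> (U - B k) = {}" using BU[of k] by auto
        then have "restrict_L1 U = restrict_L1 (B k) + restrict_L1 (U - B k)"
          using restrict_L1_Un[OF Bs[of k] sets.Diff[OF Us Bs[of k]]] by simp
        then have "norm (restrict_L1 (B k) one_L1 - restrict_L1 U one_L1) = \<mu> (U - B k)"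
          using norm_restrict_one_L1[OF sets.Diff[OF Us Bs[of k]]] by (simp add: blinfun.add_left)
        then show ?thesis using L01.finite_measure_Diff[OF Us Bs BU] by simp
      qed
      ultimately have "(\<lambda>k. norm (restrict_L1 (B k) one_L1 - restrict_L1 U one_L1)) \<longlonglongrightarrow> 0" by simp
      then have lim: "(\<lambda>k. restrict_L1 (B k) one_L1) \<longlonglongrightarrow> restrict_L1 U one_L1"
        by (rule LIM_zero_cancel[OF tendsto_norm_zero_cancel])
      have "restrict_L1 U one_L1 \<in> C" by (rule closed_sequentially[OF C(2) BC lim])
      moreover have "(\<Union>i. A i) \<inter> {0<..<1} = U" by (auto simp: U_def)
      ultimately show ?case by simp
    qed
  qed
  have setC: "restrict_L1 A one_L1 \<in> C" if A: "A \<in> sets lebesgue_01" for A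
  proof -
    have "A \<in> sets (completion lborel)" "A \<subseteq> {0<..<1}"
      using A by (auto simp: sets_restrict_space)
    then obtain B N N' where B: "A = B \<union> N" "N \<subseteq> N'" "N' \<in> null_sets lborel" "B \<in> sets lborel"
      by (auto elim: sets_completionE)
    have N': "N' \<inter> {0<..<1} \<in> sets lebesgue_01" using b01[of N'] B(3) by auto
    have "\<mu> (N' \<inter> {0<..<1}) = measure lebesgue (N' \<inter> {0<..<1})"
      by (intro measure_restrict_space) auto
    also have "\<dots> = 0"
    proof -
      have "N' \<inter> {0<..<1} \<in> null_sets lborel" by (rule null_set_Int2[OF B(3)]) simp
      then have "N' \<inter> {0<..<1} \<in> null_sets lebesgue" by (rule null_sets_completionI)
      then show ?thesis by (simp add: measure_eq_0_null_sets)
    qed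
    finally have N0: "\<mu> (N' \<inter> {0<..<1}) = 0" .
    have "AE x in lebesgue_01. indicator A x = (indicator (B \<inter> {0<..<1}) x :: real)"
      using B(1,2) \<open>A \<subseteq> _\<close> N0 N'
      by (intro AE_I[where N = "N' \<inter> {0<..<1}"]) (auto simp: L01.emeasure_eq_measure split: split_indicator)
    then have "restrict_L1 A one_L1 = restrict_L1 (B \<inter> {0<..<1}) one_L1"
      using A b01[of B] B(4) by (simp add: restrict_one_L1 abs_L1_eq_iff integrable_indicator_01)
    then show ?thesis using borelC[of B] B(4) by simp
  qed
  have "f \<in> closure C" for f
  proof (subst closure_approachable, intro allI impI)
    fix e :: real assume "e > 0"
    obtain S A where "finite S" and A: "\<And>y. A y \<in> sets lebesgue_01"
      and close: "norm (f - (\<Sum>y\<in>S. y *\<^sub>R restrict_L1 (A y) one_L1)) < e"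
      by (rule L1_simple_approx[OF \<open>e > 0\<close>, of f]) (rule that)
    moreover have "(\<Sum>y\<in>S. y *\<^sub>R restrict_L1 (A y) one_L1) \<in> C"
      using setC[OF A] by (intro subspace_sum[OF C(1)] subspace_scale[OF C(1)])
    ultimately show "\<exists>y\<in>C. dist y f < e" by (auto simp: dist_norm norm_minus_commute)
  qed
  then show ?thesis using C(2) by auto
qed

section \<open>The bidual of L1\<close>

lemma blinfun_compose_assoc: "(f o\<^sub>L g) o\<^sub>L h = f o\<^sub>L (g o\<^sub>L h)"
  by (rule blinfun_eqI) simp

text \<open>
  The second adjoint of the restriction to \<open>A\<close>: it cuts an element of the bidual down to \<open>A\<close>, in the
  way in which a finitely additive measure is restricted to a set.
\<close>

definition biproj :: "real set \<Rightarrow> L1 dual dual \<Rightarrow>\<^sub>L L1 dual dual" where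
  "biproj A = dual_adjoint (dual_adjoint (restrict_L1 A))"

lemma biproj_apply [simp]: "blinfun_apply (blinfun_apply (biproj A) \<Phi>) \<phi> = blinfun_apply \<Phi> (\<phi> o\<^sub>L restrict_L1 A)"
  by (simp add: biproj_def)

lemma biproj_comp:
  "A \<in> sets lebesgue_01 \<Longrightarrow> B \<in> sets lebesgue_01 \<Longrightarrow> biproj A (biproj B \<Phi>) = biproj (A \<inter> B) \<Phi>"
  by (rule blinfun_eqI) (simp add: blinfun_compose_assoc restrict_L1_comp)

lemma biproj_Un:
  "A \<in> sets lebesgue_01 \<Longrightarrow> B \<in> sets lebesgue_01 \<Longrightarrow> A \<inter> B = {} \<Longrightarrow>
     biproj (A \<union> B) \<Phi> = biproj A \<Phi> + biproj B \<Phi>"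
  by (rule blinfun_eqI) (simp add: restrict_L1_Un blinfun.add_left
      bounded_bilinear.add_right[OF bounded_bilinear_blinfun_compose] blinfun.add_right)

lemma norm_biproj_le: "norm (biproj A \<Phi>) \<le> norm \<Phi>"
proof (rule norm_blinfun_bound)
  fix \<phi> :: "L1 dual"
  have "norm (\<phi> o\<^sub>L restrict_L1 A) \<le> norm \<phi>"
  proof (rule norm_blinfun_bound)
    fix f show "norm (blinfun_apply (\<phi> o\<^sub>L restrict_L1 A) f) \<le> norm \<phi> * norm f"
      using norm_blinfun[of \<phi> "restrict_L1 A f"] mult_left_mono[OF norm_restrict_L1_le[of A f], of "norm \<phi>"]
      by simp
  qed simp
  then show "norm (blinfun_apply (biproj A \<Phi>) \<phi>) \<le> norm \<Phi> * norm \<phi>"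
    using norm_blinfun[of \<Phi> "\<phi> o\<^sub>L restrict_L1 A"] mult_left_mono[of _ _ "norm \<Phi>"]
    by (fastforce intro: order_trans)
qed simp

text \<open>
  The norm of \<open>L\<^sub>1\<close> is additive over disjoint supports, so functionals of norm at most one on two
  disjoint sets combine to a functional of norm at most one. Hence the norm of the bidual is additive
  as well, and \<open>A \<mapsto> \<parallel>biproj A \<Phi>\<parallel>\<close> is a finitely additive measure: the total variation of \<open>\<Phi>\<close>.
\<close>

lemma norm_biproj_Un:
  assumes A: "A \<in> sets lebesgue_01" and B: "B \<in> sets lebesgue_01" and disj: "A \<inter> B = {}"
  shows "norm (biproj (A \<union> B) \<Phi>) = norm (biproj A \<Phi>) + norm (biproj B \<Phi>)"
proof (rule antisym)
  show "norm (biproj (A \<union> B) \<Phi>) \<le> norm (biproj A \<Phi>) + norm (biproj B \<Phi>)"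
    using assms by (simp add: biproj_Un norm_triangle_ineq)
  \<comment> \<open>The norm of \<open>\<Psi>\<close> is almost attained, without absolute values, on the unit ball.\<close>
  have unit: "\<exists>\<phi>. norm \<phi> \<le> 1 \<and> norm \<Psi> - e \<le> blinfun_apply \<Psi> \<phi>" if "e > 0" for \<Psi> :: "L1 dual dual" and e
  proof (rule ccontr)
    assume neg: "\<not> ?thesis"
    have "norm \<Psi> \<le> max 0 (norm \<Psi> - e)"
    proof (rule norm_blinfun_bound)
      fix \<phi> :: "L1 dual"
      show "norm (\<Psi> \<phi>) \<le> max 0 (norm \<Psi> - e) * norm \<phi>"
      proof (cases "\<phi> = 0")
        case False
        define \<zeta> where "\<zeta> = (sgn (\<Psi> \<phi>) / norm \<phi>) *\<^sub>R \<phi>"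
        have "norm \<zeta> \<le> 1" using False by (simp add: \<zeta>_def sgn_if)
        moreover have "\<Psi> \<zeta> = norm (\<Psi> \<phi>) / norm \<phi>"
          by (simp add: \<zeta>_def blinfun.scaleR_right sgn_if)
        ultimately have "norm (\<Psi> \<phi>) / norm \<phi> < norm \<Psi> - e" using neg by force
        then have "norm (\<Psi> \<phi>) \<le> (norm \<Psi> - e) * norm \<phi>" using False by (simp add: divide_less_eq)
        also have "\<dots> \<le> max 0 (norm \<Psi> - e) * norm \<phi>" by (intro mult_right_mono) auto
        finally show ?thesis .
      qed simp
    qed simp
    moreover have "norm \<Psi> - e > 0"
    proof (rule ccontr)
      assume "\<not> norm \<Psi> - e > 0"
      then have "norm (0 :: L1 dual) \<le> 1 \<and> norm \<Psi> - e \<le> \<Psi> 0" by simp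
      then show False using neg by blast
    qed
    ultimately show False using that by simp
  qed
  show "norm (biproj A \<Phi>) + norm (biproj B \<Phi>) \<le> norm (biproj (A \<union> B) \<Phi>)"
  proof (rule field_le_epsilon)
    fix e :: real assume "e > 0"
    then obtain \<phi> \<zeta> where \<phi>: "norm \<phi> \<le> 1" "norm (biproj A \<Phi>) - e / 2 \<le> biproj A \<Phi> \<phi>"
      and \<zeta>: "norm \<zeta> \<le> 1" "norm (biproj B \<Phi>) - e / 2 \<le> biproj B \<Phi> \<zeta>"
      using unit[of "e / 2" "biproj A \<Phi>"] unit[of "e / 2" "biproj B \<Phi>"] by auto
    define \<theta> where "\<theta> = (\<phi> o\<^sub>L restrict_L1 A) + (\<zeta> o\<^sub>L restrict_L1 B)"
    have "norm \<theta> \<le> 1"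
    proof (rule norm_blinfun_bound)
      fix f
      have "norm (\<phi> (restrict_L1 A f)) \<le> norm (restrict_L1 A f)"
        using norm_blinfun[of \<phi> "restrict_L1 A f"] mult_right_mono[OF \<phi>(1), of "norm (restrict_L1 A f)"] by simp
      moreover have "norm (\<zeta> (restrict_L1 B f)) \<le> norm (restrict_L1 B f)"
        using norm_blinfun[of \<zeta> "restrict_L1 B f"] mult_right_mono[OF \<zeta>(1), of "norm (restrict_L1 B f)"] by simp
      ultimately show "norm (blinfun_apply \<theta> f) \<le> 1 * norm f"
        using norm_restrict_L1_add[OF A B disj, of f]
        unfolding \<theta>_def by (simp add: blinfun.add_left)
    qed simp
    have absorb: "restrict_L1 A o\<^sub>L restrict_L1 (A \<union> B) = restrict_L1 A"
        "restrict_L1 B o\<^sub>L restrict_L1 (A \<union> B) = restrict_L1 B"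
      using A B by (simp_all add: restrict_L1_comp Int_absorb2)
    have "biproj (A \<union> B) \<Phi> \<theta> = biproj A \<Phi> \<phi> + biproj B \<Phi> \<zeta>"
      by (simp add: \<theta>_def absorb blinfun_compose_assoc blinfun.add_right
          bounded_bilinear.add_left[OF bounded_bilinear_blinfun_compose])
    moreover have "biproj (A \<union> B) \<Phi> \<theta> \<le> norm (biproj (A \<union> B) \<Phi>)"
      using norm_blinfun[of "biproj (A \<union> B) \<Phi>" \<theta>] mult_left_mono[OF \<open>norm \<theta> \<le> 1\<close>, of "norm (biproj (A \<union> B) \<Phi>)"]
      by simp
    ultimately show "norm (biproj A \<Phi>) + norm (biproj B \<Phi>) \<le> norm (biproj (A \<union> B) \<Phi>) + e"
      using \<phi>(2) \<zeta>(2) by linarith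
  qed
qed

lemma norm_biproj_Diff:
  assumes "A \<in> sets lebesgue_01" "B \<in> sets lebesgue_01" "B \<subseteq> A"
  shows "norm (biproj (A - B) \<Phi>) = norm (biproj A \<Phi>) - norm (biproj B \<Phi>)"
proof -
  have "(A - B) \<inter> B = {}" "A - B \<union> B = A" using assms by auto
  then show ?thesis using norm_biproj_Un[of "A - B" B \<Phi>] assms by simp
qed

lemma norm_biproj_mono:
  assumes "A \<in> sets lebesgue_01" "B \<in> sets lebesgue_01" "B \<subseteq> A"
  shows "norm (biproj B \<Phi>) \<le> norm (biproj A \<Phi>)"
  using norm_biproj_Diff[OF assms, of \<Phi>] norm_ge_zero[of "biproj (A - B) \<Phi>"] by linarith

definition abs_cont_bidual :: "L1 dual dual \<Rightarrow> bool" where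
  "abs_cont_bidual \<Phi> \<longleftrightarrow> (\<forall>\<epsilon>>0. \<exists>\<eta>>0. \<forall>A\<in>sets lebesgue_01. \<mu> A < \<eta> \<longrightarrow> norm (biproj A \<Phi>) \<le> \<epsilon>)"

text \<open>
  This replaces the identification of the dual of \<open>L\<^sub>1\<close> with \<open>L\<^sub>\<infinity>\<close>. After adding \<open>\<parallel>\<phi>\<parallel>\<close> times the
  measure, the set function of \<open>\<phi>\<close> is nonnegative and has a density \<open>g\<close>; cutting the range of \<open>g\<close>
  into intervals of length \<open>\<epsilon>\<close> approximates \<open>\<phi>\<close> by a step function, uniformly.
\<close>

lemma dual_L1_simple_approx:
  fixes \<phi> :: "L1 dual"
  assumes \<epsilon>: "\<epsilon> > 0"
  obtains m :: nat and c :: "nat \<Rightarrow> real" and A :: "nat \<Rightarrow> real set" where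
    "\<And>i. A i \<in> sets lebesgue_01" "norm (\<phi> - (\<Sum>i<m. c i *\<^sub>R set_functional (A i))) \<le> \<epsilon>"
proof -
  let ?\<nu> = "\<lambda>A. \<phi> (restrict_L1 A one_L1) + norm \<phi> * \<mu> A"
  have bd: "\<bar>blinfun_apply \<phi> (restrict_L1 A one_L1)\<bar> \<le> norm \<phi> * \<mu> A" if "A \<in> sets lebesgue_01" for A
    using norm_blinfun[of \<phi> "restrict_L1 A one_L1"] norm_restrict_one_L1[OF that] by simp
  have add: "\<phi> (restrict_L1 (A \<union> B) one_L1) = \<phi> (restrict_L1 A one_L1) + \<phi> (restrict_L1 B one_L1)"
    if "A \<in> sets lebesgue_01" "B \<in> sets lebesgue_01" "A \<inter> B = {}" for A B
    using that by (simp add: restrict_L1_Un blinfun.add_left blinfun.add_right)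
  obtain g where g: "integrable lebesgue_01 g" "\<And>A. A \<in> sets lebesgue_01 \<Longrightarrow> ?\<nu> A = (\<integral>x. indicator A x * g x \<partial>lebesgue_01)"
  proof (rule finitely_additive_density[of ?\<nu>])
    fix A B assume A: "A \<in> sets lebesgue_01"
    show "0 \<le> ?\<nu> A" using bd[OF A] by linarith
    assume B: "B \<in> sets lebesgue_01" "A \<inter> B = {}"
    show "?\<nu> (A \<union> B) = ?\<nu> A + ?\<nu> B"
      using A B by (simp add: add L01.finite_measure_Union distrib_left)
  next
    fix e :: real assume e: "e > 0"
    have "?\<nu> A \<le> e" if A: "A \<in> sets lebesgue_01" and "\<mu> A < e / (2 * norm \<phi> + 1)" for A
    proof -
      have "?\<nu> A \<le> (2 * norm \<phi> + 1) * \<mu> A"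
        using bd[OF A] measure_nonneg[of lebesgue_01 A] unfolding distrib_right by linarith
      also have "\<dots> \<le> (2 * norm \<phi> + 1) * (e / (2 * norm \<phi> + 1))"
        using that by (intro mult_left_mono) auto
      also have "\<dots> = e" using norm_ge_zero[of \<phi>] by (simp add: field_simps add_nonneg_eq_0_iff del: norm_ge_zero) 
      finally show ?thesis .
    qed
    then show "\<exists>\<eta>>0. \<forall>A\<in>sets lebesgue_01. \<mu> A < \<eta> \<longrightarrow> ?\<nu> A \<le> e"
      using e norm_ge_zero[of \<phi>] by (intro exI[of _ "e / (2 * norm \<phi> + 1)"]) (auto intro!: divide_pos_pos add_nonneg_pos)
  qed blast
  have gm [measurable]: "g \<in> borel_measurable lebesgue_01" using g(1) by auto
  obtain m :: nat where m: "2 * norm \<phi> < real m * \<epsilon>"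
    using reals_Archimedean3[OF \<epsilon>] by blast
  define A where "A i = {x \<in> space lebesgue_01. i * \<epsilon> \<le> g x \<and> g x < (i + 1) * \<epsilon>}" for i :: nat
  define R where "R = space lebesgue_01 - (\<Union>i<m. A i)"
  have As: "A i \<in> sets lebesgue_01" for i unfolding A_def by measurable
  have Rs: "R \<in> sets lebesgue_01" unfolding R_def using As by blast
  have disjA: "disjoint_family_on A {..<m}"
  proof (unfold disjoint_family_on_def, intro ballI impI)
    fix i j :: nat assume "i \<noteq> j"
    have False if "x \<in> A i" "x \<in> A j" "i < j" for x and i j :: nat
    proof -
      have "(real i + 1) * \<epsilon> \<le> real j * \<epsilon>" using that \<epsilon> by (intro mult_right_mono) auto
      moreover have "real j * \<epsilon> \<le> g x" "g x < (real i + 1) * \<epsilon>" using that by (auto simp: A_def add.commute)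
      ultimately show False by linarith
    qed
    then show "A i \<inter> A j = {}" using \<open>i \<noteq> j\<close> by (meson disjoint_iff linorder_neqE_nat)
  qed
  \<comment> \<open>On a part of a level set, \<open>\<phi>\<close> is almost a multiple of the measure.\<close>
  have piece: "\<bar>blinfun_apply \<phi> (restrict_L1 B one_L1) - (real i * \<epsilon> - norm \<phi>) * \<mu> B\<bar> \<le> \<epsilon> * \<mu> B"
    if B: "B \<in> sets lebesgue_01" "B \<subseteq> A i" for B and i :: nat
  proof -
    have iB: "integrable lebesgue_01 (\<lambda>x. indicator B x * c :: real)" for c
      using B integrable_indicator_01 by simp
    have Bm: "(\<integral>x. indicator B x * c \<partial>lebesgue_01) = c * \<mu> B" for c
      using B sets.sets_into_space[OF B(1)] by (simp add: Int_absorb2)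
    have Bg: "real i * \<epsilon> \<le> g x" "g x \<le> (real i + 1) * \<epsilon>" if "x \<in> B" for x
      using B(2) that by (auto simp: A_def add.commute less_imp_le)
    have "(\<integral>x. indicator B x * (real i * \<epsilon>) \<partial>lebesgue_01) \<le> (\<integral>x. indicator B x * g x \<partial>lebesgue_01)"
      using B(1) g(1) Bg by (intro integral_mono iB integrable_indicator_times) (auto split: split_indicator)
    moreover have "(\<integral>x. indicator B x * g x \<partial>lebesgue_01) \<le> (\<integral>x. indicator B x * ((real i + 1) * \<epsilon>) \<partial>lebesgue_01)"
      using B(1) g(1) Bg by (intro integral_mono iB integrable_indicator_times) (auto split: split_indicator)
    ultimately show ?thesis
      unfolding Bm g(2)[OF B(1), symmetric] by (simp add: abs_le_iff algebra_simps)
  qed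
  \<comment> \<open>The density does not exceed \<open>2 \<parallel>\<phi>\<parallel> < m \<epsilon>\<close> almost everywhere, so the level sets exhaust the interval.\<close>
  have R0: "\<mu> R = 0"
  proof -
    have gpos: "AE x in lebesgue_01. 0 \<le> g x"
    proof -
      define Z where "Z = {x \<in> space lebesgue_01. g x < 0}"
      have Zs: "Z \<in> sets lebesgue_01" unfolding Z_def by measurable
      have "0 \<le> ?\<nu> Z" using bd[OF Zs] by linarith
      then have "0 \<le> (\<integral>x. indicator Z x * g x \<partial>lebesgue_01)" using g(2)[OF Zs] by simp
      moreover have "AE x in lebesgue_01. 0 \<le> - (indicator Z x * g x)"
        by (auto simp: Z_def split: split_indicator)
      ultimately have "AE x in lebesgue_01. - (indicator Z x * g x) = 0"
        using integral_nonneg_eq_0_iff_AE[of lebesgue_01 "\<lambda>x. - (indicator Z x * g x)"]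
          integral_nonneg_AE[of "\<lambda>x. - (indicator Z x * g x)" lebesgue_01] g Zs
        by (simp add: integrable_indicator_times)
      then show ?thesis by (rule AE_mp) (auto simp: Z_def split: split_indicator)
    qed
    have big: "AE x in lebesgue_01. x \<in> R \<longrightarrow> real m * \<epsilon> \<le> g x"
      using gpos
    proof (rule AE_mp, intro AE_I2 impI)
      fix x assume x: "x \<in> space lebesgue_01" "0 \<le> g x" "x \<in> R"
      show "real m * \<epsilon> \<le> g x"
      proof (rule ccontr)
        assume "\<not> ?thesis"
        define i where "i = nat \<lfloor>g x / \<epsilon>\<rfloor>"
        have i: "real i \<le> g x / \<epsilon>" "g x / \<epsilon> < real i + 1"
          using x \<epsilon> by (auto simp: i_def)
        then have "x \<in> A i" using x \<epsilon> by (auto simp: A_def field_simps)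
        moreover have "i < m"
        proof -
          have "g x / \<epsilon> < m" using \<open>\<not> _\<close> \<epsilon> by (simp add: field_simps)
          with i(1) show ?thesis by linarith
        qed
        ultimately show False using x by (auto simp: R_def)
      qed
    qed
    have "(real m * \<epsilon>) * \<mu> R = (\<integral>x. indicator R x * (real m * \<epsilon>) \<partial>lebesgue_01)"
      using Rs sets.sets_into_space[OF Rs] by (simp add: Int_absorb2)
    also have "\<dots> \<le> (\<integral>x. indicator R x * g x \<partial>lebesgue_01)"
      using Rs g big integrable_indicator_01[OF Rs]
      by (intro integral_mono_AE integrable_indicator_times) (auto split: split_indicator elim: AE_mp)
    also have "\<dots> \<le> 2 * norm \<phi> * \<mu> R"
      using g(2)[OF Rs] bd[OF Rs] by linarith
    finally have "(real m * \<epsilon> - 2 * norm \<phi>) * \<mu> R \<le> 0" by (simp add: algebra_simps)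
    then show ?thesis using m measure_nonneg[of lebesgue_01 R] by (simp add: mult_le_0_iff)
  qed
  define \<theta> where "\<theta> = \<phi> - (\<Sum>i<m. (real i * \<epsilon> - norm \<phi>) *\<^sub>R set_functional (A i))"
  have "norm \<theta> \<le> \<epsilon>"
  proof (rule norm_dual_L1_bound)
    fix B assume B: "B \<in> sets lebesgue_01"
    have sf: "set_functional C (restrict_L1 B one_L1) = \<mu> (B \<inter> C)" if "C \<in> sets lebesgue_01" for C
    proof -
      have "restrict_L1 C (restrict_L1 B one_L1) = abs_L1 (indicator (B \<inter> C))"
        using restrict_L1_comp[OF that B] B that
        by (metis blinfun_apply_blinfun_compose inf_commute restrict_one_L1 sets.Int)
      moreover have "B \<inter> C \<subseteq> {0<..<1}" using sets.sets_into_space[OF B] by auto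
      ultimately show ?thesis
        using B that integral_L1(2)[of "indicator (B \<inter> C)"] integrable_indicator_01[of "B \<inter> C"]
        by (simp add: Int_absorb2)
    qed
    have disjB: "disjoint_family_on (\<lambda>i. B \<inter> A i) {..<m}" using disjA by (auto simp: disjoint_family_on_def)
    have split: "B = (\<Union>i<m. B \<inter> A i) \<union> (B \<inter> R)"
      using sets.sets_into_space[OF B] by (auto simp: R_def)
    have Usets: "(\<Union>i<k. B \<inter> A i) \<in> sets lebesgue_01" for k using B As by blast
    have addU: "\<phi> (restrict_L1 (\<Union>i<k. B \<inter> A i) one_L1) = (\<Sum>i<k. \<phi> (restrict_L1 (B \<inter> A i) one_L1))" if "k \<le> m" for k
      using that
    proof (induction k)
      case 0 then show ?case using bd[of "{}"] by simp
    next
      case (Suc k)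
      have "(\<Union>i<k. B \<inter> A i) \<inter> (B \<inter> A k) = {}"
      proof -
        have "A i \<inter> A k = {}" if "i < k" for i
          using disjoint_family_onD[OF disjA, of i k] Suc.prems that by simp
        then show ?thesis by blast
      qed
      moreover have "(\<Union>i<Suc k. B \<inter> A i) = (\<Union>i<k. B \<inter> A i) \<union> (B \<inter> A k)"
        by (auto simp: less_Suc_eq)
      ultimately show ?case using Suc add[of "\<Union>i<k. B \<inter> A i" "B \<inter> A k"] Usets B As by simp
    qed
    have BR: "\<mu> (B \<inter> R) = 0"
      using R0 L01.finite_measure_mono[of "B \<inter> R" R] Rs measure_nonneg[of lebesgue_01 "B \<inter> R"] by auto
    have \<phi>R: "\<phi> (restrict_L1 (B \<inter> R) one_L1) = 0"
      using bd[of "B \<inter> R"] BR B Rs by auto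
    have dR: "(\<Union>i<m. B \<inter> A i) \<inter> (B \<inter> R) = {}" by (auto simp: R_def)
    have "\<phi> (restrict_L1 B one_L1) = (\<Sum>i<m. \<phi> (restrict_L1 (B \<inter> A i) one_L1))"
      using add[OF Usets[of m] sets.Int[OF B Rs] dR] addU[of m] \<phi>R split by simp
    then have "\<theta> (restrict_L1 B one_L1)
        = (\<Sum>i<m. \<phi> (restrict_L1 (B \<inter> A i) one_L1) - (real i * \<epsilon> - norm \<phi>) * \<mu> (B \<inter> A i))"
      using sf[OF As] by (simp add: \<theta>_def blinfun.diff_left blinfun.sum_left blinfun.scaleR_left sum_subtractf)
    also have "\<bar>\<dots>\<bar> \<le> (\<Sum>i<m. \<epsilon> * \<mu> (B \<inter> A i))"
      using piece B As by (intro order_trans[OF sum_abs] sum_mono) auto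
    also have "\<dots> = \<epsilon> * \<mu> (\<Union>i<m. B \<inter> A i)"
      using B As disjB by (subst L01.finite_measure_finite_Union) (auto simp: sum_distrib_left)
    also have "\<dots> \<le> \<epsilon> * \<mu> B"
      using \<epsilon> B by (intro mult_left_mono L01.finite_measure_mono) auto
    finally show "\<bar>blinfun_apply \<theta> (restrict_L1 B one_L1)\<bar> \<le> \<epsilon> * \<mu> B" .
  qed (use \<epsilon> in simp)
  then show thesis unfolding \<theta>_def by (rule that[OF As])
qed

lemma biproj_split:
  assumes "A \<in> sets lebesgue_01" "B \<in> sets lebesgue_01"
  shows "biproj A \<Phi> = biproj (A - B) \<Phi> + biproj (A \<inter> B) \<Phi>"
    and "norm (biproj A \<Phi>) = norm (biproj (A - B) \<Phi>) + norm (biproj (A \<inter> B) \<Phi>)"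
proof -
  have *: "(A - B) \<inter> (A \<inter> B) = {}" "A - B \<union> A \<inter> B = A" by auto
  show "biproj A \<Phi> = biproj (A - B) \<Phi> + biproj (A \<inter> B) \<Phi>"
    using biproj_Un[OF _ _ *(1), of \<Phi>] assms unfolding *(2) by blast
  show "norm (biproj A \<Phi>) = norm (biproj (A - B) \<Phi>) + norm (biproj (A \<inter> B) \<Phi>)"
    using norm_biproj_Un[OF _ _ *(1), of \<Phi>] assms unfolding *(2) by blast
qed

text \<open>
  The total variation \<open>N\<close> and the sum of \<open>N\<close> and the set function \<open>m\<close> of \<open>\<Phi>\<close> are both nonnegative
  and absolutely continuous. The difference of their densities is the function that represents \<open>\<Phi>\<close>.
\<close>

theorem abs_cont_bidual_in_range:
  assumes ac: "abs_cont_bidual \<Phi>"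
  shows "\<Phi> \<in> range canonical_embedding"
proof -
  define N where "N A = norm (biproj A \<Phi>)" for A
  define m where "m A = \<Phi> (set_functional A)" for A
  have N_Un: "N (A \<union> B) = N A + N B" and m_Un: "m (A \<union> B) = m A + m B"
    if "A \<in> sets lebesgue_01" "B \<in> sets lebesgue_01" "A \<inter> B = {}" for A B
    using that unfolding N_def m_def
    by (simp_all add: norm_biproj_Un restrict_L1_Un blinfun.add_right
        bounded_bilinear.add_right[OF bounded_bilinear_blinfun_compose])
  have mN: "\<bar>m A\<bar> \<le> N A" for A
  proof -
    have "\<bar>m A\<bar> \<le> N A * norm integral_L1"
      using norm_blinfun[of "biproj A \<Phi>" integral_L1] by (simp add: m_def N_def)
    also have "\<dots> \<le> N A" using mult_left_mono[OF integral_L1(1), of "N A"] by (simp add: N_def)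
    finally show ?thesis .
  qed
  have Nac: "\<exists>\<eta>>0. \<forall>A\<in>sets lebesgue_01. \<mu> A < \<eta> \<longrightarrow> N A \<le> \<epsilon>" if "\<epsilon> > 0" for \<epsilon>
    using ac that by (auto simp: abs_cont_bidual_def N_def)
  obtain g where g: "integrable lebesgue_01 g"
      "\<And>A. A \<in> sets lebesgue_01 \<Longrightarrow> N A = (\<integral>x. indicator A x * g x \<partial>lebesgue_01)"
    by (rule finitely_additive_density[of N]) (use Nac N_Un in \<open>auto simp: N_def\<close>)
  obtain k where k: "integrable lebesgue_01 k"
      "\<And>A. A \<in> sets lebesgue_01 \<Longrightarrow> N A + m A = (\<integral>x. indicator A x * k x \<partial>lebesgue_01)"
  proof (rule finitely_additive_density[of "\<lambda>A. N A + m A"])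
    show "0 \<le> N A + m A" for A using mN[of A] by linarith
    show "\<exists>\<eta>>0. \<forall>A\<in>sets lebesgue_01. \<mu> A < \<eta> \<longrightarrow> N A + m A \<le> \<epsilon>" if "\<epsilon> > 0" for \<epsilon>
    proof -
      obtain \<eta> where "\<eta> > 0" and \<eta>: "\<forall>A\<in>sets lebesgue_01. \<mu> A < \<eta> \<longrightarrow> N A \<le> \<epsilon> / 2"
        using Nac[of "\<epsilon> / 2"] \<open>\<epsilon> > 0\<close> by (meson half_gt_zero)
      moreover have "N A + m A \<le> \<epsilon>" if "N A \<le> \<epsilon> / 2" for A using that mN[of A] by linarith
      ultimately show ?thesis by blast
    qed
  qed (use N_Un m_Un in auto)
  define f where "f = abs_L1 (\<lambda>x. k x - g x)"
  have mf: "m A = set_functional A f" if A: "A \<in> sets lebesgue_01" for A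
  proof -
    have "set_functional A f = (\<integral>x. indicator A x * k x - indicator A x * g x \<partial>lebesgue_01)"
      using A g(1) k(1) unfolding f_def
      by (simp add: restrict_L1_abs integral_L1 integrable_indicator_times right_diff_distrib)
    also have "\<dots> = m A"
      using A k(2)[OF A] g(2)[OF A] k(1) g(1) by (simp add: integrable_indicator_times)
    finally show ?thesis by simp
  qed
  have "\<Phi> \<phi> = \<phi> f" for \<phi>
  proof -
    have "\<bar>\<Phi> \<phi> - \<phi> f\<bar> \<le> \<epsilon>" if "\<epsilon> > 0" for \<epsilon>
    proof -
      define M where "M = norm \<Phi> + norm f + 1"
      have M: "M > 0" using norm_ge_zero[of \<Phi>] norm_ge_zero[of f] unfolding M_def by linarith
      obtain l :: nat and c A where A: "\<And>i. A i \<in> sets lebesgue_01"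
        and \<theta>: "norm (\<phi> - (\<Sum>i<l. c i *\<^sub>R set_functional (A i))) \<le> \<epsilon> / M"
      proof -
        have pos: "\<epsilon> / M > 0" using M \<open>\<epsilon> > 0\<close> by simp
        show ?thesis by (rule dual_L1_simple_approx[OF pos, of \<phi>]) (rule that)
      qed
      define \<theta> where "\<theta> = \<phi> - (\<Sum>i<l. c i *\<^sub>R set_functional (A i))"
      have "\<Phi> \<phi> - \<phi> f = \<Phi> \<theta> - \<theta> f"
        using mf[OF A] unfolding \<theta>_def m_def
        by (simp add: blinfun.diff_right blinfun.diff_left blinfun.sum_left blinfun.sum_right
            blinfun.scaleR_left blinfun.scaleR_right)
      also have "\<bar>\<dots>\<bar> \<le> norm \<Phi> * norm \<theta> + norm \<theta> * norm f"
        using norm_blinfun[of \<Phi> \<theta>] norm_blinfun[of \<theta> f] by (simp add: abs_le_iff)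
      also have "\<dots> \<le> M * norm \<theta>" by (simp add: M_def algebra_simps)
      also have "\<dots> \<le> M * (\<epsilon> / M)" using \<theta> M unfolding \<theta>_def by (intro mult_left_mono) auto
      finally show ?thesis using M by simp
    qed
    then have "\<bar>\<Phi> \<phi> - \<phi> f\<bar> \<le> 0" by (meson field_le_epsilon dense_ge)
    then show ?thesis by simp
  qed
  then have "\<Phi> = canonical_embedding f" by (intro blinfun_eqI) simp
  then show ?thesis by blast
qed

text \<open>
  The Yosida--Hewitt decomposition. Let \<open>c\<^sub>0\<close> be the amount of variation of \<open>\<Phi>\<close> that remains on sets
  of arbitrarily small measure. Unions \<open>B k\<close> of tails of a sequence of small sets that capture almost
  \<open>c\<^sub>0\<close> decrease and capture at least \<open>c\<^sub>0\<close>. By additivity of the norm the restrictions of \<open>\<Phi>\<close> to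
  \<open>B k\<close> form a Cauchy sequence; its limit is the singular part, and no variation on small sets is left
  for the rest.
\<close>

theorem bidual_L1_decomposition:
  fixes \<Phi> :: "L1 dual dual"
  obtains f \<sigma> B where "\<Phi> = canonical_embedding f + \<sigma>" "\<And>k. B k \<in> sets lebesgue_01" "decseq B"
    "(\<lambda>k. \<mu> (B k)) \<longlonglongrightarrow> 0" "\<And>k. biproj (B k) \<sigma> = \<sigma>"
proof -
  define N where "N A = norm (biproj A \<Phi>)" for A
  \<comment> \<open>The number \<open>c\<^sub>0\<close> is the infimum of all bounds for the variation on sufficiently small sets.\<close>
  define C where "C = {c. \<exists>\<eta>>0. \<forall>A\<in>sets lebesgue_01. \<mu> A < \<eta> \<longrightarrow> N A \<le> c}"
  have N0: "0 \<le> N A" for A by (simp add: N_def)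
  have Cne: "norm \<Phi> \<in> C" unfolding C_def N_def using norm_biproj_le by (auto intro: exI[of _ 1])
  have C0: "0 \<le> c" if c: "c \<in> C" for c
  proof -
    obtain \<eta> where "\<eta> > 0" "\<forall>A\<in>sets lebesgue_01. \<mu> A < \<eta> \<longrightarrow> N A \<le> c"
      using c unfolding C_def by blast
    then have "N {} \<le> c" by (simp del: sets_restrict_space)
    then show ?thesis using N0[of "{}"] by simp
  qed
  have bdd: "bdd_below C" using C0 by (rule bdd_belowI)
  define c0 where "c0 = Inf C"
  have ub: "\<exists>\<eta>>0. \<forall>A\<in>sets lebesgue_01. \<mu> A < \<eta> \<longrightarrow> N A \<le> c0 + \<epsilon>" if "\<epsilon> > 0" for \<epsilon>
  proof -
    have "\<exists>c\<in>C. c < c0 + \<epsilon>"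
      using that cInf_less_iff[OF _ bdd, of "c0 + \<epsilon>"] Cne unfolding c0_def by force
    then show ?thesis unfolding C_def by fastforce
  qed
  have lb: "\<exists>A\<in>sets lebesgue_01. \<mu> A < \<eta> \<and> c0 - \<epsilon> < N A" if "\<epsilon> > 0" "\<eta> > 0" for \<epsilon> \<eta>
  proof (rule ccontr)
    assume "\<not> ?thesis"
    then have "c0 - \<epsilon> \<in> C" unfolding C_def using that by (force simp: not_less)
    then have "c0 \<le> c0 - \<epsilon>" unfolding c0_def using bdd by (rule cInf_lower)
    then show False using that by simp
  qed
  have "\<exists>A. A \<in> sets lebesgue_01 \<and> \<mu> A < (1/2) ^ k \<and> c0 - (1/2) ^ k < N A" for k :: nat
    using lb[of "(1/2) ^ k" "(1/2) ^ k"] unfolding Bex_def by simp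
  then obtain A where A: "\<And>k. A k \<in> sets lebesgue_01" "\<And>k. \<mu> (A k) < (1/2) ^ k"
      "\<And>k. c0 - (1/2) ^ k < N (A k)"
    by metis
  define B where "B k = (\<Union>i. A (i + k))" for k
  have AB: "A j \<subseteq> B k" if "j \<ge> k" for j k
    using that UN_upper[of "j - k" UNIV "\<lambda>i. A (i + k)"] by (simp add: B_def)
  have Bs: "B k \<in> sets lebesgue_01" for k unfolding B_def using A(1) by blast
  have decB: "decseq B" unfolding decseq_def
  proof (intro allI impI)
    fix k l :: nat assume "k \<le> l"
    then show "B l \<subseteq> B k" unfolding B_def[of l] by (intro UN_least AB) simp
  qed
  have mB: "\<mu> (B k) \<le> 2 * (1/2) ^ k" for k
  proof -
    have geo: "summable (\<lambda>i. (1/2::real) ^ (i + k))"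
      by (simp add: power_add summable_mult2)
    have le: "\<mu> (A (i + k)) \<le> (1/2) ^ (i + k)" for i
      using A(2) by (rule less_imp_le)
    have sm: "summable (\<lambda>i. \<mu> (A (i + k)))"
      by (rule summable_comparison_test'[OF geo, of 0]) (use le in auto)
    have "\<mu> (B k) \<le> (\<Sum>i. \<mu> (A (i + k)))"
      unfolding B_def using A(1) by (intro L01.finite_measure_subadditive_countably sm) auto
    also have "\<dots> \<le> (\<Sum>i. (1/2)^(i + k))"
      using le sm geo by (rule suminf_le)
    also have "\<dots> = 2 * (1/2) ^ k"
      using suminf_mult2[of "\<lambda>i. (1/2::real)^i" "(1/2)^k"] suminf_geometric[of "1/2::real"]
      by (simp add: power_add)
    finally show ?thesis .
  qed
  have half0: "(\<lambda>k. 2 * (1/2::real) ^ k) \<longlonglongrightarrow> 0"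
    using tendsto_mult_right_zero[OF LIMSEQ_power_zero[of "1/2::real"], of 2] by simp
  have mB0: "(\<lambda>k. \<mu> (B k)) \<longlonglongrightarrow> 0"
    by (rule tendsto_sandwich[OF _ _ tendsto_const half0]) (simp_all only: mB measure_nonneg eventually_True)
  have NB: "c0 \<le> N (B k)" for k
  proof (rule LIMSEQ_le_const2)
    show "(\<lambda>j. c0 - (1/2) ^ j) \<longlonglongrightarrow> c0"
      using tendsto_diff[OF tendsto_const[of c0] LIMSEQ_power_zero[of "1/2::real"]] by simp
    have "c0 - (1/2) ^ j \<le> N (B k)" if "j \<ge> k" for j
      using A(3)[of j] norm_biproj_mono[OF Bs[of k] A(1)[of j] AB[OF that], of \<Phi>] unfolding N_def by linarith
    then show "\<exists>M. \<forall>j\<ge>M. c0 - (1/2) ^ j \<le> N (B k)" by blast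
  qed
  define \<Psi> where "\<Psi> k = biproj (B k) \<Phi>" for k
  have diff: "norm (\<Psi> k - \<Psi> l) = N (B k) - N (B l)" if "k \<le> l" for k l
  proof -
    have sub: "B l \<subseteq> B k" using decB that by (simp add: decseq_def)
    have "\<Psi> k = biproj (B k - B l) \<Phi> + \<Psi> l"
      using biproj_split(1)[OF Bs[of k] Bs[of l], of \<Phi>] sub by (simp add: \<Psi>_def Int_absorb1)
    then show ?thesis using norm_biproj_Diff[OF Bs Bs sub] by (simp add: N_def)
  qed
  have NBub: "\<exists>k. \<forall>l\<ge>k. N (B l) \<le> c0 + \<epsilon>" if "\<epsilon> > 0" for \<epsilon>
  proof -
    obtain \<eta> where "\<eta> > 0" and \<eta>: "\<forall>A\<in>sets lebesgue_01. \<mu> A < \<eta> \<longrightarrow> N A \<le> c0 + \<epsilon>"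
      using ub[OF \<open>\<epsilon> > 0\<close>] by blast
    obtain k where k: "\<forall>l\<ge>k. \<mu> (B l) < \<eta>"
      using order_tendstoD(2)[OF mB0 \<open>\<eta> > 0\<close>] unfolding eventually_sequentially by blast
    have "N (B l) \<le> c0 + \<epsilon>" if "l \<ge> k" for l
      using \<eta>[rule_format, OF Bs k[rule_format, OF that]] .
    then show ?thesis by blast
  qed
  have "Cauchy \<Psi>"
  proof (rule CauchyI')
    fix e :: real assume "e > 0"
    then obtain k where k: "\<forall>l\<ge>k. N (B l) \<le> c0 + e / 2" using NBub[of "e / 2"] by auto
    have "dist (\<Psi> i) (\<Psi> j) < e" if "i \<ge> k" "i < j" for i j
    proof -
      have "N (B i) \<le> c0 + e / 2" using k that by blast
      then show ?thesis using diff[of i j] NB[of j] that \<open>e > 0\<close> by (simp add: dist_norm)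
    qed
    then show "\<exists>M. \<forall>m\<ge>M. \<forall>n>m. dist (\<Psi> m) (\<Psi> n) < e" by blast
  qed
  then obtain \<sigma> where \<sigma>: "\<Psi> \<longlonglongrightarrow> \<sigma>" using Cauchy_convergent convergent_def by blast
  have \<sigma>B: "biproj (B k) \<sigma> = \<sigma>" for k
  proof (rule LIMSEQ_unique)
    show "(\<lambda>l. biproj (B k) (\<Psi> l)) \<longlonglongrightarrow> biproj (B k) \<sigma>"
      using \<sigma> by (intro blinfun.tendsto tendsto_const)
    have "biproj (B k) (\<Psi> l) = \<Psi> l" if "l \<ge> k" for l
      using that decB Bs by (simp add: \<Psi>_def biproj_comp decseq_def Int_absorb1)
    then show "(\<lambda>l. biproj (B k) (\<Psi> l)) \<longlonglongrightarrow> \<sigma>"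
      by (intro Lim_transform_eventually[OF \<sigma>] eventually_sequentiallyI[of k]) simp
  qed
  have "abs_cont_bidual (\<Phi> - \<sigma>)"
    unfolding abs_cont_bidual_def
  proof (intro allI impI)
    fix \<epsilon> :: real assume "\<epsilon> > 0"
    define e where "e = \<epsilon> / 2"
    have e: "e > 0" using \<open>\<epsilon> > 0\<close> by (simp add: e_def)
    obtain \<eta> where "\<eta> > 0" and \<eta>: "\<forall>A\<in>sets lebesgue_01. \<mu> A < \<eta> \<longrightarrow> N A \<le> c0 + e"
      using ub[OF e] by blast
    have "\<forall>\<^sub>F k in sequentially. \<mu> (B k) < \<eta> / 2 \<and> norm (\<Psi> k - \<sigma>) < e"
      using order_tendstoD(2)[OF mB0, of "\<eta> / 2"] \<open>\<eta> > 0\<close> tendstoD[OF \<sigma> e, unfolded dist_norm]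
      by (intro eventually_conj) simp_all
    then obtain k where k: "\<mu> (B k) < \<eta> / 2" "norm (\<Psi> k - \<sigma>) < e"
      unfolding eventually_sequentially by blast
    have "norm (biproj D (\<Phi> - \<sigma>)) \<le> \<epsilon>" if D: "D \<in> sets lebesgue_01" "\<mu> D < \<eta> / 2" for D
    proof -
      have "\<mu> (D \<union> B k) < \<eta>"
        using measure_Un_le[OF D(1) Bs[of k]] D(2) k(1) by linarith
      then have "N (D \<union> B k) \<le> c0 + e" using \<eta>[rule_format, OF sets.Un[OF D(1) Bs[of k]]] by simp
      moreover have "N (D \<union> B k) = N (D - B k) + N (B k)"
      proof -
        have "(D \<union> B k) - B k = D - B k" "(D \<union> B k) \<inter> B k = B k" by auto
        then show ?thesis
          using biproj_split(2)[OF sets.Un[OF D(1) Bs[of k]] Bs[of k], of \<Phi>] unfolding N_def by simp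
      qed
      ultimately have out: "N (D - B k) \<le> e" using NB[of k] by linarith
      have "biproj (D - B k) \<sigma> = biproj (D - B k) (biproj (B k) \<sigma>)" by (simp add: \<sigma>B)
      also have "\<dots> = biproj {} \<sigma>"
      proof -
        have "(D - B k) \<inter> B k = {}" by auto
        then show ?thesis using biproj_comp[OF sets.Diff[OF D(1) Bs[of k]] Bs[of k], of \<sigma>] by simp
      qed
      also have "\<dots> = 0" using biproj_Un[of "{}" "{}" \<sigma>] by simp
      finally have "biproj (D - B k) (\<Phi> - \<sigma>) = biproj (D - B k) \<Phi>" by (simp add: blinfun.diff_right)
      then have 1: "norm (biproj (D - B k) (\<Phi> - \<sigma>)) \<le> e" using out by (simp add: N_def)
      have "norm (biproj (D \<inter> B k) (\<Phi> - \<sigma>)) \<le> norm (biproj (B k) (\<Phi> - \<sigma>))"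
        by (rule norm_biproj_mono[OF Bs sets.Int[OF D(1) Bs] Int_lower2])
      also have "biproj (B k) (\<Phi> - \<sigma>) = \<Psi> k - \<sigma>"
        by (simp add: blinfun.diff_right \<sigma>B \<Psi>_def)
      finally have 2: "norm (biproj (D \<inter> B k) (\<Phi> - \<sigma>)) \<le> e" using k(2) by linarith
      have "norm (biproj D (\<Phi> - \<sigma>)) = norm (biproj (D - B k) (\<Phi> - \<sigma>)) + norm (biproj (D \<inter> B k) (\<Phi> - \<sigma>))"
        by (rule biproj_split(2)[OF D(1) Bs])
      then show ?thesis using 1 2 by (simp add: e_def)
    qed
    then show "\<exists>\<eta>>0. \<forall>A\<in>sets lebesgue_01. \<mu> A < \<eta> \<longrightarrow> norm (biproj A (\<Phi> - \<sigma>)) \<le> \<epsilon>"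
      using \<open>\<eta> > 0\<close> by (intro exI[of _ "\<eta> / 2"]) auto
  qed
  then obtain f where "\<Phi> - \<sigma> = canonical_embedding f"
    using abs_cont_bidual_in_range by blast
  then have "\<Phi> = canonical_embedding f + \<sigma>" by (simp add: algebra_simps)
  then show thesis using Bs decB mB0 \<sigma>B by (rule that)
qed

text \<open>
  For the singular part \<open>\<sigma>\<close> and a functional \<open>\<phi>\<close>, Helly's theorem is applied to the operator
  \<open>f \<mapsto> (T f, \<phi> f)\<close> restricted to the small set \<open>B k\<close>. It yields functions \<open>u k\<close> on \<open>B k\<close> such that
  \<open>T (u k)\<close> converges and \<open>\<phi> (u k)\<close> tends to \<open>\<sigma> \<phi>\<close>. Since \<open>u k\<close> tends to zero, \<open>\<sigma> \<phi> = 0\<close>.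
\<close>

theorem tauberian_of_bounded_below_on_small_support:
  fixes T :: "L1 \<Rightarrow>\<^sub>L 'b::banach"
  assumes "\<delta> > 0" and "c > 0"
    and below: "\<And>f. supp_measure f < \<delta> \<Longrightarrow> c * norm f \<le> norm (T f)"
  shows "tauberian T"
proof -
  have "\<Phi> \<in> range canonical_embedding"
    if y: "dual_adjoint (dual_adjoint T) \<Phi> = canonical_embedding y" for \<Phi> y
  proof -
    obtain f \<sigma> B where \<Phi>: "\<Phi> = canonical_embedding f + \<sigma>" and Bs: "\<And>k. B k \<in> sets lebesgue_01"
      and decB: "decseq B" and B0: "(\<lambda>k. \<mu> (B k)) \<longlonglongrightarrow> 0" and \<sigma>B: "\<And>k. biproj (B k) \<sigma> = \<sigma>"
      using bidual_L1_decomposition[of \<Phi>] by blast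
    define g where "g = y - T f"
    have \<sigma>T: "\<sigma> (\<psi> o\<^sub>L T) = \<psi> g" for \<psi>
    proof -
      have "\<Phi> (\<psi> o\<^sub>L T) = \<psi> y" using y by (metis canonical_embedding_apply dual_adjoint_apply blinfun_apply_blinfun_compose)
      then show ?thesis by (simp add: \<Phi> g_def blinfun.add_left blinfun.diff_right)
    qed
    have "\<sigma> \<phi> = 0" for \<phi>
    proof -
      define P where "P = (\<lambda>k f. (T (restrict_L1 (B k) f), \<phi> (restrict_L1 (B k) f)))"
      have blP: "bounded_linear (P k)" for k
        unfolding P_def by (intro bounded_linear_Pair bounded_linear_compose[OF blinfun.bounded_linear_right blinfun.bounded_linear_right])
      have "\<exists>x. norm x \<le> norm \<sigma> + 1 \<and> norm (P k x - (g, \<sigma> \<phi>)) \<le> inverse (real (Suc k))" for k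
      proof -
        have "\<sigma> (\<psi> o\<^sub>L Blinfun (P k)) = \<psi> (g, \<sigma> \<phi>)" for \<psi> :: "('b \<times> real) dual"
        proof -
          \<comment> \<open>A functional on the product splits into a functional on the first factor and a number.\<close>
          define \<psi>1 where "\<psi>1 = Blinfun (\<lambda>z. \<psi> (z, 0))"
          have \<psi>1: "blinfun_apply \<psi>1 z = \<psi> (z, 0)" for z
            unfolding \<psi>1_def
            by (subst bounded_linear_Blinfun_apply)
              (auto intro!: bounded_linear_compose[OF blinfun.bounded_linear_right] bounded_linear_Pair bounded_linear_ident bounded_linear_zero)
          have split: "\<psi> (z, t) = \<psi>1 z + t * \<psi> (0, 1)" for z t
          proof -
            have "(z, t) = (z, 0) + t *\<^sub>R (0, 1)" by simp
            then show ?thesis by (simp only: blinfun.add_right blinfun.scaleR_right \<psi>1 real_scaleR_def)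
          qed
          have "\<psi> o\<^sub>L Blinfun (P k) = ((\<psi>1 o\<^sub>L T) + \<psi> (0, 1) *\<^sub>R \<phi>) o\<^sub>L restrict_L1 (B k)"
          proof (rule blinfun_eqI)
            fix x
            have "blinfun_apply (\<psi> o\<^sub>L Blinfun (P k)) x = \<psi> (T (restrict_L1 (B k) x), \<phi> (restrict_L1 (B k) x))"
              by (simp add: bounded_linear_Blinfun_apply[OF blP]) (simp add: P_def)
            also note split
            finally show "blinfun_apply (\<psi> o\<^sub>L Blinfun (P k)) x
                = blinfun_apply (((\<psi>1 o\<^sub>L T) + \<psi> (0, 1) *\<^sub>R \<phi>) o\<^sub>L restrict_L1 (B k)) x"
              by (simp add: blinfun.add_left blinfun.scaleR_left)
          qed
          then have "\<sigma> (\<psi> o\<^sub>L Blinfun (P k)) = biproj (B k) \<sigma> ((\<psi>1 o\<^sub>L T) + \<psi> (0, 1) *\<^sub>R \<phi>)" by simp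
          also have "\<dots> = \<psi>1 g + \<psi> (0, 1) * \<sigma> \<phi>"
            by (simp only: \<sigma>B blinfun.add_right blinfun.scaleR_right \<sigma>T real_scaleR_def)
          finally show ?thesis using split[of g "\<sigma> \<phi>"] by (simp only: mult.commute)
        qed
        from helly_bidual[OF this, of "inverse (real (Suc k))"]
        obtain x where x: "norm x \<le> norm \<sigma> + inverse (real (Suc k))" "norm (P k x - (g, \<sigma> \<phi>)) \<le> inverse (real (Suc k))"
          by (auto simp: bounded_linear_Blinfun_apply[OF blP])
        moreover have "inverse (real (Suc k)) \<le> (1::real)" by (simp add: inverse_eq_divide)
        ultimately show ?thesis by (intro exI[of _ x]) linarith
      qed
      then obtain x where x: "\<And>k. norm (x k) \<le> norm \<sigma> + 1" "\<And>k. norm (P k (x k) - (g, \<sigma> \<phi>)) \<le> inverse (real (Suc k))"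
        by metis
      define u where "u k = restrict_L1 (B k) (x k)" for k
      have "(\<lambda>k. P k (x k)) \<longlonglongrightarrow> (g, \<sigma> \<phi>)"
        using LIMSEQ_inverse_real_of_nat x(2) by (subst LIM_zero_iff[symmetric]) (rule Lim_null_comparison[OF always_eventually], auto)
      then have Tu: "(\<lambda>k. T (u k)) \<longlonglongrightarrow> g" and \<phi>u: "(\<lambda>k. \<phi> (u k)) \<longlonglongrightarrow> \<sigma> \<phi>"
        unfolding P_def u_def by (auto dest: tendsto_fst tendsto_snd)
      have ures: "restrict_L1 (B k) (u l) = u l" if "k \<le> l" for k l
      proof -
        have "B k \<inter> B l = B l" using decB that by (auto simp: decseq_def)
        then show ?thesis
          using restrict_L1_comp[OF Bs[of k] Bs[of l]] unfolding u_def by (metis blinfun_apply_blinfun_compose)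
      qed
      obtain k0 where k0: "\<mu> (B k0) < \<delta>"
        using order_tendstoD(2)[OF B0 \<open>\<delta> > 0\<close>] by (auto simp: eventually_sequentially)
      have lower: "c * norm (u i - u j) \<le> norm (T (u i) - T (u j))" if "i \<ge> k0" "j \<ge> k0" for i j
      proof -
        have "restrict_L1 (B k0) (u i - u j) = u i - u j" by (simp add: blinfun.diff_right ures that)
        then have "supp_measure (u i - u j) < \<delta>"
          using supp_measure_restrict[OF Bs[of k0], of "u i - u j"] k0 by simp
        from below[OF this] show ?thesis by (simp add: blinfun.diff_right)
      qed
      have "Cauchy u"
      proof (rule CauchyI)
        fix e :: real assume "e > 0"
        then have "c * e > 0" using \<open>c > 0\<close> by simp
        moreover have "Cauchy (\<lambda>k. T (u k))" using Tu by (rule LIMSEQ_imp_Cauchy)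
        ultimately obtain M where M: "\<forall>i\<ge>M. \<forall>j\<ge>M. norm (T (u i) - T (u j)) < c * e"
          using CauchyD by blast
        have "norm (u i - u j) < e" if "i \<ge> max M k0" "j \<ge> max M k0" for i j
        proof -
          have "c * norm (u i - u j) < c * e" using lower[of i j] M that by (meson le_less_trans max.boundedE)
          then show ?thesis using \<open>c > 0\<close> by simp
        qed
        then show "\<exists>M. \<forall>m\<ge>M. \<forall>n\<ge>M. norm (u m - u n) < e" by blast
      qed
      then obtain v where v: "u \<longlonglongrightarrow> v" using Cauchy_convergent convergent_def by blast
      have "restrict_L1 (B k) v = v" for k
      proof (rule LIMSEQ_unique)
        show "(\<lambda>l. restrict_L1 (B k) (u l)) \<longlonglongrightarrow> restrict_L1 (B k) v" by (intro blinfun.tendsto tendsto_const v)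
        show "(\<lambda>l. restrict_L1 (B k) (u l)) \<longlonglongrightarrow> v"
          by (intro Lim_transform_eventually[OF v] eventually_sequentiallyI[of k]) (simp add: ures)
      qed
      then have "supp_measure v \<le> \<mu> (B k)" for k
        using supp_measure_restrict[OF Bs[of k], of v] by simp
      then have "supp_measure v \<le> 0" by (intro LIMSEQ_le_const[OF B0]) auto
      then have "v = 0" by (rule supp_measure_0)
      then have "(\<lambda>k. \<phi> (u k)) \<longlonglongrightarrow> \<phi> 0" using v by (intro blinfun.tendsto tendsto_const) simp
      then show ?thesis using \<phi>u LIMSEQ_unique by force
    qed
    then have "\<sigma> = 0" by (intro blinfun_eqI) simp
    then show ?thesis using \<Phi> by simp
  qed
  moreover have "dual_adjoint (dual_adjoint T) (canonical_embedding x) = canonical_embedding (T x)" for x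
    by (rule blinfun_eqI) simp
  ultimately show ?thesis
    unfolding tauberian_def by (auto simp: image_iff)
qed

section \<open>Lossless expanders\<close>

lemma self_power_le_fact: "real k ^ k \<le> 3 ^ k * fact k"
proof -
  have sm: "(\<lambda>n. real k ^ n /\<^sub>R fact n) sums exp (real k)" by (rule exp_converges)
  have "real k ^ k /\<^sub>R fact k = (\<Sum>n\<in>{k}. real k ^ n /\<^sub>R fact n)" by simp
  also have "\<dots> \<le> exp (real k)"
    unfolding sums_unique[OF sm] by (rule sum_le_suminf[OF sums_summable[OF sm]]) auto
  also have "\<dots> = exp 1 ^ k" by (simp add: exp_of_nat_mult[symmetric])
  also have "\<dots> \<le> 3 ^ k" by (intro power_mono exp_le) simp
  finally show ?thesis by (simp add: field_simps)
qed

lemma binomial_le_power: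
  assumes "k > 0"
  shows "real (n choose k) \<le> (3 * real n / real k) ^ k"
proof -
  have "real (n choose k) * fact k \<le> real n ^ k"
    using binomial_fact_pow[of n k] by (metis of_nat_fact of_nat_le_iff of_nat_mult of_nat_power)
  then have "real (n choose k) * (3 ^ k * fact k) \<le> 3 ^ k * real n ^ k"
    by (simp add: mult.left_commute)
  moreover have "real (n choose k) * real k ^ k \<le> real (n choose k) * (3 ^ k * fact k)"
    by (intro mult_left_mono self_power_le_fact) simp
  ultimately have "real (n choose k) * real k ^ k \<le> (3 * real n) ^ k"
    unfolding power_mult_distrib by linarith
  then show ?thesis using assms by (simp add: power_divide field_simps)
qed

text \<open>
  The union bound. A map \<open>\<sigma>\<close> that sends the edges of some set of \<open>a\<close> left vertices into fewer than
  \<open>6a\<close> points sends them into a set of exactly \<open>6a\<close> points. The proportion of such maps is at most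
  \<open>(5n choose a) (n choose 6a) (6a/n)\<^sup>8\<^sup>a \<le> (393660 a/n)\<^sup>a\<close>, and the sum over \<open>1 \<le> a \<le> n/2000000\<close> is less
  than one. Degree 8 leaves one more factor \<open>a/n\<close> per vertex than the \<open>1 + 6\<close> needed to choose the sets.
\<close>

lemma expander_exists:
  fixes n :: nat
  assumes n: "n > 0"
  shows "\<exists>\<sigma>. (\<forall>e\<in>{..<5*n} \<times> {..<8::nat}. \<sigma> e < n) \<and>
    (\<forall>A\<subseteq>{..<5*n}. 2000000 * card A \<le> n \<longrightarrow> 6 * card A \<le> card (\<sigma> ` (A \<times> {..<8::nat})))"
proof (rule ccontr)
  assume neg: "\<not> ?thesis"
  define V where "V = {..<5*n}"
  define E where "E = V \<times> {..<8::nat}"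
  define F where "F = E \<rightarrow>\<^sub>E {..<n}"
  define G where "G A B = {\<sigma>\<in>F. \<sigma> ` (A \<times> {..<8::nat}) \<subseteq> B}" for A B
  define m where "m = n div 2000000"
  let ?bad = "(\<Union>a\<in>{1..m}. \<Union>A\<in>{A. A \<subseteq> V \<and> card A = a}. \<Union>B\<in>{B. B \<subseteq> {..<n} \<and> card B = 6 * a}. G A B)"
  have cV: "card V = 5 * n" and fV: "finite V" and cE: "card E = 40 * n" and fE: "finite E"
    by (auto simp: V_def E_def)
  have cF: "card F = n ^ (40 * n)" using fE cE by (simp add: F_def card_PiE)
  have cover: "F \<subseteq> ?bad"
  proof
    fix \<sigma> assume \<sigma>: "\<sigma> \<in> F"
    then have "\<forall>e\<in>{..<5*n} \<times> {..<8::nat}. \<sigma> e < n" by (auto simp: F_def E_def V_def PiE_iff)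
    with neg obtain A where A: "A \<subseteq> V" "2000000 * card A \<le> n" "card (\<sigma> ` (A \<times> {..<8::nat})) < 6 * card A"
      unfolding V_def by (meson not_le)
    then have a: "card A \<in> {1..m}" by (auto simp: m_def less_eq_div_iff_mult_less_eq mult.commute intro!: Suc_leI gr0I)
    have sub: "\<sigma> ` (A \<times> {..<8::nat}) \<subseteq> {..<n}" using \<sigma> A(1) by (auto simp: F_def E_def PiE_iff)
    have "6 * card A \<le> card {..<n}" using A(2) by simp
    then obtain B where "\<sigma> ` (A \<times> {..<8::nat}) \<subseteq> B" "B \<subseteq> {..<n}" "card B = 6 * card A"
      using exists_subset_between[of "\<sigma> ` (A \<times> {..<8::nat})" "6 * card A" "{..<n}"] A(3) sub by auto
    then show "\<sigma> \<in> ?bad"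
      using A(1) a \<sigma> unfolding G_def by blast
  qed
  have cG: "card (G A B) = (6 * a) ^ (8 * a) * n ^ (40 * n - 8 * a)"
    if A: "A \<subseteq> V" "card A = a" and B: "B \<subseteq> {..<n}" "card B = 6 * a" for A B a
  proof -
    have fin: "finite A" using A fV finite_subset by blast
    have AE: "A \<times> {..<8::nat} \<subseteq> E" using A by (auto simp: E_def)
    have "G A B = (\<Pi>\<^sub>E e\<in>E. if e \<in> A \<times> {..<8::nat} then B else {..<n})"
    proof (intro set_eqI iffI)
      fix \<sigma> assume "\<sigma> \<in> G A B"
      then show "\<sigma> \<in> (\<Pi>\<^sub>E e\<in>E. if e \<in> A \<times> {..<8::nat} then B else {..<n})"
        unfolding G_def F_def by (auto simp: PiE_iff image_subset_iff)
    next
      fix \<sigma> assume \<sigma>: "\<sigma> \<in> (\<Pi>\<^sub>E e\<in>E. if e \<in> A \<times> {..<8::nat} then B else {..<n})"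
      have "\<sigma> e < n" if "e \<in> E" for e using PiE_mem[OF \<sigma> that] B(1) by (auto split: if_splits)
      moreover have "\<sigma> e \<in> B" if "e \<in> A \<times> {..<8::nat}" for e using PiE_mem[OF \<sigma>, of e] that AE by auto
      ultimately show "\<sigma> \<in> G A B" using \<sigma> unfolding G_def F_def by (auto simp: PiE_iff)
    qed
    then have "card (G A B) = (\<Prod>e\<in>E. if e \<in> A \<times> {..<8::nat} then card B else n)"
      using fE by (simp add: card_PiE if_distrib cong: if_cong)
    also have "\<dots> = (\<Prod>e\<in>E \<inter> (A \<times> {..<8::nat}). card B) * (\<Prod>e\<in>E - A \<times> {..<8::nat}. n)"
      using fE by (simp add: prod.If_cases Diff_eq)
    also have "E \<inter> (A \<times> {..<8::nat}) = A \<times> {..<8::nat}" using AE by blast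
    also have "(\<Prod>e\<in>A \<times> {..<8::nat}. card B) * (\<Prod>e\<in>E - A \<times> {..<8::nat}. n) = (6 * a) ^ (8 * a) * n ^ (40 * n - 8 * a)"
      using AE fin A B cE card_Diff_subset[of "A \<times> {..<8::nat}" E]
      by (simp add: card_cartesian_product mult.commute)
    finally show ?thesis .
  qed
  define cnt where "cnt a = (5 * n choose a) * ((n choose (6 * a)) * ((6 * a) ^ (8 * a) * n ^ (40 * n - 8 * a)))" for a
  have term_le: "real (cnt a) \<le> (1/4) ^ a * real n ^ (40 * n)"
    if a: "a \<in> {1..m}" for a
  proof -
    have an: "2000000 * a \<le> n" "a > 0" using a by (auto simp: m_def less_eq_div_iff_mult_less_eq mult.commute)
    then have r: "real a / real n \<le> 1 / 2000000" using n by (simp add: field_simps)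
    have "real (cnt a)
        \<le> (3 * real (5 * n) / real a) ^ a * ((3 * real n / real (6 * a)) ^ (6 * a) * (real (6 * a) ^ (8 * a) * real n ^ (40 * n - 8 * a)))"
      unfolding cnt_def of_nat_mult of_nat_power
      using an binomial_le_power[of a "5 * n"] binomial_le_power[of "6 * a" n]
      by (intro mult_mono mult_right_mono) auto
    also have "real n ^ (40 * n - 8 * a) = real n ^ (40 * n) / real n ^ (8 * a)"
      using an n by (intro power_diff) auto
    also have "(3 * real (5 * n) / real a) ^ a * ((3 * real n / real (6 * a)) ^ (6 * a) * (real (6 * a) ^ (8 * a) * (real n ^ (40 * n) / real n ^ (8 * a))))
        = ((3 * real (5 * n) / real a) * (3 * real n / real (6 * a)) ^ 6 * (real (6 * a) / real n) ^ 8) ^ a * real n ^ (40 * n)"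
      unfolding power_mult by (simp only: power_mult_distrib power_divide times_divide_eq_right times_divide_eq_left)
    also have "\<dots> \<le> (1/4) ^ a * real n ^ (40 * n)"
    proof (intro mult_right_mono power_mono)
      have x: "x > 0 \<Longrightarrow> 15 / x * (1 / (2 * x)) ^ 6 * (6 * x) ^ 8 = 393660 * x" for x :: real
        by (simp add: field_simps power_numeral_reduce)
      have "(3 * real (5 * n) / real a) * (3 * real n / real (6 * a)) ^ 6 * (real (6 * a) / real n) ^ 8 = 393660 * (real a / real n)"
        using x[of "real a / real n"] an n by simp
      then show "(3 * real (5 * n) / real a) * (3 * real n / real (6 * a)) ^ 6 * (real (6 * a) / real n) ^ 8 \<le> 1 / 4"
        using r by simp
    qed auto
    finally show ?thesis .
  qed
  have "card F \<le> card ?bad"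
  proof (rule card_mono[OF _ cover])
    have "finite F" unfolding F_def using fE by (intro finite_PiE) auto
    then have "finite (G A B)" for A B unfolding G_def by simp
    then show "finite ?bad"
      using fV by auto
  qed
  also have "\<dots> \<le> (\<Sum>a\<in>{1..m}. \<Sum>A\<in>{A. A \<subseteq> V \<and> card A = a}. \<Sum>B\<in>{B. B \<subseteq> {..<n} \<and> card B = 6 * a}. card (G A B))"
    using fV by (intro order_trans[OF card_UN_le] sum_mono) auto
  also have "\<dots> = (\<Sum>a\<in>{1..m}. \<Sum>A\<in>{A. A \<subseteq> V \<and> card A = a}. \<Sum>B\<in>{B. B \<subseteq> {..<n} \<and> card B = 6 * a}. (6 * a) ^ (8 * a) * n ^ (40 * n - 8 * a))"
    using cG by (intro sum.cong refl) auto
  also have "\<dots> = (\<Sum>a\<in>{1..m}. cnt a)"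
    using fV cV by (simp add: n_subsets cnt_def)
  finally have "real (card F) \<le> (\<Sum>a\<in>{1..m}. real (cnt a))"
    by (simp only: of_nat_sum[symmetric] of_nat_le_iff)
  also have "\<dots> \<le> (\<Sum>a\<in>{1..m}. (1/4) ^ a * real n ^ (40 * n))"
    by (intro sum_mono term_le)
  also have "\<dots> = (\<Sum>a\<in>{1..m}. (1/4) ^ a) * real n ^ (40 * n)" by (simp add: sum_distrib_right)
  also have "\<dots> < 1 * real n ^ (40 * n)"
  proof (rule mult_strict_right_mono)
    have "3 * (\<Sum>a\<in>{1..k}. (1/4::real) ^ a) = 1 - (1/4) ^ k" for k :: nat
      by (induction k) (simp_all add: algebra_simps)
    from this[of m] show "(\<Sum>a\<in>{1..m}. (1/4::real) ^ a) < 1"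
      using zero_less_power[of "1/4::real" m] by linarith
  qed (use n in simp)
  finally show False by (simp add: cF)
qed

text \<open>
  Right vertices of large degree are split into vertices of degree at most \<open>D\<close>. Each vertex causes at
  most one incomplete block, which bounds the number of new vertices. A refinement of \<open>\<sigma>\<close> has images
  at least as large, so that expansion is preserved.
\<close>

lemma split_fibres:
  assumes fE: "finite E" and fW: "finite W" and \<sigma>: "\<sigma> ` E \<subseteq> W" and D: "D > 0"
  obtains \<tau> :: "'e \<Rightarrow> nat" where "\<And>e. e \<in> E \<Longrightarrow> \<tau> e < card W + card E div D"
    "\<And>w. card {e\<in>E. \<tau> e = w} \<le> D" "\<And>e e'. e \<in> E \<Longrightarrow> e' \<in> E \<Longrightarrow> \<tau> e = \<tau> e' \<Longrightarrow> \<sigma> e = \<sigma> e'"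
proof -
  define F where "F w = {e\<in>E. \<sigma> e = w}" for w
  have fF: "finite (F w)" for w using fE by (simp add: F_def)
  have "\<exists>h. bij_betw h (F w) {..<card (F w)}" for w
    using ex_bij_betw_finite_nat[OF fF, of w] by (simp add: atLeast0LessThan)
  then obtain h where h: "\<And>w. bij_betw (h w) (F w) {..<card (F w)}" by metis
  define S where "S = (SIGMA w:W. {..card (F w) div D})"
  have fS: "finite S" unfolding S_def using fW by auto
  have "D * (\<Sum>w\<in>W. card (F w) div D) \<le> (\<Sum>w\<in>W. card (F w))"
    unfolding sum_distrib_left by (intro sum_mono) simp
  also have "\<dots> = card E"
    using sum_card_image sum.group[OF fE fW \<sigma>, of "\<lambda>_. 1::nat"] by (simp add: F_def)
  finally have "(\<Sum>w\<in>W. card (F w) div D) \<le> card E div D"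
    using D by (simp add: less_eq_div_iff_mult_less_eq mult.commute)
  then have cS: "card S \<le> card W + card E div D"
    using fW by (simp add: S_def card_SigmaI sum.distrib sum_Suc)
  obtain g where g: "bij_betw g S {..<card S}"
    using ex_bij_betw_finite_nat[OF fS] by (auto simp: atLeast0LessThan)
  define \<rho> where "\<rho> e = (\<sigma> e, h (\<sigma> e) e div D)" for e
  have hb: "h (\<sigma> e) e < card (F (\<sigma> e))" if "e \<in> E" for e
    using bij_betwE[OF h[of "\<sigma> e"]] that by (auto simp: F_def)
  have \<rho>S: "\<rho> e \<in> S" if "e \<in> E" for e
    using hb[OF that] \<sigma> that by (auto simp: S_def \<rho>_def intro!: div_le_mono)
  have inj: "inj_on g S" using g by (rule bij_betw_imp_inj_on)
  have \<tau>eq: "\<rho> e = \<rho> e'" if "e \<in> E" "e' \<in> E" "g (\<rho> e) = g (\<rho> e')" for e e'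
    using inj_onD[OF inj that(3)] \<rho>S that by blast
  show thesis
  proof (rule that[of "g \<circ> \<rho>"])
    fix e assume "e \<in> E"
    then show "(g \<circ> \<rho>) e < card W + card E div D"
      using bij_betwE[OF g] \<rho>S[of e] cS by fastforce
  next
    fix e e' assume "e \<in> E" "e' \<in> E" "(g \<circ> \<rho>) e = (g \<circ> \<rho>) e'"
    then show "\<sigma> e = \<sigma> e'" using \<tau>eq by (auto simp: \<rho>_def)
  next
    fix w
    show "card {e\<in>E. (g \<circ> \<rho>) e = w} \<le> D"
    proof (cases "{e\<in>E. (g \<circ> \<rho>) e = w} = {}")
      case True
      show ?thesis unfolding True by simp
    next
      case False
      then obtain e0 where e0: "e0 \<in> E" "g (\<rho> e0) = w" by auto
      define q where "q = h (\<sigma> e0) e0 div D"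
      have in_F: "e \<in> F (\<sigma> e0)" "h (\<sigma> e0) e \<in> {q * D..<q * D + D}" if "e \<in> E" "g (\<rho> e) = w" for e
      proof -
        have "\<rho> e = \<rho> e0" using \<tau>eq[of e e0] that e0 by simp
        then have *: "\<sigma> e = \<sigma> e0" "h (\<sigma> e0) e div D = q" by (auto simp: \<rho>_def q_def)
        then show "e \<in> F (\<sigma> e0)" using that by (simp add: F_def)
        show "h (\<sigma> e0) e \<in> {q * D..<q * D + D}"
          using *(2) D div_mult_mod_eq[of "h (\<sigma> e0) e" D] mod_less_divisor[OF D, of "h (\<sigma> e0) e"] by auto
      qed
      have "card {e\<in>E. (g \<circ> \<rho>) e = w} \<le> card {q * D..<q * D + D}"
      proof (rule card_inj_on_le)
        show "inj_on (h (\<sigma> e0)) {e\<in>E. (g \<circ> \<rho>) e = w}"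
          using bij_betw_imp_inj_on[OF h[of "\<sigma> e0"]] in_F by (auto intro: inj_on_subset)
        show "h (\<sigma> e0) ` {e\<in>E. (g \<circ> \<rho>) e = w} \<subseteq> {q * D..<q * D + D}" using in_F(2) by auto
      qed simp
      then show ?thesis by simp
    qed
  qed
qed

lemma bounded_degree_expander_exists:
  fixes n :: nat
  assumes n: "n > 0"
  obtains \<sigma> :: "nat \<times> nat \<Rightarrow> nat" where
    "\<And>e. e \<in> {..<5*n} \<times> {..<8::nat} \<Longrightarrow> \<sigma> e < 2 * n"
    "\<And>w. card {e \<in> {..<5*n} \<times> {..<8::nat}. \<sigma> e = w} \<le> 40"
    "\<And>A. A \<subseteq> {..<5*n} \<Longrightarrow> 2000000 * card A \<le> n \<Longrightarrow> 6 * card A \<le> card (\<sigma> ` (A \<times> {..<8::nat}))"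
proof -
  let ?E = "{..<5*n} \<times> {..<8::nat}"
  obtain \<rho> where \<rho>: "\<forall>e\<in>?E. \<rho> e < n"
    "\<And>A. A \<subseteq> {..<5*n} \<Longrightarrow> 2000000 * card A \<le> n \<Longrightarrow> 6 * card A \<le> card (\<rho> ` (A \<times> {..<8::nat}))"
    using expander_exists[OF n] by blast
  obtain \<sigma> where \<sigma>: "\<And>e. e \<in> ?E \<Longrightarrow> \<sigma> e < card {..<n} + card ?E div 40"
    "\<And>w. card {e\<in>?E. \<sigma> e = w} \<le> 40" "\<And>e e'. e \<in> ?E \<Longrightarrow> e' \<in> ?E \<Longrightarrow> \<sigma> e = \<sigma> e' \<Longrightarrow> \<rho> e = \<rho> e'"
    using split_fibres[of ?E "{..<n}" \<rho> 40] \<rho>(1) by auto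
  show thesis
  proof (rule that[of \<sigma>])
    show "\<sigma> e < 2 * n" if "e \<in> ?E" for e using \<sigma>(1)[OF that] by (simp add: card_cartesian_product)
    show "card {e\<in>?E. \<sigma> e = w} \<le> 40" for w by (rule \<sigma>(2))
    fix A assume A: "A \<subseteq> {..<5*n}" "2000000 * card A \<le> n"
    have fin: "finite (A \<times> {..<8::nat})" using finite_subset[OF A(1)] by simp
    define \<kappa> where "\<kappa> w = \<rho> (SOME e. e \<in> A \<times> {..<8::nat} \<and> \<sigma> e = w)" for w
    have "\<kappa> (\<sigma> e) = \<rho> e" if e: "e \<in> A \<times> {..<8::nat}" for e
    proof -
      have "\<exists>e'. e' \<in> A \<times> {..<8::nat} \<and> \<sigma> e' = \<sigma> e" using e by blast
      define e' where "e' = (SOME e'. e' \<in> A \<times> {..<8::nat} \<and> \<sigma> e' = \<sigma> e)"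
      have e': "e' \<in> A \<times> {..<8::nat}" "\<sigma> e' = \<sigma> e"
        using someI_ex[OF \<open>\<exists>e'. _ e'\<close>] unfolding e'_def by blast+
      have "e \<in> ?E" "e' \<in> ?E" using e e'(1) A(1) by auto
      from \<sigma>(3)[OF this(2,1) e'(2)] show ?thesis by (simp add: \<kappa>_def e'_def)
    qed
    then have "\<rho> ` (A \<times> {..<8::nat}) = \<kappa> ` (\<sigma> ` (A \<times> {..<8::nat}))"
      unfolding image_image by (intro image_cong) simp_all
    then have "card (\<rho> ` (A \<times> {..<8::nat})) \<le> card (\<sigma> ` (A \<times> {..<8::nat}))" using fin by (simp add: card_image_le)
    then show "6 * card A \<le> card (\<sigma> ` (A \<times> {..<8::nat}))" using \<rho>(2)[OF A] by simp
  qed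
qed

section \<open>Operators on finite L1 spaces defined by expanders\<close>

text \<open>
  The adjacency operator of the bipartite multigraph in which an edge \<open>e\<close> joins \<open>fst e\<close> to \<open>\<sigma> e\<close>.
\<close>

definition edge_sum :: "(nat \<times> nat) set \<Rightarrow> (nat \<times> nat \<Rightarrow> nat) \<Rightarrow> (nat \<Rightarrow> 'a::comm_monoid_add) \<Rightarrow> nat \<Rightarrow> 'a" where
  "edge_sum E \<sigma> f w = (\<Sum>e\<in>{e\<in>E. \<sigma> e = w}. f (fst e))"

text \<open>
  A discrete layer-cake argument: lowering \<open>g\<close> by its least positive value \<open>m\<close> on its support \<open>S\<close>
  lowers the left-hand side by \<open>k m |S|\<close> and the right-hand side by at least \<open>m\<close> for each neighbour of
  \<open>S\<close>; expansion compares the two.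
\<close>

lemma sum_edge_max_ge:
  fixes g :: "nat \<Rightarrow> real" and k s M :: nat
  assumes fV: "finite V" and \<sigma>: "\<And>e. e \<in> V \<times> {..<d} \<Longrightarrow> \<sigma> e < M"
    and expand: "\<And>A. A \<subseteq> V \<Longrightarrow> card A \<le> s \<Longrightarrow> k * card A \<le> card (\<sigma> ` (A \<times> {..<d::nat}))"
    and g: "\<And>v. v \<in> V \<Longrightarrow> 0 \<le> g v" and small: "card {v\<in>V. g v \<noteq> 0} \<le> s"
  shows "k * (\<Sum>v\<in>V. g v) \<le> (\<Sum>w<M. Max (insert 0 ((\<lambda>e. g (fst e)) ` {e \<in> V \<times> {..<d}. \<sigma> e = w})))"
  using g small
proof (induction "card {v\<in>V. g v \<noteq> 0}" arbitrary: g rule: less_induct)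
  case less
  define mx where "mx h w = Max (insert 0 ((\<lambda>e. h (fst e)) ` {e \<in> V \<times> {..<d}. \<sigma> e = w}))" for h :: "nat \<Rightarrow> real" and w
  have fin: "finite (insert 0 ((\<lambda>e. h (fst e)) ` {e \<in> V \<times> {..<d}. \<sigma> e = w}))" for h :: "nat \<Rightarrow> real" and w
    using fV by simp
  have mx0: "0 \<le> mx h w" for h w unfolding mx_def using fin by (intro Max_ge) auto
  define S where "S = {v\<in>V. g v \<noteq> 0}"
  show ?case
  proof (cases "S = {}")
    case True
    then have "(\<Sum>v\<in>V. g v) = 0" by (intro sum.neutral) (auto simp: S_def)
    moreover have "0 \<le> (\<Sum>w<M. mx g w)" by (intro sum_nonneg mx0)
    ultimately show ?thesis by (simp add: mx_def)
  next
    case False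
    have fS: "finite S" using fV by (simp add: S_def)
    define m where "m = Min (g ` S)"
    have mle: "m \<le> g v" if "v \<in> S" for v unfolding m_def using fS that by simp
    have "m \<in> g ` S" unfolding m_def using fS False by (intro Min_in) auto
    then obtain v0 where v0: "v0 \<in> S" "g v0 = m" by auto
    have mpos: "m > 0" using v0 less.prems(1)[of v0] by (auto simp: S_def less_le)
    define h where "h v = (if v \<in> S then g v - m else g v)" for v
    have hS: "{v\<in>V. h v \<noteq> 0} \<subseteq> S - {v0}" using v0 by (auto simp: h_def S_def)
    then have "card {v\<in>V. h v \<noteq> 0} \<le> card (S - {v0})" using fS by (intro card_mono) auto
    also have "\<dots> < card S" using fS v0 by (intro card_Diff1_less)
    finally have hc: "card {v\<in>V. h v \<noteq> 0} < card {v\<in>V. g v \<noteq> 0}" by (simp add: S_def)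
    have h0: "0 \<le> h v" if "v \<in> V" for v using mle less.prems(1)[OF that] by (auto simp: h_def)
    have IH: "k * (\<Sum>v\<in>V. h v) \<le> (\<Sum>w<M. mx h w)"
      unfolding mx_def using hc h0 less.prems(2) by (intro less.hyps) auto
    let ?N = "\<sigma> ` (S \<times> {..<d})"
    \<comment> \<open>A maximum attained at a positive value of \<open>h\<close> comes from a vertex of \<open>S\<close>, where \<open>g\<close> is larger by \<open>m\<close>.\<close>
    have step: "mx h w + (if w \<in> ?N then m else 0) \<le> mx g w" for w
    proof -
      have "mx h w \<in> insert 0 ((\<lambda>e. h (fst e)) ` {e \<in> V \<times> {..<d}. \<sigma> e = w})"
        unfolding mx_def using fin by (intro Max_in) auto
      then consider "mx h w = 0" | e where "e \<in> V \<times> {..<d}" "\<sigma> e = w" "mx h w = h (fst e)" "h (fst e) \<noteq> 0"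
        by auto metis
      then show ?thesis
      proof cases
        case 1
        show ?thesis
        proof (cases "w \<in> ?N")
          case True
          then obtain e where e: "e \<in> S \<times> {..<d}" "\<sigma> e = w" by auto
          have "g (fst e) \<le> mx g w"
            unfolding mx_def using fin e by (intro Max_ge) (auto simp: S_def)
          moreover have "m \<le> g (fst e)" using e mle by auto
          ultimately show ?thesis using 1 True by simp
        next
          case False
          then show ?thesis using 1 mx0[of g w] by simp
        qed
      next
        case 2
        then have "fst e \<in> S" using hS by (auto simp: mem_Times_iff)
        then have "h (fst e) + m = g (fst e)" by (simp add: h_def)
        moreover have "g (fst e) \<le> mx g w"
          unfolding mx_def using fin 2 by (intro Max_ge) auto
        ultimately show ?thesis using 2 mpos by auto
      qed
    qed
    have Nsub: "?N \<subseteq> {..<M}" using \<sigma> by (auto simp: S_def)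
    have "(\<Sum>v\<in>V. g v) = (\<Sum>v\<in>V. h v + (if v \<in> S then m else 0))"
      by (intro sum.cong) (auto simp: h_def)
    also have "\<dots> = (\<Sum>v\<in>V. h v) + m * card S"
    proof -
      have "V \<inter> S = S" by (auto simp: S_def)
      then show ?thesis using fV by (simp add: sum.distrib sum.If_cases mult.commute)
    qed
    finally have "k * (\<Sum>v\<in>V. g v) = k * (\<Sum>v\<in>V. h v) + m * (k * card S)"
      by (simp add: algebra_simps)
    also have "\<dots> \<le> (\<Sum>w<M. mx h w) + m * card ?N"
    proof -
      have "k * card S \<le> card ?N" using less.prems(2) by (intro expand) (auto simp: S_def)
      then have "real k * real (card S) \<le> card ?N" by (metis of_nat_le_iff of_nat_mult)
      then show ?thesis using IH mpos by (intro add_mono mult_left_mono) auto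
    qed
    also have "\<dots> = (\<Sum>w<M. mx h w + (if w \<in> ?N then m else 0))"
    proof -
      have "(\<Sum>w<M. if w \<in> ?N then m else 0) = (\<Sum>w\<in>{..<M} \<inter> ?N. m)"
        by (rule sum.inter_restrict[symmetric]) simp
      also have "{..<M} \<inter> ?N = ?N" using Nsub by blast
      finally show ?thesis unfolding sum.distrib by (simp add: mult.commute)
    qed
    also have "\<dots> \<le> (\<Sum>w<M. mx g w)" by (intro sum_mono step)
    finally show ?thesis by (simp add: mx_def)
  qed
qed

text \<open>
  At a right vertex the largest term can be cancelled at most by the other ones, so the absolute value
  of the sum is at least twice the maximum minus the sum of the absolute values. Summed over all
  vertices, the maxima contribute at least \<open>2k\<close> and the absolute values \<open>d\<close> times the norm of \<open>f\<close>.
\<close>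

lemma expander_lower_bound:
  fixes f :: "nat \<Rightarrow> real" and k s M :: nat
  assumes fV: "finite V" and \<sigma>: "\<And>e. e \<in> V \<times> {..<d} \<Longrightarrow> \<sigma> e < M"
    and expand: "\<And>A. A \<subseteq> V \<Longrightarrow> card A \<le> s \<Longrightarrow> k * card A \<le> card (\<sigma> ` (A \<times> {..<d::nat}))"
    and small: "card {v\<in>V. f v \<noteq> 0} \<le> s"
  shows "(2 * real k - real d) * (\<Sum>v\<in>V. \<bar>f v\<bar>) \<le> (\<Sum>w<M. \<bar>edge_sum (V \<times> {..<d}) \<sigma> f w\<bar>)"
proof -
  define E where "E = V \<times> {..<d}"
  have fE: "finite E" using fV by (simp add: E_def)
  define mx where "mx w = Max (insert 0 ((\<lambda>e. \<bar>f (fst e)\<bar>) ` {e\<in>E. \<sigma> e = w}))" for w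
  have max: "2 * mx w - (\<Sum>e\<in>{e\<in>E. \<sigma> e = w}. \<bar>f (fst e)\<bar>) \<le> \<bar>edge_sum E \<sigma> f w\<bar>" for w
  proof -
    have "mx w \<in> insert 0 ((\<lambda>e. \<bar>f (fst e)\<bar>) ` {e\<in>E. \<sigma> e = w})"
      unfolding mx_def using fE by (intro Max_in) auto
    then consider "mx w = 0" | e where "e \<in> E" "\<sigma> e = w" "mx w = \<bar>f (fst e)\<bar>" by auto
    then show ?thesis
    proof cases
      case 1
      have "0 \<le> (\<Sum>e\<in>{e\<in>E. \<sigma> e = w}. \<bar>f (fst e)\<bar>)" by (intro sum_nonneg) auto
      then show ?thesis using 1 abs_ge_zero[of "edge_sum E \<sigma> f w"] by linarith
    next
      case 2
      let ?R = "{e\<in>E. \<sigma> e = w} - {e}"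
      have "edge_sum E \<sigma> f w = f (fst e) + (\<Sum>e\<in>?R. f (fst e))"
        unfolding edge_sum_def using fE 2 by (subst sum.remove[of _ e]) auto
      moreover have "(\<Sum>e\<in>{e\<in>E. \<sigma> e = w}. \<bar>f (fst e)\<bar>) = \<bar>f (fst e)\<bar> + (\<Sum>e\<in>?R. \<bar>f (fst e)\<bar>)"
        using fE 2 by (subst sum.remove[of _ e]) auto
      moreover have "\<bar>\<Sum>e\<in>?R. f (fst e)\<bar> \<le> (\<Sum>e\<in>?R. \<bar>f (fst e)\<bar>)" by (rule sum_abs)
      ultimately show ?thesis using 2(3) by linarith
    qed
  qed
  have "(\<Sum>w<M. \<Sum>e\<in>{e\<in>E. \<sigma> e = w}. \<bar>f (fst e)\<bar>) = (\<Sum>e\<in>E. \<bar>f (fst e)\<bar>)"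
    using fE \<sigma> by (intro sum.group) (auto simp: E_def)
  also have "\<dots> = d * (\<Sum>v\<in>V. \<bar>f v\<bar>)"
    unfolding E_def by (simp add: sum.cartesian_product' sum_distrib_left)
  finally have tot: "(\<Sum>w<M. \<Sum>e\<in>{e\<in>E. \<sigma> e = w}. \<bar>f (fst e)\<bar>) = d * (\<Sum>v\<in>V. \<bar>f v\<bar>)" .
  have "k * (\<Sum>v\<in>V. \<bar>f v\<bar>) \<le> (\<Sum>w<M. mx w)"
    unfolding mx_def E_def using small by (intro sum_edge_max_ge[OF fV \<sigma> expand]) auto
  then have "(2 * real k - real d) * (\<Sum>v\<in>V. \<bar>f v\<bar>) \<le> 2 * (\<Sum>w<M. mx w) - (\<Sum>w<M. \<Sum>e\<in>{e\<in>E. \<sigma> e = w}. \<bar>f (fst e)\<bar>)"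
    unfolding tot by (simp add: algebra_simps)
  also have "\<dots> = (\<Sum>w<M. 2 * mx w - (\<Sum>e\<in>{e\<in>E. \<sigma> e = w}. \<bar>f (fst e)\<bar>))"
    by (simp add: sum_subtractf sum_distrib_left)
  also have "\<dots> \<le> (\<Sum>w<M. \<bar>edge_sum E \<sigma> f w\<bar>)" by (intro sum_mono max)
  finally show ?thesis by (simp add: E_def)
qed

text \<open>
  A form of Siegel's lemma. There are at least \<open>41\<^sup>4\<^sup>n\<close> functions with values in \<open>{0..40}\<close> that vanish
  on \<open>P\<close>, and at most \<open>1601\<^sup>2\<^sup>n < (41\<^sup>2)\<^sup>2\<^sup>n\<close> possible images, since every sum has at most 40 terms.
  Two functions with the same image have the required difference.
\<close>

lemma integer_kernel_vector:
  fixes n :: nat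
  assumes n: "n > 0" and \<sigma>: "\<And>e. e \<in> {..<5*n} \<times> {..<8} \<Longrightarrow> \<sigma> e < 2 * n"
    and deg: "\<And>w. card {e \<in> {..<5*n} \<times> {..<8}. \<sigma> e = w} \<le> 40"
    and P: "P \<subseteq> {..<5*n}" "card P \<le> n"
  obtains z :: "nat \<Rightarrow> int" where "\<exists>v<5*n. z v \<noteq> 0" "\<And>v. v \<in> P \<Longrightarrow> z v = 0" "\<And>v. \<bar>z v\<bar> \<le> 40"
    "\<And>w. edge_sum ({..<5*n} \<times> {..<8}) \<sigma> z w = 0"
proof -
  define E where "E = {..<5*n} \<times> {..<8::nat}"
  define Q where "Q = {..<5*n} - P"
  \<comment> \<open>Functions on \<open>Q\<close> are extended by zero, which makes them vanish on \<open>P\<close>.\<close>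
  define F where "F = Q \<rightarrow>\<^sub>E {0..40::int}"
  define ext where "ext f v = (if v \<in> Q then f v else 0)" for f :: "nat \<Rightarrow> int" and v
  define \<Theta> where "\<Theta> f = (\<lambda>w\<in>{..<2*n}. edge_sum E \<sigma> (ext f) w)" for f
  have fE: "finite E" by (simp add: E_def)
  have ext_range: "0 \<le> ext f v \<and> ext f v \<le> 40" if "f \<in> F" for f v
    using that PiE_mem[of f Q "\<lambda>_. {0..40}" v] by (auto simp: F_def ext_def)
  have "\<Theta> ` F \<subseteq> {..<2*n} \<rightarrow>\<^sub>E {0..1600::int}"
  proof (intro image_subsetI)
    fix f assume f: "f \<in> F"
    have "edge_sum E \<sigma> (ext f) w \<in> {0..1600}" for w
    proof -
      have "edge_sum E \<sigma> (ext f) w \<le> (\<Sum>e\<in>{e\<in>E. \<sigma> e = w}. 40)"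
        unfolding edge_sum_def using ext_range[OF f] by (intro sum_mono) auto
      also have "\<dots> \<le> 40 * 40" using deg[of w] by (simp add: E_def)
      finally show ?thesis
        unfolding edge_sum_def using ext_range[OF f] by (auto intro: sum_nonneg)
    qed
    then show "\<Theta> f \<in> {..<2*n} \<rightarrow>\<^sub>E {0..1600}" by (auto simp: \<Theta>_def)
  qed
  then have "card (\<Theta> ` F) \<le> card ({..<2*n} \<rightarrow>\<^sub>E {0..1600::int})"
    by (intro card_mono finite_PiE) auto
  also have "\<dots> = 1601 ^ (2 * n)" by (simp add: card_PiE)
  also have "\<dots> < (1681::nat) ^ (2 * n)" using n by (intro power_strict_mono) auto
  also have "(1681::nat) ^ (2 * n) = 41 ^ (4 * n)"
  proof -
    have "(41 ^ 2 :: nat) ^ (2 * n) = 41 ^ (4 * n)" by (subst power_mult[symmetric]) simp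
    then show ?thesis by simp
  qed
  also have "\<dots> \<le> 41 ^ card Q"
    using P card_Diff_subset[OF finite_subset[OF P(1)] P(1)] by (intro power_increasing) (auto simp: Q_def)
  also have "\<dots> = card F" unfolding F_def by (simp add: card_PiE Q_def)
  finally have "\<not> inj_on \<Theta> F" by (rule pigeonhole)
  then obtain f g where fg: "f \<in> F" "g \<in> F" "f \<noteq> g" "\<Theta> f = \<Theta> g" by (auto simp: inj_on_def)
  show thesis
  proof (rule that[of "\<lambda>v. ext f v - ext g v"])
    obtain v where v: "v \<in> Q" "f v \<noteq> g v"
      using fg(1-3) unfolding F_def by (metis PiE_ext)
    then show "\<exists>v<5*n. ext f v - ext g v \<noteq> 0" by (intro exI[of _ v]) (auto simp: ext_def Q_def)
    show "ext f v - ext g v = 0" if "v \<in> P" for v using that by (simp add: ext_def Q_def)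
    show "\<bar>ext f v - ext g v\<bar> \<le> 40" for v
      using ext_range[OF fg(1), of v] ext_range[OF fg(2), of v] by linarith
    fix w
    have eq: "edge_sum E \<sigma> (ext f) w = edge_sum E \<sigma> (ext g) w"
    proof (cases "w < 2 * n")
      case True
      then show ?thesis using fun_cong[OF fg(4), of w] by (simp add: \<Theta>_def)
    next
      case False
      then have "{e\<in>E. \<sigma> e = w} = {}" using \<sigma> by (auto simp: E_def)
      then show ?thesis by (simp only: edge_sum_def sum.empty)
    qed
    show "edge_sum ({..<5*n} \<times> {..<8}) \<sigma> (\<lambda>v. ext f v - ext g v) w = 0"
      using eq unfolding E_def edge_sum_def by (simp add: sum_subtractf)
  qed
qed

lemma sum_edge_sum_le:
  fixes f :: "nat \<Rightarrow> real"
  assumes fV: "finite V" and \<sigma>: "\<And>e. e \<in> V \<times> {..<d::nat} \<Longrightarrow> \<sigma> e < (M::nat)"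
  shows "(\<Sum>w<M. \<bar>edge_sum (V \<times> {..<d}) \<sigma> f w\<bar>) \<le> d * (\<Sum>v\<in>V. \<bar>f v\<bar>)"
proof -
  have "(\<Sum>w<M. \<bar>edge_sum (V \<times> {..<d}) \<sigma> f w\<bar>) \<le> (\<Sum>w<M. \<Sum>e\<in>{e\<in>V \<times> {..<d}. \<sigma> e = w}. \<bar>f (fst e)\<bar>)"
    unfolding edge_sum_def by (intro sum_mono sum_abs)
  also have "\<dots> = (\<Sum>e\<in>V \<times> {..<d}. \<bar>f (fst e)\<bar>)"
    using fV \<sigma> by (intro sum.group) auto
  also have "\<dots> = d * (\<Sum>v\<in>V. \<bar>f v\<bar>)"
    by (simp add: sum.cartesian_product' sum_distrib_left)
  finally show ?thesis .
qed

text \<open>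
  The vectors \<open>z k\<close> lie in the kernel and are in triangular form with respect to the pivot sets \<open>P k\<close>,
  whose densities have a positive lower limit for each \<open>k\<close> as \<open>n\<close> grows.
\<close>

locale finite_model =
  fixes n :: nat and \<sigma> :: "nat \<times> nat \<Rightarrow> nat" and z :: "nat \<Rightarrow> nat \<Rightarrow> int" and P :: "nat \<Rightarrow> nat set"
  assumes n_pos: "n > 0"
    and \<sigma>_less: "e \<in> {..<5 * n} \<times> {..<8} \<Longrightarrow> \<sigma> e < 2 * n"
    and degree: "card {e \<in> {..<5 * n} \<times> {..<8}. \<sigma> e = w} \<le> 40"
    and lower: "card {v\<in>{..<5 * n}. f v \<noteq> 0} \<le> n div 2000000 \<Longrightarrow>
      4 * (\<Sum>v<5 * n. \<bar>f v :: real\<bar>) \<le> (\<Sum>w<2 * n. \<bar>edge_sum ({..<5 * n} \<times> {..<8}) \<sigma> f w\<bar>)"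
    and z_bound: "\<bar>z k v\<bar> \<le> 40"
    and z_kernel: "edge_sum ({..<5 * n} \<times> {..<8}) \<sigma> (z k) w = 0"
    and P_sub: "P k \<subseteq> {..<5 * n}" and P_card: "card (P k) = n div 2000000 div 2 ^ Suc k"
    and P_nz: "v \<in> P k \<Longrightarrow> z k v \<noteq> 0" and P_z: "k < l \<Longrightarrow> v \<in> P k \<Longrightarrow> z l v = 0"

text \<open>
  The vectors are chosen one after the other, each of them vanishing on the union \<open>U\<close> of the earlier
  pivot sets. A nonzero kernel vector violates the lower bound for small supports, so its support has more than
  \<open>s\<close> points and contains a pivot set of the prescribed size. Halving the sizes keeps \<open>U\<close> below \<open>s\<close>.
\<close>

lemma finite_model_exists:
  assumes n: "n > 0"
  shows "\<exists>\<sigma> z P. finite_model n \<sigma> z P"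
proof -
  define V where "V = {..<5*n}"
  define s where "s = n div 2000000"
  define E where "E = V \<times> {..<8::nat}"
  obtain \<sigma> :: "nat \<times> nat \<Rightarrow> nat" where \<sigma>: "\<And>e. e \<in> E \<Longrightarrow> \<sigma> e < 2 * n"
    and deg: "\<And>w. card {e\<in>E. \<sigma> e = w} \<le> 40"
    and expand: "\<And>A. A \<subseteq> V \<Longrightarrow> 2000000 * card A \<le> n \<Longrightarrow> 6 * card A \<le> card (\<sigma> ` (A \<times> {..<8}))"
    unfolding E_def V_def by (rule bounded_degree_expander_exists[OF n]) blast
  have fV: "finite V" by (simp add: V_def)
  have expand': "6 * card A \<le> card (\<sigma> ` (A \<times> {..<8}))" if "A \<subseteq> V" "card A \<le> s" for A
    using that by (intro expand) (auto simp: s_def less_eq_div_iff_mult_less_eq mult.commute)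
  have lower: "4 * (\<Sum>v\<in>V. \<bar>f v\<bar>) \<le> (\<Sum>w<2*n. \<bar>edge_sum E \<sigma> f w\<bar>)"
    if "card {v\<in>V. f v \<noteq> 0} \<le> s" for f :: "nat \<Rightarrow> real"
    using expander_lower_bound[OF fV \<sigma>[unfolded E_def] expand' that] by (simp add: E_def)
  have next_vector: "\<exists>(z :: nat \<Rightarrow> int) P. (\<forall>v. \<bar>z v\<bar> \<le> 40) \<and> (\<forall>w. edge_sum E \<sigma> z w = 0) \<and> P \<subseteq> V \<and> card P = s div 2 ^ Suc k
      \<and> (\<forall>v\<in>P. z v \<noteq> 0) \<and> (\<forall>v\<in>U. z v = 0)" if U: "U \<subseteq> V" "card U \<le> s" for U k
  proof -
    have "card U \<le> n" using U(2) by (simp add: s_def) 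
    then obtain z :: "nat \<Rightarrow> int" where z: "\<exists>v<5*n. z v \<noteq> 0" "\<And>v. v \<in> U \<Longrightarrow> z v = 0" "\<And>v. \<bar>z v\<bar> \<le> 40"
        "\<And>w. edge_sum E \<sigma> z w = 0"
      using integer_kernel_vector[of n \<sigma> U, OF n \<sigma>[unfolded E_def V_def] deg[unfolded E_def V_def] U(1)[unfolded V_def]]
      unfolding E_def V_def by blast
    define f where "f v = real_of_int (z v)" for v
    have ef: "edge_sum E \<sigma> f w = 0" for w
    proof -
      have "edge_sum E \<sigma> f w = of_int (edge_sum E \<sigma> z w)" by (simp add: edge_sum_def f_def)
      then show ?thesis using z(4) by simp
    qed
    have "s < card {v\<in>V. f v \<noteq> 0}"
    proof (rule ccontr)
      assume "\<not> ?thesis"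
      then have "4 * (\<Sum>v\<in>V. \<bar>f v\<bar>) \<le> (\<Sum>w<2*n. \<bar>edge_sum E \<sigma> f w\<bar>)" by (intro lower) simp
      then have "(\<Sum>v\<in>V. \<bar>f v\<bar>) \<le> 0" by (simp add: ef)
      then have "(\<Sum>v\<in>V. \<bar>f v\<bar>) = 0" by (intro antisym sum_nonneg) auto
      then have "\<forall>v\<in>V. \<bar>f v\<bar> = 0" by (subst (asm) sum_nonneg_eq_0_iff[OF fV]) auto
      then show False using z(1) by (auto simp: f_def V_def)
    qed
    then have "s div 2 ^ Suc k \<le> card {v\<in>V. f v \<noteq> 0}"
      using div_le_dividend[of s "2 ^ Suc k"] by linarith
    then obtain P where "P \<subseteq> {v\<in>V. f v \<noteq> 0}" "card P = s div 2 ^ Suc k"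
      by (rule obtain_subset_with_card_n)
    then show ?thesis using z by (intro exI[of _ z] exI[of _ P]) (auto simp: f_def)
  qed
  \<comment> \<open>The state \<open>(z, P, U)\<close> of the recursion consists of the current vector, its pivot set and the union of the earlier pivot sets.\<close>
  define good where "good k x \<longleftrightarrow> (case x of (z, P, U) \<Rightarrow> (\<forall>v. \<bar>z v\<bar> \<le> 40) \<and> (\<forall>w. edge_sum E \<sigma> z w = 0) \<and> P \<subseteq> V
      \<and> card P = s div 2 ^ Suc k \<and> (\<forall>v\<in>P. z v \<noteq> 0) \<and> (\<forall>v\<in>U. z v = 0) \<and> U \<subseteq> V \<and> card U + s div 2 ^ k \<le> s)"
    for k :: nat and x :: "(nat \<Rightarrow> int) \<times> nat set \<times> nat set"
  define after where "after x y \<longleftrightarrow> snd (snd y) = snd (snd x) \<union> fst (snd x)"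
    for x y :: "(nat \<Rightarrow> int) \<times> nat set \<times> nat set"
  have "\<exists>X. \<forall>k. good k (X k) \<and> after (X k) (X (Suc k))"
  proof (rule dependent_nat_choice)
    obtain z :: "nat \<Rightarrow> int" and P where "(\<forall>v. \<bar>z v\<bar> \<le> 40) \<and> (\<forall>w. edge_sum E \<sigma> z w = 0) \<and> P \<subseteq> V \<and> card P = s div 2 ^ Suc 0
      \<and> (\<forall>v\<in>P. z v \<noteq> 0) \<and> (\<forall>v\<in>{}. z v = 0)"
      using next_vector[of "{}" 0] by auto
    then show "\<exists>x. good 0 x" by (intro exI[of _ "(z, P, {})"]) (simp add: good_def)
  next
    fix x k assume "good k x"
    then obtain z P U where x: "x = (z, P, U)" and gx: "good k (z, P, U)" by (cases x) auto
    have U': "U \<union> P \<subseteq> V" "card (U \<union> P) + s div 2 ^ Suc k \<le> s"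
    proof -
      show "U \<union> P \<subseteq> V" using gx by (simp add: good_def)
      have "2 * (s div 2 ^ Suc k) \<le> s div 2 ^ k"
        unfolding power_Suc2 div_mult2_eq by simp
      moreover have "card (U \<union> P) \<le> card U + s div 2 ^ Suc k"
        using card_Un_le[of U P] gx by (simp add: good_def)
      ultimately show "card (U \<union> P) + s div 2 ^ Suc k \<le> s" using gx by (simp add: good_def)
    qed
    then have "card (U \<union> P) \<le> s" by linarith
    then obtain z' :: "nat \<Rightarrow> int" and P' where "(\<forall>v. \<bar>z' v\<bar> \<le> 40) \<and> (\<forall>w. edge_sum E \<sigma> z' w = 0) \<and> P' \<subseteq> V \<and> card P' = s div 2 ^ Suc (Suc k)
      \<and> (\<forall>v\<in>P'. z' v \<noteq> 0) \<and> (\<forall>v\<in>U \<union> P. z' v = 0)"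
      using next_vector[OF U'(1), of "Suc k"] by blast
    then show "\<exists>y. good (Suc k) y \<and> after x y"
      using U' by (intro exI[of _ "(z', P', U \<union> P)"]) (simp add: good_def after_def x)
  qed
  then obtain X where X: "\<And>k. good k (X k)" "\<And>k. after (X k) (X (Suc k))" by blast
  define z P U where "z k = fst (X k)" and "P k = fst (snd (X k))" and "U k = snd (snd (X k))" for k
  have g: "good k (z k, P k, U k)" and US: "U (Suc k) = U k \<union> P k" for k
    using X[of k] by (simp_all add: z_def P_def U_def after_def)
  have PU: "P k \<subseteq> U l" if "k < l" for k l
    using that by (induction l) (auto simp: US less_Suc_eq)
  have zP: "P k \<subseteq> V" "card (P k) = s div 2 ^ Suc k" "\<bar>z k v\<bar> \<le> 40" "edge_sum E \<sigma> (z k) w = 0"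
      "v \<in> P k \<Longrightarrow> z k v \<noteq> 0" "v \<in> U k \<Longrightarrow> z k v = 0" for k v w
    using g[of k] by (auto simp: good_def)
  have "finite_model n \<sigma> z P"
  proof (rule finite_model.intro)
    show "z l v = 0" if "k < l" "v \<in> P k" for k l v using zP(6) PU[OF that(1)] that(2) by blast
  qed (use n \<sigma> deg lower zP in \<open>unfold V_def E_def s_def, blast+\<close>)
  then show ?thesis by blast
qed

section \<open>Limits of finite probability spaces with labels\<close>

text \<open>
  The weak limit of the distributions of label sequences, realised on the unit interval. The
  frequencies of all finite words converge along a subsequence. The limits \<open>p u\<close> are the lengths of
  intervals \<open>I u\<close>, nested in the same way as the words extend each other; the labels of \<open>x\<close> are read
  off from the intervals that contain \<open>x\<close>. That the cells are intervals is used to show that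
  functions of finitely many labels are dense.
\<close>

lemma limit_of_digit_sequences:
  fixes N :: "nat \<Rightarrow> nat" and a :: "nat \<Rightarrow> nat \<Rightarrow> nat \<Rightarrow> nat" and Q :: nat
  assumes N: "\<And>i. N i > 0" and a: "\<And>i v k. a i v k < Q"
  obtains r :: "nat \<Rightarrow> nat" and \<alpha> :: "real \<Rightarrow> nat \<Rightarrow> nat" where
    "strict_mono r"
    "\<And>m (H :: nat list \<Rightarrow> real). integrable lebesgue_01 (\<lambda>x. H (map (\<alpha> x) [0..<m]))"
    "\<And>m (H :: nat list \<Rightarrow> real). (\<lambda>i. (\<Sum>v<N (r i). H (map (a (r i) v) [0..<m])) / N (r i))
        \<longlonglongrightarrow> (\<integral>x. H (map (\<alpha> x) [0..<m]) \<partial>lebesgue_01)"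
    "\<And>m u. is_interval {x \<in> {0<..<1}. map (\<alpha> x) [0..<m] = u}"
proof -
  define wd where "wd i v m = map (a i v) [0..<m]" for i v m
  define words where "words m = {u. set u \<subseteq> {..<Q} \<and> length u = m}" for m :: nat
  have fwords: "finite (words m)" for m
    unfolding words_def by (rule finite_lists_length_eq) simp
  have wd_words: "wd i v m \<in> words m" for i v m using a by (auto simp: wd_def words_def)
  have wd_Suc: "wd i v (Suc m) = wd i v m @ [a i v m]" for i v m by (simp add: wd_def)
  define p' where "p' i u = card {v. v < N i \<and> wd i v (length u) = u} / N i" for i u
  have p'_le: "norm (p' i u) \<le> 1" for i u
  proof -
    have "card {v. v < N i \<and> wd i v (length u) = u} \<le> card {..<N i}" by (intro card_mono) auto
    then show ?thesis using N[of i] by (simp add: p'_def)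
  qed
  have "\<exists>r. strict_mono r \<and> (\<forall>u. \<exists>l. (\<lambda>i. p' (r i) u) \<longlonglongrightarrow> l)"
    by (rule function_convergent_subsequence[of "UNIV :: nat list set" p' 1]) (use p'_le in \<open>blast+\<close>)
  then obtain r where r: "strict_mono r" "\<And>u. \<exists>l. (\<lambda>i. p' (r i) u) \<longlonglongrightarrow> l"
    by blast
  then obtain p where p: "\<And>u. (\<lambda>i. p' (r i) u) \<longlonglongrightarrow> p u" by metis
  have p_nonneg: "0 \<le> p u" for u by (rule LIMSEQ_le_const[OF p]) (auto simp: p'_def)
  have p_Nil: "p [] = 1"
  proof (rule LIMSEQ_unique[OF p])
    have "p' i [] = 1" for i using N[of i] by (simp add: p'_def wd_def)
    then show "(\<lambda>i. p' (r i) []) \<longlonglongrightarrow> 1" by simp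
  qed
  have p_split: "(\<Sum>j<Q. p (u @ [j])) = p u" for u
  proof (rule LIMSEQ_unique[OF tendsto_sum[OF p]])
    have "(\<Sum>j<Q. p' i (u @ [j])) = p' i u" for i
    proof -
      define S where "S j = {v. v < N i \<and> wd i v (length (u @ [j])) = u @ [j]}" for j
      have S: "v \<in> S j \<longleftrightarrow> v < N i \<and> wd i v (length u) = u \<and> a i v (length u) = j" for v j
        by (simp add: S_def wd_Suc)
      have "{v. v < N i \<and> wd i v (length u) = u} = (\<Union>j<Q. S j)"
        using a by (auto simp: S)
      moreover have "card (\<Union>j<Q. S j) = (\<Sum>j<Q. card (S j))"
        by (rule card_UN_disjoint) (auto simp: S intro: finite_subset[of _ "{..<N i}"])
      ultimately have "card {v. v < N i \<and> wd i v (length u) = u}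
          = (\<Sum>j<Q. card {v. v < N i \<and> wd i v (length (u @ [j])) = u @ [j]})"
        unfolding S_def by (simp only:)
      then show ?thesis by (simp add: p'_def sum_divide_distrib[symmetric])
    qed
    then show "(\<lambda>i. \<Sum>j<Q. p' (r i) (u @ [j])) \<longlonglongrightarrow> p u" using p by simp
  qed
  have p_out: "p (u @ [j]) = 0" if "j \<ge> Q" for u j
  proof (rule LIMSEQ_unique[OF p])
    have "{v. v < N i \<and> wd i v (length (u @ [j])) = u @ [j]} = {}" for i
      using a that by (auto simp: wd_Suc not_less[symmetric])
    then have "p' i (u @ [j]) = 0" for i by (simp only: p'_def card.empty)
    then show "(\<lambda>i. p' (r i) (u @ [j])) \<longlonglongrightarrow> 0" by simp
  qed
  \<comment> \<open>The left end point of the interval of \<open>u\<close>: the total length of all words that branch off to the left of \<open>u\<close>.\<close>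
  define l where "l u = (\<Sum>k<length u. \<Sum>j<u ! k. p (take k u @ [j]))" for u
  have l_snoc: "l (u @ [i]) = l u + (\<Sum>j<i. p (u @ [j]))" for u i
    by (simp add: l_def nth_append)
  define I where "I u = {l u..<l u + p u}" for u
  have I_Nil: "I [] = {0..<1}" by (simp add: I_def l_def p_Nil)
  define s where "s u i = l u + (\<Sum>j<i. p (u @ [j]))" for u i
  have s_mono: "s u i \<le> s u i'" if "i \<le> i'" for u i i'
    unfolding s_def using that p_nonneg by (intro add_left_mono sum_mono2) auto
  have I_snoc: "I (u @ [i]) = {s u i..<s u (Suc i)}" for u i
    by (simp add: I_def l_snoc s_def add.assoc)
  have I_s: "I u = {s u 0..<s u Q}" for u by (simp add: I_def s_def p_split)
  have I_sub: "I (u @ [i]) \<subseteq> I u" for u i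
  proof (cases "i < Q")
    case True
    then show ?thesis
      using s_mono[of 0 i u] s_mono[of "Suc i" Q u] unfolding I_snoc I_s[of u] by auto
  next
    case False
    then show ?thesis by (auto simp: I_def p_out)
  qed
  have I_ex: "\<exists>i<Q. x \<in> I (u @ [i])" if x: "x \<in> I u" for x u
  proof -
    define i where "i = (LEAST i. x < s u (Suc i))"
    have Q: "Q > 0" using a[of 0 0 0] by simp
    have xQ: "x < s u (Suc (Q - 1))" using x Q by (simp add: I_s)
    then have 1: "x < s u (Suc i)" unfolding i_def by (rule LeastI)
    have "i \<le> Q - 1" unfolding i_def using xQ by (rule Least_le)
    moreover have "s u i \<le> x"
    proof (cases i)
      case 0 then show ?thesis using x by (simp add: I_s)
    next
      case (Suc i')
      then have "\<not> x < s u (Suc i')" using not_less_Least[of i' "\<lambda>i. x < s u (Suc i)"] by (simp add: i_def)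
      then show ?thesis using Suc by simp
    qed
    ultimately show ?thesis using 1 Q by (intro exI[of _ i]) (auto simp: I_snoc)
  qed
  have I_uniq: "i = i'" if "x \<in> I (u @ [i])" "x \<in> I (u @ [i'])" for x u i i'
  proof (rule ccontr)
    assume "i \<noteq> i'"
    then consider "Suc i \<le> i'" | "Suc i' \<le> i" by linarith
    then show False using that s_mono[of "Suc i" i' u] s_mono[of "Suc i'" i u] by cases (auto simp: I_snoc)
  qed
  define W where "W x = rec_nat [] (\<lambda>m u. u @ [SOME i. i < Q \<and> x \<in> I (u @ [i])])" for x
  have W_0: "W x 0 = []" and W_Suc: "W x (Suc m) = W x m @ [SOME i. i < Q \<and> x \<in> I (W x m @ [i])]" for x m
    by (simp_all add: W_def)
  have W_I: "x \<in> I (W x m) \<and> W x m \<in> words m" if x: "x \<in> {0<..<1}" for x m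
  proof (induction m)
    case 0
    then show ?case using x by (simp add: W_0 I_Nil words_def)
  next
    case (Suc m)
    then have "\<exists>i. i < Q \<and> x \<in> I (W x m @ [i])" using I_ex by blast
    from someI_ex[OF this] Suc show ?case by (auto simp: W_Suc words_def)
  qed
  have W_unique: "W x (length u) = u" if x: "x \<in> {0<..<1}" and u: "x \<in> I u" for x u
    using u
  proof (induction u rule: rev_induct)
    case Nil then show ?case by (simp add: W_0)
  next
    case (snoc i u)
    then have IH: "W x (length u) = u" using I_sub by blast
    have "x \<in> I (W x (Suc (length u)))" using W_I[OF x] by blast
    then show ?case using I_uniq snoc.prems unfolding W_Suc IH by (auto simp: W_Suc IH)
  qed
  have len: "length (W x m) = m" for x m by (induction m) (simp_all add: W_0 W_Suc)
  define \<alpha> where "\<alpha> x k = W x (Suc k) ! k" for x k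
  have \<alpha>W: "map (\<alpha> x) [0..<m] = W x m" for x m
    by (induction m) (simp_all add: W_0 W_Suc \<alpha>_def nth_append len)
  have cell: "{x \<in> {0<..<1}. W x m = u} = (if length u = m then I u \<inter> {0<..<1} else {})" for m u
  proof (cases "length u = m")
    case True
    have "W x m = u \<longleftrightarrow> x \<in> I u" if "x \<in> {0<..<1}" for x
      using W_I[OF that, of m] W_unique[OF that, of u] True by auto
    then show ?thesis using True by auto
  next
    case False
    then show ?thesis using len by auto
  qed
  have l_bounds: "0 \<le> l u \<and> l u + p u \<le> 1" if "I u \<noteq> {}" for u
  proof -
    have sub: "I u \<subseteq> {0..<1}"
    proof (induction u rule: rev_induct)
      case Nil then show ?case by (simp add: I_Nil)
    next
      case (snoc i u) then show ?case using I_sub by blast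
    qed
    have "l u < l u + p u" using that by (auto simp: I_def)
    then show ?thesis using sub unfolding I_def by (simp add: atLeastLessThan_subset_iff)
  qed
  have top: "{0<..<1} \<in> sets lebesgue_01" using sets.top[of lebesgue_01] by simp
  have cell_sets: "{x \<in> {0<..<1}. W x m = u} \<in> sets lebesgue_01" for m u
    unfolding cell by (auto simp: sets_restrict_space I_def)
  have cell_measure: "\<mu> {x \<in> {0<..<1}. W x m = u} = p u" if u: "length u = m" for m u
  proof (cases "I u = {}")
    case True
    then have "p u = 0" using p_nonneg[of u] by (auto simp: I_def)
    moreover have "{x \<in> {0<..<1}. W x m = u} = {}" unfolding cell using True by simp
    ultimately show ?thesis by (simp only: measure_empty)
  next
    case False
    note lb = l_bounds[OF False]
    have "\<mu> (I u \<inter> {0<..<1}) = measure lebesgue (I u \<inter> {0<..<1})"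
      by (intro measure_restrict_space) auto
    also have "\<dots> = measure lebesgue ({l u..<l u + p u} - {0})"
      using lb by (intro arg_cong[where f = "measure lebesgue"]) (auto simp: I_def)
    also have "\<dots> = measure lebesgue {l u..<l u + p u}"
      by (intro measure_Diff_null_set) (auto simp: null_sets_def)
    also have "\<dots> = p u" using p_nonneg[of u] by simp
    finally show ?thesis unfolding cell using u by simp
  qed
  have exp: "integrable lebesgue_01 (\<lambda>x. H (W x m))"
      "(\<integral>x. H (W x m) \<partial>lebesgue_01) = (\<Sum>u\<in>words m. H u * p u)" for m and H :: "nat list \<Rightarrow> real"
  proof -
    have eq: "H (W x m) = (\<Sum>u\<in>words m. H u * indicator {x \<in> {0<..<1}. W x m = u} x)" if "x \<in> space lebesgue_01" for x
    proof -
      have x: "x \<in> {0<..<1}" using that by simp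
      have "(\<Sum>u\<in>words m. H u * indicator {x \<in> {0<..<1}. W x m = u} x) = (\<Sum>u\<in>words m. if u = W x m then H u else 0)"
        using x by (intro sum.cong) (auto simp: indicator_def)
      then show ?thesis using fwords W_I[OF x] by simp
    qed
    have int: "integrable lebesgue_01 (\<lambda>x. indicator {x \<in> {0<..<1}. W x m = u} x :: real)" for u
      using cell_sets by (intro integrable_real_indicator) (auto simp: L01.emeasure_eq_measure)
    have mi: "(\<integral>x. indicator {x \<in> {0<..<1}. W x m = u} x \<partial>lebesgue_01) = \<mu> {x \<in> {0<..<1}. W x m = u}" for u
      using cell_sets[of m u] sets.sets_into_space[OF cell_sets[of m u]] by (simp add: Int_absorb2)
    have "integrable lebesgue_01 (\<lambda>x. \<Sum>u\<in>words m. H u * indicator {x \<in> {0<..<1}. W x m = u} x)"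
      using int by (intro Bochner_Integration.integrable_sum integrable_mult_right)
    then show "integrable lebesgue_01 (\<lambda>x. H (W x m))"
      by (subst Bochner_Integration.integrable_cong[OF refl eq])
    have "(\<integral>x. H (W x m) \<partial>lebesgue_01) = (\<integral>x. (\<Sum>u\<in>words m. H u * indicator {x \<in> {0<..<1}. W x m = u} x) \<partial>lebesgue_01)"
      by (rule Bochner_Integration.integral_cong[OF refl eq])
    also have "\<dots> = (\<Sum>u\<in>words m. H u * \<mu> {x \<in> {0<..<1}. W x m = u})"
      using int mi by (subst Bochner_Integration.integral_sum) simp_all
    also have "\<dots> = (\<Sum>u\<in>words m. H u * p u)"
      using cell_measure by (intro sum.cong) (auto simp: words_def)
    finally show "(\<integral>x. H (W x m) \<partial>lebesgue_01) = (\<Sum>u\<in>words m. H u * p u)" .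
  qed
  have avg: "(\<Sum>v<N i. H (wd i v m)) / N i = (\<Sum>u\<in>words m. H u * p' i u)" for i m and H :: "nat list \<Rightarrow> real"
  proof -
    have "(\<Sum>v<N i. H (wd i v m)) = (\<Sum>u\<in>words m. \<Sum>v\<in>{v\<in>{..<N i}. wd i v m = u}. H (wd i v m))"
      using wd_words by (intro sum.group[symmetric] fwords) auto
    also have "\<dots> = (\<Sum>u\<in>words m. \<Sum>v\<in>{v\<in>{..<N i}. wd i v m = u}. H u)"
      by (intro sum.cong) auto
    also have "\<dots> = (\<Sum>u\<in>words m. H u * p' i u * N i)"
      using N[of i] by (intro sum.cong) (auto simp: p'_def words_def)
    finally show ?thesis using N[of i] by (simp add: sum_distrib_right[symmetric])
  qed
  show thesis
  proof (rule that[of r \<alpha>])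
    show "strict_mono r" by (rule r(1))
    show "integrable lebesgue_01 (\<lambda>x. H (map (\<alpha> x) [0..<m]))" for m and H :: "nat list \<Rightarrow> real"
      unfolding \<alpha>W by (rule exp(1))
    show "(\<lambda>i. (\<Sum>v<N (r i). H (map (a (r i) v) [0..<m])) / N (r i))
        \<longlonglongrightarrow> (\<integral>x. H (map (\<alpha> x) [0..<m]) \<partial>lebesgue_01)" for m and H :: "nat list \<Rightarrow> real"
      unfolding \<alpha>W exp(2) wd_def[symmetric] avg by (intro tendsto_intros p)
    show "is_interval {x \<in> {0<..<1}. map (\<alpha> x) [0..<m] = u}" for m u
      unfolding \<alpha>W cell by (auto simp: I_def is_interval_1)
  qed
qed

section \<open>The limit operator\<close>

definition word :: "(nat \<Rightarrow> nat) \<Rightarrow> nat \<Rightarrow> nat list" where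
  "word a m = map a [0..<m]"

lemma length_word [simp]: "length (word a m) = m" by (simp add: word_def)

lemma nth_word [simp]: "k < m \<Longrightarrow> word a m ! k = a k" by (simp add: word_def)

lemma take_word: "l \<le> m \<Longrightarrow> take l (word a m) = word a l"
  by (simp add: word_def take_map)

lemma real_div_bounds:
  fixes n c :: nat
  assumes "c > 0"
  shows "real n / real c - 1 \<le> real (n div c)" "real (n div c) \<le> real n / real c"
proof -
  have "real n = real (n div c) * real c + real (n mod c)"
    by (metis div_mult_mod_eq of_nat_add of_nat_mult)
  moreover have "real (n mod c) < real c" using assms by simp
  ultimately show "real n / real c - 1 \<le> real (n div c)" "real (n div c) \<le> real n / real c"
    using assms by (simp_all add: field_simps)
qed

lemma mod_power2_eqI:
  fixes v w :: nat
  assumes "\<And>j. j < k \<Longrightarrow> (v div 2 ^ j) mod 2 = (w div 2 ^ j) mod 2"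
  shows "v mod 2 ^ k = w mod 2 ^ k"
  using assms
proof (induction k)
  case (Suc k)
  have "u mod 2 ^ Suc k = 2 ^ k * ((u div 2 ^ k) mod 2) + u mod 2 ^ k" for u :: nat
    unfolding power_Suc2 by (rule mod_mult2_eq)
  then show ?case using Suc by simp
qed simp

text \<open>
  The left labels \<open>a\<close> alternate between the values of the kernel vectors, shifted to be nonnegative, and
  binary digits of the vertex, which make the cells small. The right label number \<open>k\<close> counts the edges
  from the cell of the word with code \<open>k\<close>; thus the adjacency operator turns a function of left labels
  into a function of right labels by a formula that does not depend on \<open>i\<close>. The functions \<open>\<alpha>\<close>
  and \<open>\<beta>\<close> are the limits of both kinds of labels.
\<close>

locale expander_limit =
  fixes n :: "nat \<Rightarrow> nat" and \<sigma> :: "nat \<Rightarrow> nat \<times> nat \<Rightarrow> nat" and z :: "nat \<Rightarrow> nat \<Rightarrow> nat \<Rightarrow> int"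
    and P :: "nat \<Rightarrow> nat \<Rightarrow> nat set" and a :: "nat \<Rightarrow> nat \<Rightarrow> nat \<Rightarrow> nat"
    and b :: "nat \<Rightarrow> nat \<Rightarrow> nat \<Rightarrow> nat" and \<alpha> \<beta> :: "real \<Rightarrow> nat \<Rightarrow> nat"
  assumes model: "\<And>i. finite_model (n i) (\<sigma> i) (z i) (P i)" and n_lim: "filterlim n at_top sequentially"
    and a_def: "\<And>i v k. a i v k = (if even k then nat (z i (k div 2) v + 40) else (v div 2 ^ (k div 2)) mod 2)"
    and b_def: "\<And>i w k. b i w k = edge_sum ({..<5 * n i} \<times> {..<8}) (\<sigma> i)
      (\<lambda>v. if word (a i v) (length (from_nat k :: nat list)) = from_nat k then 1 else 0) w"
    and \<alpha>_int: "\<And>m (H :: nat list \<Rightarrow> real). integrable lebesgue_01 (\<lambda>x. H (word (\<alpha> x) m))"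
    and \<alpha>_lim: "\<And>m (H :: nat list \<Rightarrow> real). (\<lambda>i. (\<Sum>v<5 * n i. H (word (a i v) m)) / real (5 * n i))
        \<longlonglongrightarrow> (\<integral>x. H (word (\<alpha> x) m) \<partial>lebesgue_01)"
    and \<alpha>_interval: "\<And>m u. is_interval {x \<in> {0<..<1}. word (\<alpha> x) m = u}"
    and \<beta>_int: "\<And>m (H :: nat list \<Rightarrow> real). integrable lebesgue_01 (\<lambda>x. H (word (\<beta> x) m))"
    and \<beta>_lim: "\<And>m (H :: nat list \<Rightarrow> real). (\<lambda>i. (\<Sum>w<2 * n i. H (word (b i w) m)) / real (2 * n i))
        \<longlonglongrightarrow> (\<integral>x. H (word (\<beta> x) m) \<partial>lebesgue_01)"
begin

lemmas n_pos = finite_model.n_pos[OF model] and \<sigma> = finite_model.\<sigma>_less[OF model]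
  and lower = finite_model.lower[OF model] and z_bound = finite_model.z_bound[OF model]
  and z_kernel = finite_model.z_kernel[OF model] and P_sub = finite_model.P_sub[OF model]
  and P_card = finite_model.P_card[OF model] and P_nz = finite_model.P_nz[OF model]
  and P_z = finite_model.P_z[OF model]

abbreviation T :: "nat \<Rightarrow> (nat \<Rightarrow> real) \<Rightarrow> nat \<Rightarrow> real" where
  "T i \<equiv> edge_sum ({..<5 * n i} \<times> {..<8}) (\<sigma> i)"

definition words :: "nat \<Rightarrow> nat list set" where
  "words m = {u. set u \<subseteq> {..<81} \<and> length u = m}"

lemma finite_words [simp]: "finite (words m)"
  unfolding words_def by (rule finite_lists_length_eq) simp

lemma a_lt: "a i v k < 81"
  using z_bound[of i "k div 2" v] by (auto simp: a_def)

lemma word_a: "word (a i v) m \<in> words m"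
  using a_lt by (auto simp: words_def word_def)

definition step :: "nat \<Rightarrow> (nat list \<Rightarrow> real) \<Rightarrow> L1" where
  "step m H = abs_L1 (\<lambda>x. H (word (\<alpha> x) m))"

text \<open>
  The formula for the adjacency operator in terms of right labels, with limit labels in their place.
\<close>

definition image_fun :: "nat \<Rightarrow> (nat list \<Rightarrow> real) \<Rightarrow> real \<Rightarrow> real" where
  "image_fun m H x = (\<Sum>u\<in>words m. H u * \<beta> x (to_nat u))"

definition step_image :: "nat \<Rightarrow> (nat list \<Rightarrow> real) \<Rightarrow> L1" where
  "step_image m H = abs_L1 (image_fun m H)"

lemma edge_sum_indicators:
  "(\<Sum>u\<in>words m. H u * real (b i w (to_nat u))) = T i (\<lambda>v. H (word (a i v) m)) w"
proof -
  have "real (b i w (to_nat u)) = T i (\<lambda>v. if word (a i v) m = u then 1 else 0) w" if "u \<in> words m" for u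
    using that unfolding b_def edge_sum_def by (simp add: words_def of_nat_sum if_distrib cong: if_cong)
  then have "(\<Sum>u\<in>words m. H u * real (b i w (to_nat u)))
      = (\<Sum>u\<in>words m. \<Sum>e\<in>{e\<in>{..<5 * n i} \<times> {..<8}. \<sigma> i e = w}. H u * (if word (a i (fst e)) m = u then 1 else 0))"
    by (intro sum.cong) (simp_all add: edge_sum_def sum_distrib_left)
  also have "\<dots> = (\<Sum>e\<in>{e\<in>{..<5 * n i} \<times> {..<8}. \<sigma> i e = w}. \<Sum>u\<in>words m. H u * (if word (a i (fst e)) m = u then 1 else 0))"
    by (rule sum.swap)
  also have "\<dots> = T i (\<lambda>v. H (word (a i v) m)) w"
    unfolding edge_sum_def using word_a by (intro sum.cong) (simp_all add: if_distrib cong: if_cong)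
  finally show ?thesis .
qed

lemma norm_step_lim: "(\<lambda>i. (\<Sum>v<5 * n i. \<bar>H (word (a i v) m)\<bar>) / real (5 * n i)) \<longlonglongrightarrow> norm (step m H)"
  using \<alpha>_lim[of "\<lambda>u. \<bar>H u\<bar>" m] \<alpha>_int[of H m] by (simp add: step_def norm_abs_L1)

lemma image_pair_word:
  obtains M where "\<And>u. u \<in> words m \<union> words m' \<Longrightarrow> to_nat u < M"
proof
  fix u assume "u \<in> words m \<union> words m'"
  then show "to_nat u < Suc (Max (to_nat ` (words m \<union> words m')))"
    by (intro le_imp_less_Suc Max_ge) auto
qed

lemma image_fun_integrable [simp]: "integrable lebesgue_01 (image_fun m H)"
proof -
  obtain M where M: "\<And>u. u \<in> words m \<union> words m \<Longrightarrow> to_nat u < M"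
    using image_pair_word[of m m] by blast
  have "image_fun m H = (\<lambda>x. (\<lambda>c. \<Sum>u\<in>words m. H u * real (c ! to_nat u)) (word (\<beta> x) M))"
    using M by (auto simp: image_fun_def intro!: sum.cong)
  then show ?thesis using \<beta>_int[of "\<lambda>c. \<Sum>u\<in>words m. H u * real (c ! to_nat u)" M] by simp
qed

text \<open>
  Words of sufficient length see all the right labels that occur, so the convergence of distributions
  applies. Two levels are allowed because this is what shows that the image of a function does not
  depend on the number of labels used to write it.
\<close>

lemma norm_image_diff_lim:
  "(\<lambda>i. (\<Sum>w<2 * n i. \<bar>T i (\<lambda>v. H (word (a i v) m)) w - T i (\<lambda>v. H' (word (a i v) m')) w\<bar>) / real (2 * n i))
     \<longlonglongrightarrow> norm (step_image m H - step_image m' H')"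
proof -
  obtain M where M: "\<And>u. u \<in> words m \<union> words m' \<Longrightarrow> to_nat u < M"
    using image_pair_word[of m m'] by blast
  define K where "K c = \<bar>(\<Sum>u\<in>words m. H u * real (c ! to_nat u)) - (\<Sum>u\<in>words m'. H' u * real (c ! to_nat u))\<bar>" for c
  have KT: "K (word (b i w) M) = \<bar>T i (\<lambda>v. H (word (a i v) m)) w - T i (\<lambda>v. H' (word (a i v) m')) w\<bar>" for i w
    using M unfolding K_def edge_sum_indicators[symmetric]
    by (intro arg_cong[where f = abs] arg_cong2[where f = minus] sum.cong) auto
  have "norm (step_image m H - step_image m' H') = (\<integral>x. \<bar>image_fun m H x - image_fun m' H' x\<bar> \<partial>lebesgue_01)"
    by (simp add: step_image_def abs_L1_diff norm_abs_L1)
  also have "\<dots> = (\<integral>x. K (word (\<beta> x) M) \<partial>lebesgue_01)"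
    using M unfolding K_def image_fun_def
    by (intro Bochner_Integration.integral_cong arg_cong[where f = abs] arg_cong2[where f = minus] sum.cong) auto
  finally show ?thesis using \<beta>_lim[of K M] by (simp add: KT)
qed

lemma norm_image_lim:
  "(\<lambda>i. (\<Sum>w<2 * n i. \<bar>T i (\<lambda>v. H (word (a i v) m)) w\<bar>) / real (2 * n i)) \<longlonglongrightarrow> norm (step_image m H)"
proof -
  have "step_image 0 (\<lambda>_. 0) = 0" by (simp add: step_image_def image_fun_def[abs_def] zero_L1_abs)
  then show ?thesis using norm_image_diff_lim[of H m "\<lambda>_. 0" 0] by (simp add: edge_sum_def)
qed

lemma step_raise: "l \<le> m \<Longrightarrow> step l H = step m (\<lambda>u. H (take l u))"
  by (simp add: step_def take_word)

lemma image_raise: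
  assumes "l \<le> m"
  shows "step_image l H = step_image m (\<lambda>u. H (take l u))"
proof -
  have "(\<lambda>i. 0) \<longlonglongrightarrow> norm (step_image l H - step_image m (\<lambda>u. H (take l u)))"
    using norm_image_diff_lim[of H l "\<lambda>u. H (take l u)" m] assms by (simp add: take_word)
  then show ?thesis by (simp add: tendsto_const_iff)
qed

lemma step_linear: "step m H + step m H' = step m (\<lambda>u. H u + H' u)" "c *\<^sub>R step m H = step m (\<lambda>u. c * H u)"
  using \<alpha>_int by (simp_all add: step_def abs_L1_add abs_L1_scaleR)

lemma image_linear:
  "step_image m H + step_image m H' = step_image m (\<lambda>u. H u + H' u)"
  "c *\<^sub>R step_image m H = step_image m (\<lambda>u. c * H u)"
proof -
  have "image_fun m (\<lambda>u. H u + H' u) = (\<lambda>x. image_fun m H x + image_fun m H' x)"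
      "image_fun m (\<lambda>u. c * H u) = (\<lambda>x. c * image_fun m H x)"
    by (simp_all add: image_fun_def fun_eq_iff distrib_right sum.distrib sum_distrib_left mult.assoc)
  then show "step_image m H + step_image m H' = step_image m (\<lambda>u. H u + H' u)"
      "c *\<^sub>R step_image m H = step_image m (\<lambda>u. c * H u)"
    by (simp_all add: step_image_def abs_L1_add abs_L1_scaleR)
qed

text \<open>
  The factors 20 here and 10 below are the degree 8 and the constant 4 of the finite models, times the
  quotient \<open>5n / 2n\<close> that comes from normalising the sums over left and right vertices.
\<close>

lemma norm_image_le: "norm (step_image m H) \<le> 20 * norm (step m H)"
proof (rule LIMSEQ_le[OF norm_image_lim tendsto_mult[OF tendsto_const norm_step_lim]])
  have "(\<Sum>w<2 * n i. \<bar>T i (\<lambda>v. H (word (a i v) m)) w\<bar>) / real (2 * n i)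
      \<le> 20 * ((\<Sum>v<5 * n i. \<bar>H (word (a i v) m)\<bar>) / real (5 * n i))" for i
    using sum_edge_sum_le[of "{..<5 * n i}" 8 "\<sigma> i" "2 * n i" "\<lambda>v. H (word (a i v) m)"] \<sigma>[of _ i] n_pos[of i]
    by (simp add: field_simps)
  then show "\<exists>N. \<forall>i\<ge>N. (\<Sum>w<2 * n i. \<bar>T i (\<lambda>v. H (word (a i v) m)) w\<bar>) / real (2 * n i)
      \<le> 20 * ((\<Sum>v<5 * n i. \<bar>H (word (a i v) m)\<bar>) / real (5 * n i))" by blast
qed

lemma inverse_n_lim: "(\<lambda>i. 1 / real (n i)) \<longlonglongrightarrow> 0"
  using tendsto_divide_0[OF tendsto_const filterlim_at_top_imp_at_infinity
      [OF filterlim_compose[OF filterlim_real_sequentially n_lim]]] .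

lemma floor_ratio_lim:
  assumes "c > 0"
  shows "(\<lambda>i. real (n i div c) / real (5 * n i)) \<longlonglongrightarrow> 1 / (5 * real c)"
proof -
  have bounds: "1 / (5 * real c) - 1 / real (n i) \<le> real (n i div c) / real (5 * n i) \<and> real (n i div c) / real (5 * n i) \<le> 1 / (5 * real c)" for i
  proof -
    have "(real (n i) / real c - 1) / real (5 * n i) = 1 / (5 * real c) - 1 / (5 * real (n i))"
        "real (n i) / real c / real (5 * n i) = 1 / (5 * real c)"
      using n_pos[of i] assms by (simp_all add: field_simps)
    moreover have "1 / (5 * real (n i)) \<le> 1 / real (n i)" by (simp add: divide_simps)
    ultimately show ?thesis
      using divide_right_mono[OF real_div_bounds(1)[OF assms, of "n i"], of "real (5 * n i)"]
        divide_right_mono[OF real_div_bounds(2)[OF assms, of "n i"], of "real (5 * n i)"] by simp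
  qed
  have lim: "(\<lambda>i. 1 / (5 * real c) - 1 / real (n i)) \<longlonglongrightarrow> 1 / (5 * real c)"
    using tendsto_diff[OF tendsto_const inverse_n_lim] by simp
  show ?thesis
    by (rule tendsto_sandwich[OF _ _ lim tendsto_const]) (intro always_eventually allI conjunct1[OF bounds] conjunct2[OF bounds])+
qed

lemma cell_sets: "{x \<in> {0<..<1}. word (\<alpha> x) m \<in> S} \<in> sets lebesgue_01"
proof -
  have [measurable]: "(\<lambda>x. of_bool (word (\<alpha> x) m \<in> S) :: real) \<in> borel_measurable lebesgue_01"
    using \<alpha>_int[of "\<lambda>u. of_bool (u \<in> S)" m] by auto
  have "{x \<in> space lebesgue_01. of_bool (word (\<alpha> x) m \<in> S) = (1 :: real)} \<in> sets lebesgue_01" by measurable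
  then show ?thesis by simp
qed

lemma cell_measure_lim:
  "(\<lambda>i. real (card {v. v < 5 * n i \<and> word (a i v) m \<in> S}) / real (5 * n i))
     \<longlonglongrightarrow> \<mu> {x \<in> {0<..<1}. word (\<alpha> x) m \<in> S}"
proof -
  have "(\<integral>x. of_bool (word (\<alpha> x) m \<in> S) \<partial>lebesgue_01)
      = (\<integral>x. indicator {x \<in> {0<..<1}. word (\<alpha> x) m \<in> S} x \<partial>lebesgue_01)"
    by (intro Bochner_Integration.integral_cong) (auto simp: indicator_def)
  also have "\<dots> = \<mu> {x \<in> {0<..<1}. word (\<alpha> x) m \<in> S}"
    using Int_space_01[OF cell_sets[of m S]] by simp
  finally have 1: "(\<integral>x. of_bool (word (\<alpha> x) m \<in> S) \<partial>lebesgue_01) = \<mu> {x \<in> {0<..<1}. word (\<alpha> x) m \<in> S}" .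
  have 2: "(\<Sum>v<5 * n i. of_bool (word (a i v) m \<in> S)) = real (card {v. v < 5 * n i \<and> word (a i v) m \<in> S})" for i
    by (simp add: of_bool_def sum.If_cases Int_def)
  show ?thesis using \<alpha>_lim[of "\<lambda>u. of_bool (u \<in> S)" m] unfolding 1 2 .
qed

text \<open>
  The frequency of the support in the finite models converges to its measure. Hence it is eventually
  below the threshold \<open>1 / (5 \<sqdot> 2000000)\<close> up to which the finite operators are bounded below.
\<close>

lemma norm_image_ge:
  assumes small: "\<mu> {x \<in> {0<..<1}. H (word (\<alpha> x) m) \<noteq> 0} < 1 / 10000000"
  shows "10 * norm (step m H) \<le> norm (step_image m H)"
proof (rule LIMSEQ_le[OF tendsto_mult[OF tendsto_const norm_step_lim] norm_image_lim])
  define c where "c i = card {v. v < 5 * n i \<and> word (a i v) m \<in> {u. H u \<noteq> 0}}" for i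
  have "(\<lambda>i. real (n i div 2000000) / real (5 * n i) - real (c i) / real (5 * n i))
      \<longlonglongrightarrow> 1 / 10000000 - \<mu> {x \<in> {0<..<1}. word (\<alpha> x) m \<in> {u. H u \<noteq> 0}}"
    using tendsto_diff[OF floor_ratio_lim[of 2000000] cell_measure_lim[of m "{u. H u \<noteq> 0}"]] by (simp add: c_def)
  from order_tendstoD(1)[OF this, of 0] small
  have "\<forall>\<^sub>F i in sequentially. 0 < real (n i div 2000000) / real (5 * n i) - real (c i) / real (5 * n i)" by simp
  then obtain N where N: "\<And>i. i \<ge> N \<Longrightarrow> 0 < real (n i div 2000000) / real (5 * n i) - real (c i) / real (5 * n i)"
    unfolding eventually_sequentially by blast
  have "10 * ((\<Sum>v<5 * n i. \<bar>H (word (a i v) m)\<bar>) / real (5 * n i))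
      \<le> (\<Sum>w<2 * n i. \<bar>T i (\<lambda>v. H (word (a i v) m)) w\<bar>) / real (2 * n i)" if "i \<ge> N" for i
  proof -
    have "0 < (real (n i div 2000000) - real (c i)) / real (5 * n i)"
      using N[OF that] by (simp only: diff_divide_distrib)
    then have "real (c i) < real (n i div 2000000)"
      using n_pos[of i] by (simp add: zero_less_divide_iff)
    then have "card {v \<in> {..<5 * n i}. H (word (a i v) m) \<noteq> 0} \<le> n i div 2000000"
      by (simp add: c_def)
    from lower[OF this] show ?thesis using n_pos[of i] by (simp add: field_simps)
  qed
  then show "\<exists>N. \<forall>i\<ge>N. 10 * ((\<Sum>v<5 * n i. \<bar>H (word (a i v) m)\<bar>) / real (5 * n i))
      \<le> (\<Sum>w<2 * n i. \<bar>T i (\<lambda>v. H (word (a i v) m)) w\<bar>) / real (2 * n i)" by blast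
qed

lemma step_graph_subspace: "subspace {(step m H, step_image m H) | m H. True}"
proof (rule subspaceI)
  have "(0, 0) = (step 0 (\<lambda>_. 0), step_image 0 (\<lambda>_. 0))"
    using step_linear(2)[of 0 0 "\<lambda>_. 0"] image_linear(2)[of 0 0 "\<lambda>_. 0"] by simp
  then show "0 \<in> {(step m H, step_image m H) | m H. True}" unfolding zero_prod_def by blast
next
  fix p q assume "p \<in> {(step m H, step_image m H) | m H. True}" "q \<in> {(step m H, step_image m H) | m H. True}"
  then obtain m H m' H' where p: "p = (step m H, step_image m H)" and q: "q = (step m' H', step_image m' H')" by blast
  define k where "k = max m m'"
  have "p + q = (step k (\<lambda>u. H (take m u) + H' (take m' u)), step_image k (\<lambda>u. H (take m u) + H' (take m' u)))"
    unfolding p q step_raise[of m k H, OF max.cobounded1[of m m', folded k_def]]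
      step_raise[of m' k H', OF max.cobounded2[of m' m, folded k_def]]
      image_raise[of m k H, OF max.cobounded1[of m m', folded k_def]]
      image_raise[of m' k H', OF max.cobounded2[of m' m, folded k_def]]
    by (simp add: step_linear image_linear)
  then show "p + q \<in> {(step m H, step_image m H) | m H. True}" by blast
next
  fix c p assume "p \<in> {(step m H, step_image m H) | m H. True}"
  then obtain m H where p: "p = (step m H, step_image m H)" by blast
  have "c *\<^sub>R p = (step m (\<lambda>u. c * H u), step_image m (\<lambda>u. c * H u))" unfolding p by (simp add: step_linear image_linear)
  then show "c *\<^sub>R p \<in> {(step m H, step_image m H) | m H. True}" by blast
qed

text \<open>
  The \<open>k\<close> binary digits among the first \<open>2k\<close> labels determine the vertex modulo \<open>2\<^sup>k\<close>.
\<close>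

lemma cell_measure_le: "\<mu> {x \<in> {0<..<1}. word (\<alpha> x) (2 * k) = u} \<le> (1/2) ^ k"
proof -
  have card: "real (card {v. v < 5 * n i \<and> word (a i v) (2 * k) \<in> {u}}) / real (5 * n i) \<le> (1/2) ^ k + 1 / real (n i)" for i
  proof -
    let ?C = "{v. v < 5 * n i \<and> word (a i v) (2 * k) \<in> {u}}"
    have "inj_on (\<lambda>v. v div 2 ^ k) ?C"
    proof (rule inj_onI)
      fix v w assume v: "v \<in> ?C" and w: "w \<in> ?C" and div: "v div 2 ^ k = w div 2 ^ k"
      have "v mod 2 ^ k = w mod 2 ^ k"
      proof (rule mod_power2_eqI)
        fix j assume "j < k"
        then have "a i v (2 * j + 1) = a i w (2 * j + 1)"
          using v w nth_word[of "2 * j + 1" "2 * k" "a i v"] nth_word[of "2 * j + 1" "2 * k" "a i w"] by auto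
        then show "(v div 2 ^ j) mod 2 = (w div 2 ^ j) mod 2" by (simp add: a_def)
      qed
      with div show "v = w" by (metis div_mult_mod_eq)
    qed
    moreover have "(\<lambda>v. v div 2 ^ k) ` ?C \<subseteq> {..5 * n i div 2 ^ k}"
      by (auto intro: div_le_mono)
    ultimately have "card ?C \<le> card {..5 * n i div 2 ^ k}" by (rule card_inj_on_le) simp
    then have "real (card ?C) \<le> real (5 * n i div 2 ^ k) + 1" by simp
    also have "\<dots> \<le> real (5 * n i) / 2 ^ k + 1"
      using real_div_bounds(2)[of "2 ^ k" "5 * n i"] by simp
    finally have "real (card ?C) / real (5 * n i) \<le> (real (5 * n i) / 2 ^ k + 1) / real (5 * n i)"
      by (rule divide_right_mono) simp
    also have "\<dots> = (1/2) ^ k + 1 / real (5 * n i)"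
      using n_pos[of i] by (simp add: add_divide_distrib power_one_over)
    also have "\<dots> \<le> (1/2) ^ k + 1 / real (n i)" by (simp add: divide_simps)
    finally show ?thesis .
  qed
  have "\<mu> {x \<in> {0<..<1}. word (\<alpha> x) (2 * k) \<in> {u}} \<le> (1/2) ^ k + 0"
    by (rule LIMSEQ_le[OF cell_measure_lim tendsto_add[OF tendsto_const inverse_n_lim]]) (use card in blast)
  then show ?thesis by simp
qed

text \<open>
  An interval \<open>(0,t]\<close> is approximated by the union of the cells that meet it. Cells are intervals, so
  the two sets differ only inside the cell that contains \<open>t\<close>.
\<close>

lemma step_dense: "closure (fst ` {(step m H, step_image m H) | m H. True}) = UNIV"
proof -
  define S where "S = {step m H | m H. True}"
  have fS: "fst ` {(step m H, step_image m H) | m H. True} = S" by (force simp: S_def)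
  have sub: "subspace S"
    using linear_subspace_image[OF linear_fst step_graph_subspace] unfolding fS .
  have "closure S = UNIV"
  proof (rule closed_subspace_L1_UNIV)
    show "subspace (closure S)" by (rule subspace_closure_normed[OF sub])
    have "one_L1 = step 0 (\<lambda>_. 1)" by (simp add: one_L1_def step_def)
    then have "one_L1 \<in> S" unfolding S_def by blast
    then show "one_L1 \<in> closure S" using closure_subset by blast
  next
    fix t :: real assume t: "0 < t" "t < 1"
    show "restrict_L1 {0<..t} one_L1 \<in> closure S"
    proof (subst closure_approachable, intro allI impI)
      fix e :: real assume "e > 0"
      obtain k where k: "(1/2) ^ k < e" using real_arch_pow_inv[OF \<open>e > 0\<close>, of "1/2"] by auto
      define cell where "cell u = {x \<in> {0<..<1}. word (\<alpha> x) (2 * k) = u}" for u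
      define h where "h u = (of_bool (cell u \<inter> {0<..t} \<noteq> {}) :: real)" for u
      have ts: "{0<..t} \<in> sets lebesgue_01" using t by (auto simp: sets_restrict_space intro!: image_eqI[of _ _ "{0<..t}"])
      have cs: "cell u \<in> sets lebesgue_01" for u using cell_sets[of "2 * k" "{u}"] by (simp add: cell_def)
      have diff: "\<bar>h (word (\<alpha> x) (2 * k)) - indicator {0<..t} x\<bar> \<le> indicator (cell (word (\<alpha> t) (2 * k))) x"
        if x: "x \<in> {0<..<1}" for x
      proof (cases "x \<le> t")
        case True
        then have "x \<in> cell (word (\<alpha> x) (2 * k)) \<inter> {0<..t}" using x by (auto simp: cell_def)
        then have "h (word (\<alpha> x) (2 * k)) = 1" unfolding h_def by auto
        then show ?thesis using True x by simp
      next
        case False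
        show ?thesis
        proof (cases "cell (word (\<alpha> x) (2 * k)) \<inter> {0<..t} = {}")
          case True
          then show ?thesis using False by (simp add: h_def)
        next
          case ne: False
          then obtain y where y: "y \<in> cell (word (\<alpha> x) (2 * k))" "y \<le> t" by auto
          moreover have "x \<in> cell (word (\<alpha> x) (2 * k))" using x by (simp add: cell_def)
          ultimately have "t \<in> cell (word (\<alpha> x) (2 * k))"
            using \<alpha>_interval[of "2 * k" "word (\<alpha> x) (2 * k)"] False unfolding cell_def[symmetric] is_interval_1
            by (meson linear)
          then have "x \<in> cell (word (\<alpha> t) (2 * k))" using x by (simp add: cell_def)
          then show ?thesis using False by (simp add: h_def)
        qed
      qed
      have hi: "integrable lebesgue_01 (\<lambda>x. h (word (\<alpha> x) (2 * k)))" by (rule \<alpha>_int)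
      have "dist (step (2 * k) h) (restrict_L1 {0<..t} one_L1)
          = (\<integral>x. \<bar>h (word (\<alpha> x) (2 * k)) - indicator {0<..t} x\<bar> \<partial>lebesgue_01)"
        using hi ts by (simp add: dist_norm step_def restrict_one_L1 abs_L1_diff norm_abs_L1 integrable_indicator_01)
      also have "\<dots> \<le> (\<integral>x. indicator (cell (word (\<alpha> t) (2 * k))) x \<partial>lebesgue_01)"
        using hi ts cs diff by (intro integral_mono integrable_abs Bochner_Integration.integrable_diff integrable_indicator_01) auto
      also have "\<dots> = \<mu> (cell (word (\<alpha> t) (2 * k)))"
        using Int_space_01[OF cs] by simp
      also have "\<dots> \<le> (1/2) ^ k" unfolding cell_def by (rule cell_measure_le)
      finally have "dist (step (2 * k) h) (restrict_L1 {0<..t} one_L1) < e" using k by linarith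
      moreover have "step (2 * k) h \<in> S" unfolding S_def by blast
      ultimately show "\<exists>y\<in>S. dist y (restrict_L1 {0<..t} one_L1) < e" by blast
    qed
  qed simp
  then show ?thesis unfolding fS .
qed

lemma ex_limit_operator:
  obtains L :: "L1 \<Rightarrow>\<^sub>L L1" where "\<And>m H. L (step m H) = step_image m H"
proof -
  obtain L :: "L1 \<Rightarrow>\<^sub>L L1" where "\<And>x y. (x, y) \<in> {(step m H, step_image m H) | m H. True} \<Longrightarrow> L x = y"
  proof (rule blinfun_of_bounded_graph[OF step_graph_subspace _ step_dense, of 20])
    show "norm y \<le> 20 * norm x" if "(x, y) \<in> {(step m H, step_image m H) | m H. True}" for x y
      using that norm_image_le by auto
  qed blast
  then show thesis using that by blast
qed

text \<open>
  A function with small support is approximated by step functions \<open>H\<close>, whose supports can be large.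
  Discarding the values of \<open>H\<close> of size at most \<open>\<tau>\<close> changes the norm by at most \<open>\<tau>\<close>, and what remains
  outside the support of \<open>f\<close> has measure at most \<open>\<parallel>f - H\<parallel> / \<tau>\<close>.
\<close>

lemma limit_operator_bounded_below:
  assumes L: "\<And>m H. blinfun_apply L (step m H) = step_image m H" and f: "supp_measure f < 1 / 10000000"
  shows "10 * norm f \<le> norm (blinfun_apply L f)"
proof (rule field_le_epsilon)
  fix e :: real assume "e > 0"
  define \<tau> where "\<tau> = e / (10 + norm L) / 2"
  have L0: "10 + norm L > 0" using norm_ge_zero[of L] by linarith
  have \<tau>: "\<tau> > 0" using \<open>e > 0\<close> L0 by (simp add: \<tau>_def)
  define \<epsilon> where "\<epsilon> = min \<tau> (\<tau> * (1 / 10000000 - supp_measure f) / 2)"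
  have \<epsilon>: "\<epsilon> > 0" "\<epsilon> \<le> \<tau>" "\<epsilon> < \<tau> * (1 / 10000000 - supp_measure f)" using \<tau> f by (auto simp: \<epsilon>_def min_def)
  have "f \<in> closure (fst ` {(step m H, step_image m H) | m H. True})" using step_dense by simp
  then obtain m H where "dist (step m H) f < \<epsilon>"
    using \<epsilon>(1) unfolding closure_approachable by force
  then have close: "norm (f - step m H) < \<epsilon>" by (simp add: dist_norm norm_minus_commute)
  define H' where "H' u = (if \<bar>H u\<bar> > \<tau> then H u else 0)" for u
  obtain f' where f': "integrable lebesgue_01 f'" "f = abs_L1 f'" by (rule L1_cases)
  have [measurable]: "f' \<in> borel_measurable lebesgue_01" using f' by auto
  have hm [measurable]: "(\<lambda>x. h (word (\<alpha> x) m)) \<in> borel_measurable lebesgue_01" for h :: "nat list \<Rightarrow> real"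
    using \<alpha>_int[of h m] by auto
  let ?F = "{x \<in> space lebesgue_01. f' x \<noteq> 0}"
  let ?D = "{x \<in> space lebesgue_01. \<tau> \<le> \<bar>f' x - H (word (\<alpha> x) m)\<bar>}"
  have Fs: "?F \<in> sets lebesgue_01" and Ds: "?D \<in> sets lebesgue_01" by measurable
  have "\<tau> * \<mu> ?D = (\<integral>x. \<tau> * indicator ?D x \<partial>lebesgue_01)"
    using Int_space_01[OF Ds] by simp
  also have "\<dots> \<le> (\<integral>x. \<bar>f' x - H (word (\<alpha> x) m)\<bar> \<partial>lebesgue_01)"
    using f'(1) \<alpha>_int[of H m] integrable_indicator_01[OF Ds] by (intro integral_mono) (auto split: split_indicator)
  also have "\<dots> = norm (f - step m H)"
    using f' \<alpha>_int[of H m] by (simp add: step_def abs_L1_diff norm_abs_L1)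
  finally have "\<tau> * \<mu> ?D < \<tau> * (1 / 10000000 - supp_measure f)" using close \<epsilon>(3) by linarith
  then have Dm: "\<mu> ?D < 1 / 10000000 - supp_measure f" using \<tau> by simp
  have "{x \<in> {0<..<1}. H' (word (\<alpha> x) m) \<noteq> 0} \<subseteq> ?F \<union> ?D"
    using \<tau> by (auto simp: H'_def split: if_splits)
  then have "\<mu> {x \<in> {0<..<1}. H' (word (\<alpha> x) m) \<noteq> 0} \<le> \<mu> (?F \<union> ?D)"
    using Fs Ds by (intro L01.finite_measure_mono) auto
  also have "\<dots> \<le> \<mu> ?F + \<mu> ?D" by (rule measure_Un_le[OF Fs Ds])
  also have "\<dots> < 1 / 10000000" using Dm supp_measure_abs[OF f'(1)] f'(2) by simp
  finally have ge: "10 * norm (step m H') \<le> norm (step_image m H')" by (rule norm_image_ge)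
  have "norm (step m H - step m H') \<le> \<tau>"
  proof -
    have "norm (step m H - step m H') = (\<integral>x. \<bar>H (word (\<alpha> x) m) - H' (word (\<alpha> x) m)\<bar> \<partial>lebesgue_01)"
      using \<alpha>_int by (simp add: step_def abs_L1_diff norm_abs_L1)
    also have "\<dots> \<le> (\<integral>x. \<tau> \<partial>lebesgue_01)"
      using \<alpha>_int \<tau> by (intro integral_mono integrable_abs Bochner_Integration.integrable_diff) (auto simp: H'_def)
    finally show ?thesis by simp
  qed
  then have near: "norm (f - step m H') \<le> 2 * \<tau>"
    using close \<epsilon>(2) norm_triangle_ineq[of "f - step m H" "step m H - step m H'"] by simp
  have "norm f \<le> norm (step m H') + 2 * \<tau>"
    using near norm_triangle_ineq2[of f "step m H'"] by linarith
  moreover have "norm (step_image m H') \<le> norm (L f) + norm L * (2 * \<tau>)"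
  proof -
    have "norm (L (f - step m H')) \<le> norm L * (2 * \<tau>)"
      using norm_blinfun[of L "f - step m H'"] mult_left_mono[OF near, of "norm L"] by simp
    then show ?thesis using norm_triangle_ineq2[of "step_image m H'" "L f"] by (simp add: blinfun.diff_right L norm_minus_commute)
  qed
  ultimately have "10 * norm f \<le> norm (L f) + (10 + norm L) * (2 * \<tau>)"
    using ge by (simp add: algebra_simps)
  also have "(10 + norm L) * (2 * \<tau>) = e"
  proof -
    have "c * (2 * (e / c / 2)) = e" if "c > 0" for c :: real using that by simp
    from this[OF L0] show ?thesis unfolding \<tau>_def .
  qed
  finally show "10 * norm f \<le> norm (L f) + e" .
qed

definition kernel_fun :: "nat \<Rightarrow> L1" where
  "kernel_fun k = step (2 * k + 1) (\<lambda>u. real (u ! (2 * k)) - 40)"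

lemma kernel_word: "2 * k < m \<Longrightarrow> real (word (a i v) m ! (2 * k)) - 40 = real_of_int (z i k v)"
  using z_bound[of i k v] by (simp add: a_def)

lemma limit_operator_kernel:
  assumes L: "\<And>m H. blinfun_apply L (step m H) = step_image m H"
  shows "L (kernel_fun k) = 0"
proof -
  have "T i (\<lambda>v. real (word (a i v) (2 * k + 1) ! (2 * k)) - 40) w = 0" for i w
  proof -
    have "T i (\<lambda>v. real (word (a i v) (2 * k + 1) ! (2 * k)) - 40) w = T i (\<lambda>v. real_of_int (z i k v)) w"
      by (intro arg_cong[where f = "\<lambda>f. T i f w"] ext kernel_word) simp
    also have "\<dots> = real_of_int (edge_sum ({..<5 * n i} \<times> {..<8}) (\<sigma> i) (z i k) w)"
      by (simp add: edge_sum_def)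
    finally show ?thesis by (simp add: z_kernel)
  qed
  then have "(\<lambda>i. 0) \<longlonglongrightarrow> norm (step_image (2 * k + 1) (\<lambda>u. real (u ! (2 * k)) - 40))"
    using norm_image_lim[of "\<lambda>u. real (u ! (2 * k)) - 40" "2 * k + 1"] by simp
  then show ?thesis by (simp add: kernel_fun_def L tendsto_const_iff)
qed

text \<open>
  The pivot sets survive in the limit as a set \<open>D\<close> of positive measure on which \<open>kernel_fun k\<close> does not
  vanish but the next functions do.
\<close>

lemma kernel_fun_not_in_span:
  assumes "k \<le> d"
  shows "kernel_fun k \<notin> span (kernel_fun ` {k<..d})"
proof
  assume in_span: "kernel_fun k \<in> span (kernel_fun ` {k<..d})"
  define m where "m = 2 * d + 1"
  define S where "S = {u :: nat list. u ! (2 * k) \<noteq> 40 \<and> (\<forall>l\<in>{k<..d}. u ! (2 * l) = 40)}"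
  define D where "D = {x \<in> {0<..<1}. word (\<alpha> x) m \<in> S}"
  have Ds: "D \<in> sets lebesgue_01" unfolding D_def by (rule cell_sets)
  have "0 < 1 / (5 * real (2000000 * 2 ^ Suc k))" by simp
  also have "\<dots> \<le> \<mu> D" unfolding D_def
  proof (rule LIMSEQ_le[OF floor_ratio_lim cell_measure_lim])
    have "real (n i div (2000000 * 2 ^ Suc k)) / real (5 * n i)
        \<le> real (card {v. v < 5 * n i \<and> word (a i v) m \<in> S}) / real (5 * n i)" for i
    proof -
      have "P i k \<subseteq> {v. v < 5 * n i \<and> word (a i v) m \<in> S}"
      proof
        fix v assume v: "v \<in> P i k"
        have "a i v (2 * k) \<noteq> 40" using P_nz[OF v] z_bound[of i k v] by (simp add: a_def)
        moreover have "a i v (2 * l) = 40" if "l \<in> {k<..d}" for l using P_z[OF _ v, of l] that by (simp add: a_def)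
        ultimately show "v \<in> {v. v < 5 * n i \<and> word (a i v) m \<in> S}"
          using v P_sub[of i k] assms by (auto simp: S_def m_def)
      qed
      then have "card (P i k) \<le> card {v. v < 5 * n i \<and> word (a i v) m \<in> S}" by (intro card_mono) auto
      then have "n i div (2000000 * 2 ^ Suc k) \<le> card {v. v < 5 * n i \<and> word (a i v) m \<in> S}"
        unfolding P_card div_mult2_eq .
      then show ?thesis by (intro divide_right_mono) auto
    qed
    then show "\<exists>N. \<forall>i\<ge>N. real (n i div (2000000 * 2 ^ Suc k)) / real (5 * n i)
        \<le> real (card {v. v < 5 * n i \<and> word (a i v) m \<in> S}) / real (5 * n i)" by blast
  qed simp
  finally have Dpos: "0 < \<mu> D" .
  have kf: "restrict_L1 D (kernel_fun l) = abs_L1 (\<lambda>x. indicator D x * (real (\<alpha> x (2 * l)) - 40))"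
      "integrable lebesgue_01 (\<lambda>x. real (\<alpha> x (2 * l)) - 40)" for l
    using restrict_L1_abs[OF Ds \<alpha>_int[of "\<lambda>u. real (u ! (2 * l)) - 40" "2 * l + 1"]]
      \<alpha>_int[of "\<lambda>u. real (u ! (2 * l)) - 40" "2 * l + 1"] by (simp_all add: kernel_fun_def step_def)
  have "span (kernel_fun ` {k<..d}) \<subseteq> {y. restrict_L1 D y = 0}"
  proof (rule span_minimal)
    show "subspace {y. blinfun_apply (restrict_L1 D) y = 0}"
      by (auto intro!: subspaceI simp: blinfun.add_right blinfun.scaleR_right)
    have "restrict_L1 D (kernel_fun l) = 0" if l: "l \<in> {k<..d}" for l
    proof -
      have "(\<lambda>x. indicator D x * (real (\<alpha> x (2 * l)) - 40)) = (\<lambda>_. 0)"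
        using l by (auto simp: D_def S_def m_def fun_eq_iff split: split_indicator)
      then show ?thesis using kf(1)[of l] by (simp add: zero_L1_abs)
    qed
    then show "kernel_fun ` {k<..d} \<subseteq> {y. blinfun_apply (restrict_L1 D) y = 0}" by blast
  qed
  then have "abs_L1 (\<lambda>x. indicator D x * (real (\<alpha> x (2 * k)) - 40)) = abs_L1 (\<lambda>_. 0)"
    using in_span kf(1)[of k] by (auto simp: zero_L1_abs)
  then have "AE x in lebesgue_01. indicator D x * (real (\<alpha> x (2 * k)) - 40) = 0"
    using kf(2)[of k] Ds by (simp only: abs_L1_eq_iff integrable_indicator_times integrable_zero)
  then have "AE x in lebesgue_01. x \<notin> D"
    by (rule AE_mp) (use assms in \<open>auto simp: D_def S_def m_def indicator_def intro!: AE_I2\<close>)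
  then have "\<mu> D = 0"
    using Ds by (metis AE_iff_null_sets measure_eq_0_null_sets)
  then show False using Dpos by simp
qed

lemma infinite_dimensional_kernel:
  assumes L: "\<And>m H. blinfun_apply L (step m H) = step_image m H"
  shows "\<not> finite_dimensional (null_space L)"
proof
  assume "finite_dimensional (null_space L)"
  then obtain B where B: "finite B" "span B = null_space L" by (auto simp: finite_dimensional_def)
  have indep: "independent (kernel_fun ` {k..d}) \<and> card (kernel_fun ` {k..d}) = Suc d - k" if "k \<le> Suc d" for k d
    using that
  proof (induction rule: inc_induct)
    case base
    show ?case by (simp add: independent_empty)
  next
    case (step k)
    then have "{k..d} = insert k {Suc k..d}" "{Suc k..d} = {k<..d}" by auto
    moreover have "kernel_fun k \<notin> span (kernel_fun ` {k<..d})" using step by (intro kernel_fun_not_in_span) simp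
    ultimately show ?case
      using step span_superset[of "kernel_fun ` {k<..d}"] by (auto simp: independent_insert)
  qed
  have "kernel_fun ` {0..card B} \<subseteq> span B"
    using limit_operator_kernel[OF L] by (auto simp: B null_space_def)
  then have "card (kernel_fun ` {0..card B}) \<le> card B"
    using independent_span_bound[OF B(1)] indep[of 0 "card B"] by blast
  then show False using indep[of 0 "card B"] by simp
qed

end

lemma exists_expander_limit:
  "\<exists>n \<sigma> z P a b \<alpha> \<beta>. expander_limit n \<sigma> z P a b \<alpha> \<beta>"
proof -
  obtain \<sigma> z P where fm: "\<And>i. finite_model (Suc i) (\<sigma> i) (z i) (P i)"
    using finite_model_exists[OF zero_less_Suc] by metis
  define a where "a i v k = (if even k then nat (z i (k div 2) v + 40) else (v div 2 ^ (k div 2)) mod 2)" for i v k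
  have a: "a i v k < 81" for i v k
    using finite_model.z_bound[OF fm, of i "k div 2" v] by (auto simp: a_def)
  obtain r \<alpha> where r: "strict_mono r"
    and \<alpha>: "\<And>m (H :: nat list \<Rightarrow> real). integrable lebesgue_01 (\<lambda>x. H (map (\<alpha> x) [0..<m]))"
      "\<And>m (H :: nat list \<Rightarrow> real). (\<lambda>i. (\<Sum>v<5 * Suc (r i). H (map (a (r i) v) [0..<m])) / real (5 * Suc (r i)))
        \<longlonglongrightarrow> (\<integral>x. H (map (\<alpha> x) [0..<m]) \<partial>lebesgue_01)"
      "\<And>m u. is_interval {x \<in> {0<..<1}. map (\<alpha> x) [0..<m] = u}"
    by (rule limit_of_digit_sequences[of "\<lambda>i. 5 * Suc i" a 81]) (simp, rule a, rule that)
  define b where "b i w k = edge_sum ({..<5 * Suc i} \<times> {..<8}) (\<sigma> i)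
      (\<lambda>v. if word (a i v) (length (from_nat k :: nat list)) = from_nat k then 1 else 0 :: nat) w" for i w k
  have b: "b i w k < 41" for i w k
  proof -
    have "b i w k \<le> (\<Sum>e\<in>{e\<in>{..<5 * Suc i} \<times> {..<8}. \<sigma> i e = w}. 1)"
      unfolding b_def edge_sum_def by (intro sum_mono) auto
    also have "\<dots> \<le> 40" using finite_model.degree[OF fm, of i w] by simp
    finally show ?thesis by simp
  qed
  obtain q \<beta> where q: "strict_mono q"
    and \<beta>: "\<And>m (H :: nat list \<Rightarrow> real). integrable lebesgue_01 (\<lambda>x. H (map (\<beta> x) [0..<m]))"
      "\<And>m (H :: nat list \<Rightarrow> real). (\<lambda>i. (\<Sum>w<2 * Suc (r (q i)). H (map (b (r (q i)) w) [0..<m])) / real (2 * Suc (r (q i))))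
        \<longlonglongrightarrow> (\<integral>x. H (map (\<beta> x) [0..<m]) \<partial>lebesgue_01)"
    by (rule limit_of_digit_sequences[of "\<lambda>i. 2 * Suc (r i)" "\<lambda>i. b (r i)" 41]) (simp, rule b, rule that)
  define s where "s i = r (q i)" for i
  have s: "strict_mono s" using r q by (simp add: s_def strict_mono_def)
  have "expander_limit (\<lambda>i. Suc (s i)) (\<lambda>i. \<sigma> (s i)) (\<lambda>i. z (s i)) (\<lambda>i. P (s i)) (\<lambda>i. a (s i)) (\<lambda>i. b (s i)) \<alpha> \<beta>"
  proof (rule expander_limit.intro)
    show "filterlim (\<lambda>i. Suc (s i)) at_top sequentially"
      using filterlim_compose[OF filterlim_Suc filterlim_subseq[OF s]] .
    show "(\<lambda>i. (\<Sum>v<5 * Suc (s i). H (word (a (s i) v) m)) / real (5 * Suc (s i)))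
        \<longlonglongrightarrow> (\<integral>x. H (word (\<alpha> x) m) \<partial>lebesgue_01)" for m and H :: "nat list \<Rightarrow> real"
      using LIMSEQ_subseq_LIMSEQ[OF \<alpha>(2)[of H m] q] by (simp add: word_def s_def o_def)
    show "(\<lambda>i. (\<Sum>w<2 * Suc (s i). H (word (b (s i) w) m)) / real (2 * Suc (s i)))
        \<longlonglongrightarrow> (\<integral>x. H (word (\<beta> x) m) \<partial>lebesgue_01)" for m and H :: "nat list \<Rightarrow> real"
      using \<beta>(2)[of H m] by (simp add: word_def s_def)
    show "integrable lebesgue_01 (\<lambda>x. H (word (\<alpha> x) m))" for m and H :: "nat list \<Rightarrow> real"
      unfolding word_def by (rule \<alpha>(1))
    show "integrable lebesgue_01 (\<lambda>x. H (word (\<beta> x) m))" for m and H :: "nat list \<Rightarrow> real"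
      unfolding word_def by (rule \<beta>(1))
    show "is_interval {x \<in> {0<..<1}. word (\<alpha> x) m = u}" for m u
      unfolding word_def by (rule \<alpha>(3))
    show "finite_model (Suc (s i)) (\<sigma> (s i)) (z (s i)) (P (s i))" for i by (rule fm)
    show "a (s i) v k = (if even k then nat (z (s i) (k div 2) v + 40) else (v div 2 ^ (k div 2)) mod 2)" for i v k
      by (rule a_def)
    show "b (s i) w k = edge_sum ({..<5 * Suc (s i)} \<times> {..<8}) (\<sigma> (s i))
      (\<lambda>v. if word (a (s i) v) (length (from_nat k :: nat list)) = from_nat k then 1 else 0) w" for i w k
      by (rule b_def)
  qed
  then show ?thesis by blast
qed

theorem theorem1:
  shows "\<exists>T :: L1 \<Rightarrow>\<^sub>L L1.
           tauberian T \<and> \<not> finite_dimensional (null_space T) \<and> \<not> upper_semi_fredholm T"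
proof -
  obtain n \<sigma> z P a b \<alpha> \<beta> where "expander_limit n \<sigma> z P a b \<alpha> \<beta>"
    using exists_expander_limit by blast
  then interpret expander_limit n \<sigma> z P a b \<alpha> \<beta> .
  obtain L :: "L1 \<Rightarrow>\<^sub>L L1" where L: "\<And>m H. L (step m H) = step_image m H"
    by (rule ex_limit_operator) (rule that)
  have "tauberian L"
    by (rule tauberian_of_bounded_below_on_small_support[of "1 / 10000000" 10])
      (use limit_operator_bounded_below[OF L] in auto)
  moreover have "\<not> finite_dimensional (null_space L)"
    by (rule infinite_dimensional_kernel[OF L])
  ultimately show ?thesis unfolding upper_semi_fredholm_def by blast
qed

end
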